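(* Let $\mathcal L$ be the operator in $L_2(\mathbb R^d)$ given by $(\mathcal L u)(x)=\int_{\mathbb R^d}a(x-y)u(y)\,dy+V(x)u(x)$, where $a$ and $V$ satisfy the standing assumptions in the context, and set $\mu_0:=\min\{a_{\min},V_{\min}\}$, $\mu_1:=\max\{a_{\max},V_{\max}\}$. Then the essential spectrum of $\mathcal L$ coincides with the segment $[\mu_0,\mu_1]$. The discrete spectrum of $\mathcal L$ can be located only in the semi-intervals $[a_{\min}+V_{\min},\mu_0)$ and $(\mu_1,a_{\max}+V_{\max}]$, and it can accumulate only to the points $\mu_0$ and $\mu_1$.
   Context: Let $d\ge 1$. Standing assumptions: $a\in L_1(\mathbb R^d)$ is complex-valued with $a(-x)=\overline{a(x)}$; $V=\mathcal F[\hat V]$ for some $\hat V\in L_1(\mathbb R^d)$ with $\hat V(-x)=\overline{\hat V(x)}$, where $\mathcal F[u](x):=\int_{\mathbb R^d}u(\xi)e^{-\mathrm i x\cdot\xi}\,d\xi$. Put $\hat a:=\mathcal F[a]$. Then $\hat a$ and $V$ are real-valued, bounded, continuous and tend to zero at infinity. Define $a_{\min}:=\inf_{\mathbb R^d}\hat a$, $a_{\max}:=\sup_{\mathbb R^d}\hat a$, $V_{\min}:=\inf_{\mathbb R^d}V$, $V_{\max}:=\sup_{\mathbb R^d}V$; one has $a_{\min}\le 0\le a_{\max}$ and $V_{\min}\le 0\le V_{\max}$. The operator $\mathcal L$ is bounded and self-adjoint in $L_2(\mathbb R^d)$. *)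

theory Defs
  imports "HOL-Analysis.Analysis"
begin

text \<open>
  The space \<open>L\<^sub>2(M)\<close> of complex-valued functions is handled through representatives:
  its elements are the functions in \<open>L2 M\<close>, and two of them are the same element
  when they agree almost everywhere (\<open>ae_eq M\<close>).  An operator on \<open>L\<^sub>2(M)\<close> is a map on functions
  that sends \<open>L2 M\<close> into itself and respects \<open>ae_eq M\<close>.
\<close>

definition L2 :: "'a measure \<Rightarrow> ('a \<Rightarrow> complex) set" where
  "L2 M = {u \<in> borel_measurable M. integrable M (\<lambda>x. (cmod (u x))\<^sup>2)}"

definition L2_norm_on :: "'a measure \<Rightarrow> ('a \<Rightarrow> complex) \<Rightarrow> real" where
  "L2_norm_on M u = sqrt (\<integral>x. (cmod (u x))\<^sup>2 \<partial>M)"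

definition ae_eq :: "'a measure \<Rightarrow> ('a \<Rightarrow> complex) \<Rightarrow> ('a \<Rightarrow> complex) \<Rightarrow> bool" where
  "ae_eq M u v \<longleftrightarrow> (AE x in M. u x = v x)"

text \<open>
  \<open>z\<close> is in the resolvent set when \<open>T - z\<close> is a bijection of \<open>L\<^sub>2(M)\<close> onto itself
  whose inverse is bounded (by \<open>C\<close>).
\<close>

definition resolvent_set ::
    "'a measure \<Rightarrow> (('a \<Rightarrow> complex) \<Rightarrow> ('a \<Rightarrow> complex)) \<Rightarrow> complex set" where
  "resolvent_set M T =
    {z. \<exists>C. \<forall>f\<in>L2 M. \<exists>u\<in>L2 M.
          ae_eq M (\<lambda>x. T u x - z * u x) f \<and>
          L2_norm_on M u \<le> C * L2_norm_on M f \<and>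
          (\<forall>v\<in>L2 M. ae_eq M (\<lambda>x. T v x - z * v x) f \<longrightarrow> ae_eq M v u)}"

definition spectrum ::
    "'a measure \<Rightarrow> (('a \<Rightarrow> complex) \<Rightarrow> ('a \<Rightarrow> complex)) \<Rightarrow> complex set" where
  "spectrum M T = - resolvent_set M T"

definition eigenspace ::
    "'a measure \<Rightarrow> (('a \<Rightarrow> complex) \<Rightarrow> ('a \<Rightarrow> complex)) \<Rightarrow> complex \<Rightarrow> ('a \<Rightarrow> complex) set" where
  "eigenspace M T z = {u \<in> L2 M. ae_eq M (T u) (\<lambda>x. z * u x)}"

definition is_eigenvalue ::
    "'a measure \<Rightarrow> (('a \<Rightarrow> complex) \<Rightarrow> ('a \<Rightarrow> complex)) \<Rightarrow> complex \<Rightarrow> bool" where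
  "is_eigenvalue M T z \<longleftrightarrow> (\<exists>u\<in>eigenspace M T z. \<not> ae_eq M u (\<lambda>x. 0))"

text \<open>Finite dimension over the complex numbers, modulo equality almost everywhere.\<close>

definition finite_dim_ae :: "'a measure \<Rightarrow> ('a \<Rightarrow> complex) set \<Rightarrow> bool" where
  "finite_dim_ae M E \<longleftrightarrow>
    (\<exists>B. finite B \<and> B \<subseteq> E \<and> (\<forall>u\<in>E. \<exists>c. ae_eq M u (\<lambda>x. \<Sum>b\<in>B. c b * b x)))"

text \<open>
  For a self-adjoint operator: the discrete spectrum consists of the isolated points of the
  spectrum that are eigenvalues of finite multiplicity, and the essential spectrum is the rest.
\<close>

definition discrete_spectrum ::
    "'a measure \<Rightarrow> (('a \<Rightarrow> complex) \<Rightarrow> ('a \<Rightarrow> complex)) \<Rightarrow> complex set" where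
  "discrete_spectrum M T =
    {z. z isolated_in spectrum M T \<and> is_eigenvalue M T z \<and> finite_dim_ae M (eigenspace M T z)}"

definition essential_spectrum ::
    "'a measure \<Rightarrow> (('a \<Rightarrow> complex) \<Rightarrow> ('a \<Rightarrow> complex)) \<Rightarrow> complex set" where
  "essential_spectrum M T = spectrum M T - discrete_spectrum M T"

definition fourier :: "(real ^ 'd \<Rightarrow> complex) \<Rightarrow> real ^ 'd \<Rightarrow> complex" where
  "fourier u x = (\<integral>\<xi>. u \<xi> * exp (- \<i> * complex_of_real (x \<bullet> \<xi>)) \<partial>lebesgue)"

definition hermitian :: "(real ^ 'd \<Rightarrow> complex) \<Rightarrow> bool" where
  "hermitian u \<longleftrightarrow> (AE x in lebesgue. u (- x) = cnj (u x))"

text \<open>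
  For \<open>a\<close> in \<open>L\<^sub>1\<close> and \<open>u\<close> in \<open>L\<^sub>2\<close> the convolution integral converges for almost every \<open>x\<close>;
  on the exceptional null set the Bochner integral is \<open>0\<close> by convention.
\<close>

definition conv_potential_op ::
    "(real ^ 'd \<Rightarrow> complex) \<Rightarrow> (real ^ 'd \<Rightarrow> complex) \<Rightarrow>
     (real ^ 'd \<Rightarrow> complex) \<Rightarrow> (real ^ 'd \<Rightarrow> complex)" where
  "conv_potential_op a V u = (\<lambda>x. (\<integral>y. a (x - y) * u y \<partial>lebesgue) + V x * u x)"

text \<open>
  Infimum and supremum over the whole space of a complex function that takes real values,
  such as the Fourier transform of an integrable hermitian function (\<open>fourier_hermitian_real\<close>).
\<close>

definition real_inf :: "('a \<Rightarrow> complex) \<Rightarrow> real" where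
  "real_inf f = (INF x. Re (f x))"

definition real_sup :: "('a \<Rightarrow> complex) \<Rightarrow> real" where
  "real_sup f = (SUP x. Re (f x))"

lemma uminus_measurable_lebesgue: "uminus \<in> lebesgue \<rightarrow>\<^sub>M (lebesgue :: (real ^ 'd) measure)"
  using lebesgue_affine_measurable[of "\<lambda>_. -1" "0 :: real ^ 'd"]
  by (simp add: scaleR_sum_right [symmetric] euclidean_representation sum_negf)

lemma distr_lebesgue_uminus: "distr lebesgue lebesgue uminus = (lebesgue :: (real ^ 'd) measure)"
  using lebesgue_affine_euclidean[of "\<lambda>_. -1" "0 :: real ^ 'd"]
  by (simp add: scaleR_sum_right [symmetric] euclidean_representation sum_negf density_1)

lemma fourier_hermitian_real:
  assumes herm: "hermitian u" and int: "integrable lebesgue u"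
  shows "fourier u x \<in> \<real>"
proof -
  let ?e = "\<lambda>\<xi>. exp (- \<i> * complex_of_real (x \<bullet> \<xi>))"
  have u: "u \<in> borel_measurable lebesgue" using int by simp
  have u': "(\<lambda>\<xi>. u (- \<xi>)) \<in> borel_measurable lebesgue"
    using measurable_compose[OF uminus_measurable_lebesgue u] .
  have e: "?e \<in> borel_measurable lebesgue"
  proof (rule measurable_completion)
    have "?e \<in> borel_measurable borel"
      by (intro borel_measurable_continuous_onI continuous_intros)
    then show "?e \<in> borel_measurable lborel" by simp
  qed
  have e': "(\<lambda>\<xi>. ?e (- \<xi>)) \<in> borel_measurable lebesgue"
    by (rule measurable_compose[OF uminus_measurable_lebesgue e])
  have cu: "(\<lambda>\<xi>. cnj (u \<xi>)) \<in> borel_measurable lebesgue"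
    by (rule measurable_compose[OF u]) (intro borel_measurable_continuous_onI continuous_intros)
  have "cnj (fourier u x) = (\<integral>\<xi>. cnj (u \<xi>) * ?e (- \<xi>) \<partial>lebesgue)"
    unfolding fourier_def by (subst Bochner_Integration.integral_cnj [symmetric]) (simp add: exp_cnj del: Bochner_Integration.integral_cnj)
  also have "\<dots> = (\<integral>\<xi>. u (- \<xi>) * ?e (- \<xi>) \<partial>lebesgue)"
    using herm unfolding hermitian_def
    by (intro integral_cong_AE borel_measurable_times cu u' e') auto
  also have "\<dots> = (\<integral>\<xi>. u \<xi> * ?e \<xi> \<partial>distr lebesgue lebesgue uminus)"
    by (rule integral_distr [symmetric])
      (intro uminus_measurable_lebesgue borel_measurable_times u e)+
  also have "\<dots> = fourier u x"
    unfolding distr_lebesgue_uminus fourier_def ..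
  finally show ?thesis by (simp add: Reals_cnj_iff)
qed

end

theory Submission
  imports Defs "HOL-Probability.Characteristic_Functions" "HOL-Complex_Analysis.Great_Picard"
begin

text \<open>
  Write \<open>A\<close> for convolution with \<open>a\<close>.  The product \<open>A V\<close> is compact, because \<open>a\<close> is an \<open>L\<^sub>1\<close> limit of
  compactly supported continuous kernels and \<open>V\<close> vanishes at infinity, and
  \<open>- z (A + V - z) = (A - z) (V - z) - A V\<close>.  For real \<open>z\<close> outside the segment both factors are
  bounded below, so a bounded sequence \<open>u\<^sub>n\<close> with \<open>(A + V - z) u\<^sub>n \<rightarrow> 0\<close> has a convergent subsequence.
  Hence such a \<open>z\<close> is in the resolvent set or an eigenvalue of finite multiplicity, and eigenvalues
  cannot accumulate at \<open>z\<close>, since the eigenvectors would form an orthonormal sequence.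
  Conversely, truncated plane waves far from the origin are approximate eigenvectors for the values
  of the Fourier transform of \<open>a\<close>, and indicators of small balls for the values of \<open>V\<close>.
  The bounds \<open>a_min \<le> A \<le> a_max\<close> come from the positivity of the Fourier transform of
  \<open>a * u * u\<^sup>* - a_min (u * u\<^sup>*)\<close>, tested against Gaussians.
\<close>

section \<open>Symmetric operators on Hilbert spaces\<close>

text \<open>Both \<open>fourier a\<close> and V tend to 0 at infinity, so [a_min, a_max] and
  [V_min, V_max] both contain 0. This fact does two jobs. The union of the two intervals is the
  whole segment, so each of its points is approximated by values of one of the two functions. And a
  point z outside the segment is nonzero, as the factorisation with the factor - z demands. An
  approximate eigenvector for one summand has to be nearly invisible to the other: a plane wave is
  moved to where V is small, and a small ball carries too little L1 mass for the convolution to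
  matter. Invertibility of T - z is obtained without a spectral theorem, from a lower bound for T -
  z and a trivial kernel of its adjoint. The Hilbert space is treated as a real one with product Re
  <x, y>; multiplication by the imaginary unit becomes a skew map J that commutes with T, and a
  complex z acts as Re z + Im z J. A point of a nondegenerate segment is never isolated in the
  spectrum. If the segment is {0}, however, then T = 0 and 0 is an isolated eigenvalue; it is
  essential only because L2 has infinite dimension.\<close>

lemma norm_diff_square:
  fixes x y :: "'h::real_inner"
  shows "(norm (x - y))\<^sup>2 = (norm x)\<^sup>2 - 2 * inner x y + (norm y)\<^sup>2"
  by (simp add: power2_norm_eq_inner inner_diff_left inner_diff_right inner_commute)

text \<open>Lax-Milgram by Banach's fixed point theorem: a solution of B x = y is a fixed point of x
  -> x - t (B x - y), and coercivity makes this map a contraction for a suitable t > 0.\<close>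

lemma coercive_surj:
  fixes B :: "'h::{real_inner,complete_space} \<Rightarrow> 'h"
  assumes B: "bounded_linear B" and c: "c > 0" and coercive: "\<And>x. c * (norm x)\<^sup>2 \<le> inner (B x) x"
  shows "surj B"
proof -
  interpret B: bounded_linear B by fact
  obtain M where M: "M > 0" "\<And>x. norm (B x) \<le> norm x * M"
    using B.pos_bounded by blast
  \<comment> \<open>Enlarging the bound by c forces c / M' < 1, so that q below is a contraction
    constant in [0, 1).\<close>
  define M' where "M' = M + c"
  have M': "M' > c" "M' > 0" "norm (B x) \<le> norm x * M'" for x
    using M(1) c order_trans[OF M(2)[of x], of "norm x * M'"] by (auto simp: M'_def mult_left_mono)
  \<comment> \<open>This t minimises 1 - 2 t c + t^2 M'^2, and the minimum is q^2.\<close>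
  define t where "t = c / M'\<^sup>2"
  define q where "q = sqrt (1 - (c / M')\<^sup>2)"
  have cM: "(c / M')\<^sup>2 < 1" "0 < (c / M')\<^sup>2"
    using c M' by (auto simp: power_less_one_iff abs_square_less_1)
  have q: "0 \<le> q" "q < 1" using cM by (auto simp: q_def)
  have t: "t > 0" using c M' by (simp add: t_def)
  have contr: "norm (x - t *\<^sub>R B x) \<le> q * norm x" for x
  proof -
    have "(norm (x - t *\<^sub>R B x))\<^sup>2 = (norm x)\<^sup>2 - 2 * t * inner (B x) x + t\<^sup>2 * (norm (B x))\<^sup>2"
      by (simp add: norm_diff_square inner_commute power_mult_distrib)
    also have "\<dots> \<le> (norm x)\<^sup>2 - 2 * t * (c * (norm x)\<^sup>2) + t\<^sup>2 * (norm x * M')\<^sup>2"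
      using t by (intro add_mono diff_mono mult_left_mono coercive power_mono M'(3)) auto
    also have "\<dots> = (1 - 2 * (t * c) + t\<^sup>2 * M'\<^sup>2) * (norm x)\<^sup>2"
      by (simp add: power_mult_distrib left_diff_distrib distrib_right)
    also have "\<dots> = (q * norm x)\<^sup>2"
    proof -
      have "t * c = (c / M')\<^sup>2" "t\<^sup>2 * M'\<^sup>2 = (c / M')\<^sup>2"
        using M'(2) by (simp_all add: t_def power2_eq_square)
      moreover have "q\<^sup>2 = 1 - (c / M')\<^sup>2" using cM by (simp add: q_def)
      ultimately show ?thesis by (simp add: power_mult_distrib)
    qed
    finally show ?thesis
      using q by (auto intro: power2_le_imp_le)
  qed
  show ?thesis
  proof (rule surjI)
    fix y
    define f where "f x = x - t *\<^sub>R (B x - y)" for x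
    have "\<exists>!x. f x = x"
    proof (rule banach_fix_type[OF q])
      show "\<forall>x z. dist (f x) (f z) \<le> q * dist x z"
      proof (intro allI)
        fix x z
        have "f x - f z = (x - z) - t *\<^sub>R B (x - z)"
          by (simp add: f_def B.diff algebra_simps)
        then show "dist (f x) (f z) \<le> q * dist x z"
          using contr[of "x - z"] by (simp add: dist_norm)
      qed
    qed
    then show "B (THE x. f x = x) = y"
    proof -
      assume *: "\<exists>!x. f x = x"
      have "f (THE x. f x = x) = (THE x. f x = x)" using theI'[OF *] .
      then show ?thesis using t by (simp add: f_def)
    qed
  qed
qed

text \<open>The composition S' S is coercive, because inner (S' (S x)) x is the square of norm (S
  x). Solving S' (S x) = S' y puts y - S x into the trivial kernel of S'.\<close>

lemma bounded_below_surj: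
  fixes S S' :: "'h::{real_inner,complete_space} \<Rightarrow> 'h"
  assumes S: "bounded_linear S" and S': "bounded_linear S'"
    and adj: "\<And>x y. inner (S x) y = inner x (S' y)"
    and c: "c > 0" and below: "\<And>x. c * norm x \<le> norm (S x)"
    and ker: "\<And>x. S' x = 0 \<Longrightarrow> x = 0"
  shows "surj S"
proof -
  interpret S': bounded_linear S' by fact
  have surj: "surj (\<lambda>x. S' (S x))"
  proof (rule coercive_surj)
    show "bounded_linear (\<lambda>x. S' (S x))" using bounded_linear_compose[OF S' S] .
    show "c\<^sup>2 * (norm x)\<^sup>2 \<le> inner (S' (S x)) x" for x
      using power_mono[OF below[of x], of 2] c
      by (subst inner_commute) (simp add: adj[symmetric] power2_norm_eq_inner[symmetric] power_mult_distrib)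
  qed (use c in simp)
  show ?thesis
  proof (unfold surj_def, intro allI)
    fix y
    obtain x where "S' y = S' (S x)"
      using surj unfolding surj_def by blast
    then have "S' (y - S x) = 0" by (simp add: S'.diff)
    then show "\<exists>x. y = S x" using ker[of "y - S x"] by auto
  qed
qed

text \<open>Two distinct orthonormal vectors are at distance sqrt 2, so no subsequence is
  Cauchy.\<close>

lemma orthonormal_not_convergent:
  fixes e :: "nat \<Rightarrow> 'h::real_inner"
  assumes "\<And>n. norm (e n) = 1" "\<And>m n. m \<noteq> n \<Longrightarrow> inner (e m) (e n) = 0" "strict_mono r"
  shows "\<not> convergent (e \<circ> r)"
proof
  assume "convergent (e \<circ> r)"
  then have "Cauchy (e \<circ> r)" by (rule convergent_Cauchy)
  then obtain N where N: "\<And>m n. m \<ge> N \<Longrightarrow> n \<ge> N \<Longrightarrow> norm (e (r m) - e (r n)) < 1"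
    unfolding Cauchy_iff by (metis comp_apply zero_less_one)
  have ne: "r (Suc N) \<noteq> r N" using assms(3) by (metis lessI less_irrefl strict_mono_less)
  have "(norm (e (r (Suc N)) - e (r N)))\<^sup>2 = 2"
    using assms(1)[of "r N"] assms(1)[of "r (Suc N)"] assms(2)[OF ne] assms(2)[OF ne[symmetric]]
    by (simp add: power2_norm_eq_inner inner_diff_left inner_diff_right norm_eq_1)
  moreover have "(norm (e (r (Suc N)) - e (r N)))\<^sup>2 < 1"
    using N[of "Suc N" N] by (simp add: power_less_one_iff abs_square_less_1)
  ultimately show False by simp
qed

text \<open>Gram-Schmidt by dependent choice: the finitely many vectors found so far never span E,
  so a further one can be taken.\<close>

lemma infinite_orthonormal_sequence:
  fixes E :: "'h::real_inner set"
  assumes E: "subspace E" and inf: "\<And>B. finite B \<Longrightarrow> B \<subseteq> E \<Longrightarrow> \<not> E \<subseteq> span B"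
  obtains e :: "nat \<Rightarrow> 'h" where "range e \<subseteq> E" "\<And>n. norm (e n) = 1"
    "\<And>m n. m \<noteq> n \<Longrightarrow> inner (e m) (e n) = 0"
proof -
  define P where "P f n r \<longleftrightarrow> r \<in> E \<and> norm r = 1 \<and> (\<forall>m<n. inner (f m) r = 0)" for f :: "nat \<Rightarrow> 'h" and n r
  have "\<exists>f. \<forall>n. P f n (f n)"
  proof (rule dependent_wellorder_choice)
    fix f :: "nat \<Rightarrow> 'h" and n :: nat
    assume f: "\<And>m. m < n \<Longrightarrow> P f m (f m)"
    have orth: "inner (f j) (f k) = (if j = k then 1 else 0)" if "j < n" "k < n" for j k
    proof (cases j k rule: linorder_cases)
      case less then show ?thesis using f[OF that(2)] by (auto simp: P_def)
    next
      case equal then show ?thesis using f[OF that(2)] by (auto simp: P_def norm_eq_1)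
    next
      case greater then show ?thesis using f[OF that(1)] by (auto simp: P_def inner_commute)
    qed
    have fE: "f ` {..<n} \<subseteq> E" using f by (auto simp: P_def)
    obtain x where x: "x \<in> E" "x \<notin> span (f ` {..<n})"
      using inf[OF _ fE] by auto
    \<comment> \<open>Removing the components along the earlier vectors leaves a vector orthogonal
      to them; it is nonzero because x lies outside their span.\<close>
    define y where "y = x - (\<Sum>k<n. inner (f k) x *\<^sub>R f k)"
    have s: "(\<Sum>k<n. inner (f k) x *\<^sub>R f k) \<in> span (f ` {..<n})"
      by (intro span_sum span_scale span_base) auto
    have y: "y \<in> E"
      unfolding y_def using fE x(1) by (intro subspace_diff E subspace_sum subspace_scale) auto
    have y0: "y \<noteq> 0" using x(2) s by (auto simp: y_def)
    have "inner (f m) y = 0" if "m < n" for m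
    proof -
      have "inner (f m) y = inner (f m) x - (\<Sum>k<n. inner (f k) x * inner (f m) (f k))"
        by (simp add: y_def inner_diff_right inner_sum_right)
      also have "(\<Sum>k<n. inner (f k) x * inner (f m) (f k)) = (\<Sum>k<n. if k = m then inner (f k) x else 0)"
        using that by (intro sum.cong) (auto simp: orth)
      finally show ?thesis using that by (simp add: sum.delta)
    qed
    then have "P f n (y /\<^sub>R norm y)"
      using y y0 E by (auto simp: P_def subspace_scale)
    then show "\<exists>r. P f n r" by blast
  qed (auto simp: P_def)
  then obtain f where f: "\<And>n. P f n (f n)" by blast
  show ?thesis
  proof
    show "inner (f m) (f n) = 0" if "m \<noteq> n" for m n
      using that f[of m] f[of n] by (cases m n rule: linorder_cases) (auto simp: P_def inner_commute)
  qed (use f in \<open>auto simp: P_def\<close>)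
qed

text \<open>\<open>J\<close> is multiplication by \<open>\<i>\<close> on a complex Hilbert space with real inner product \<open>Re \<langle>x, y\<rangle>\<close>.\<close>

locale complex_symmetric_operator =
  fixes T J :: "'h::{real_inner,complete_space} \<Rightarrow> 'h"
  assumes T: "bounded_linear T" and symmetric: "inner (T x) y = inner x (T y)"
    and J: "bounded_linear J" and J_J: "J (J x) = - x" and skew: "inner (J x) y = - inner x (J y)"
    and T_J: "T (J x) = J (T x)"
begin

sublocale T: bounded_linear T by (rule T)
sublocale J: bounded_linear J by (rule J)

definition scaleC :: "complex \<Rightarrow> 'h \<Rightarrow> 'h" where
  "scaleC z x = Re z *\<^sub>R x + Im z *\<^sub>R J x"

text \<open>Membership in the resolvent set, transcribed from representatives to the abstract space;
  \<open>resolvent_set_eq\<close> provides the link.\<close>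

definition regular :: "complex \<Rightarrow> bool" where
  "regular z \<longleftrightarrow> (\<exists>C. \<forall>f. \<exists>u. T u - scaleC z u = f \<and> norm u \<le> C * norm f \<and>
    (\<forall>v. T v - scaleC z v = f \<longrightarrow> v = u))"

text \<open>Sequential form of the statement that T - z has closed range and a finite-dimensional
  kernel: there is no singular sequence in the sense of Weyl's criterion.\<close>

definition compact_resolving :: "real \<Rightarrow> bool" where
  "compact_resolving z \<longleftrightarrow> (\<forall>u. bounded (range u) \<longrightarrow> (\<lambda>n::nat. T (u n) - z *\<^sub>R u n) \<longlonglongrightarrow> 0 \<longrightarrow>
     (\<exists>r. strict_mono r \<and> convergent (u \<circ> r)))"

lemma bounded_linear_shift: "bounded_linear (\<lambda>u. T u - scaleC z u)"
  unfolding scaleC_def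
  by (intro bounded_linear_sub bounded_linear_add T bounded_linear_scaleR_right
      bounded_linear_compose[OF bounded_linear_scaleR_right J])

lemma adjoint_shift: "inner (T x - scaleC z x) y = inner x (T y - scaleC (cnj z) y)"
  by (simp add: scaleC_def inner_diff_left inner_diff_right inner_add_left inner_add_right symmetric skew)

lemma norm_J: "norm (J x) = norm x"
  by (simp add: norm_eq_sqrt_inner skew J_J)

text \<open>The vector T u - Re z u is orthogonal to J u, since inner u (J u) and inner (T u) (J u)
  each equal their own negative. By Pythagoras, subtracting Im z J u leaves at least the norm of
  that term.\<close>

lemma norm_shift_ge: "\<bar>Im z\<bar> * norm u \<le> norm (T u - scaleC z u)"
proof -
  define w where "w = T u - Re z *\<^sub>R u"
  have uJ: "inner u (J u) = 0"
    using skew[of u u] by (simp add: inner_commute)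
  have "inner (T u) (J u) = 0"
    using symmetric[of u "J u"] skew[of u "T u"] by (simp add: T_J inner_commute)
  with uJ have "inner w (J u) = 0" by (simp add: w_def inner_diff_left)
  then have "(norm (w - Im z *\<^sub>R J u))\<^sup>2 = (norm w)\<^sup>2 + (Im z)\<^sup>2 * (norm (J u))\<^sup>2"
    by (simp add: norm_diff_square power_mult_distrib)
  then have "(\<bar>Im z\<bar> * norm u)\<^sup>2 \<le> (norm (w - Im z *\<^sub>R J u))\<^sup>2"
    by (simp add: norm_J power_mult_distrib)
  moreover have "w - Im z *\<^sub>R J u = T u - scaleC z u"
    by (simp add: w_def scaleC_def)
  ultimately show ?thesis
    by (metis norm_ge_zero power2_le_imp_le)
qed

text \<open>The adjoint of T - z is T - \<open>cnj z\<close>, which is why the kernel is examined at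
  the conjugate point. The lower bound gives uniqueness and the norm of the inverse.\<close>

lemma regularI:
  assumes c: "c > 0" and below: "\<And>x. c * norm x \<le> norm (T x - scaleC z x)"
    and ker: "\<And>x. T x = scaleC (cnj z) x \<Longrightarrow> x = 0"
  shows "regular z"
proof -
  interpret S: bounded_linear "\<lambda>u. T u - scaleC z u" by (rule bounded_linear_shift)
  have "surj (\<lambda>u. T u - scaleC z u)"
    by (rule bounded_below_surj[OF bounded_linear_shift bounded_linear_shift adjoint_shift c below])
       (use ker in auto)
  show ?thesis
    unfolding regular_def
  proof (rule exI, rule allI)
    fix f
    obtain u where u: "f = T u - scaleC z u"
      using \<open>surj _\<close> by (rule surjE)
    show "\<exists>u. T u - scaleC z u = f \<and> norm u \<le> inverse c * norm f \<and> (\<forall>v. T v - scaleC z v = f \<longrightarrow> v = u)"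
    proof (intro exI conjI allI impI)
      show "norm u \<le> inverse c * norm f"
        using below[of u] c by (simp add: u field_simps)
      fix v assume "T v - scaleC z v = f"
      then have "T (v - u) - scaleC z (v - u) = 0"
        using S.diff[of v u] u by simp
      then show "v = u" using below[of "v - u"] c by (simp add: mult_le_0_iff)
    qed (simp add: u)
  qed
qed

lemma regular_bounded_below:
  assumes "regular z"
  obtains c where "c > 0" "\<And>u. c * norm u \<le> norm (T u - scaleC z u)"
proof -
  obtain C where C: "\<And>f. \<exists>u. T u - scaleC z u = f \<and> norm u \<le> C * norm f \<and> (\<forall>v. T v - scaleC z v = f \<longrightarrow> v = u)"
    using assms unfolding regular_def by blast
  have "norm u \<le> C * norm (T u - scaleC z u)" for u
    using C[of "T u - scaleC z u"] by metis
  \<comment> \<open>C may be zero or negative, whereas |C| + 1 has a positive inverse.\<close>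
  moreover have "C * norm (T u - scaleC z u) \<le> (\<bar>C\<bar> + 1) * norm (T u - scaleC z u)" for u
    by (intro mult_right_mono) auto
  ultimately have "norm u \<le> (\<bar>C\<bar> + 1) * norm (T u - scaleC z u)" for u
    using order_trans by blast
  then show ?thesis
    by (intro that[of "inverse (\<bar>C\<bar> + 1)"]) (auto simp: field_simps)
qed

lemma regular_nonreal: "Im z \<noteq> 0 \<Longrightarrow> regular z"
proof (rule regularI[of "\<bar>Im z\<bar>"])
  show "x = 0" if "Im z \<noteq> 0" "T x = scaleC (cnj z) x" for x
    using norm_shift_ge[of "cnj z" x] that by (simp add: mult_le_0_iff)
qed (auto intro: norm_shift_ge)

lemma scaleC_of_real [simp]: "scaleC (complex_of_real x) u = x *\<^sub>R u"
  by (simp add: scaleC_def)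

text \<open>If T - z were not bounded below, there would be unit vectors whose images tend to 0. The
  limit of a convergent subsequence is then a unit vector in the kernel.\<close>

lemma regular_real:
  assumes z: "compact_resolving z" and ker: "\<And>x. T x = z *\<^sub>R x \<Longrightarrow> x = 0"
  shows "regular (complex_of_real z)"
proof -
  have "\<exists>c>0. \<forall>x. c * norm x \<le> norm (T x - z *\<^sub>R x)"
  proof (rule ccontr)
    assume *: "\<not> ?thesis"
    have "\<exists>x. norm x = 1 \<and> norm (T x - z *\<^sub>R x) < 1 / Suc n" for n
    proof -
      obtain x where x: "norm (T x - z *\<^sub>R x) < 1 / Suc n * norm x"
        using * by (metis linorder_not_le of_nat_0_less_iff zero_less_Suc zero_less_divide_1_iff)
      then have "x \<noteq> 0" by auto
      have "T (x /\<^sub>R norm x) - z *\<^sub>R (x /\<^sub>R norm x) = (T x - z *\<^sub>R x) /\<^sub>R norm x"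
        by (simp add: T.scaleR scaleR_diff_right)
      then have "norm (T (x /\<^sub>R norm x) - z *\<^sub>R (x /\<^sub>R norm x)) = norm (T x - z *\<^sub>R x) / norm x"
        by (simp only: norm_scaleR) (simp add: divide_inverse)
      also have "\<dots> < 1 / Suc n"
        using x \<open>x \<noteq> 0\<close> by (simp add: divide_less_eq)
      finally show ?thesis
        using \<open>x \<noteq> 0\<close> by (intro exI[of _ "x /\<^sub>R norm x"]) simp
    qed
    then obtain u where u: "\<And>n. norm (u n) = 1" "\<And>n. norm (T (u n) - z *\<^sub>R u n) < 1 / Suc n"
      by metis
    have lim: "(\<lambda>n. T (u n) - z *\<^sub>R u n) \<longlonglongrightarrow> 0"
      by (rule tendsto_norm_zero_cancel, rule tendsto_sandwich[OF _ _ tendsto_const LIMSEQ_inverse_real_of_nat])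
        (use u(2) in \<open>auto simp: inverse_eq_divide less_imp_le intro!: always_eventually\<close>)
    moreover have "bounded (range u)" using u(1) by (auto simp: bounded_iff)
    ultimately obtain r l where r: "strict_mono r" "(u \<circ> r) \<longlonglongrightarrow> l"
      using z unfolding compact_resolving_def convergent_def by blast
    have "(\<lambda>n. T ((u \<circ> r) n) - z *\<^sub>R (u \<circ> r) n) \<longlonglongrightarrow> T l - z *\<^sub>R l"
      by (intro tendsto_intros T.tendsto r)
    moreover have "(\<lambda>n. T ((u \<circ> r) n) - z *\<^sub>R (u \<circ> r) n) \<longlonglongrightarrow> 0"
      using LIMSEQ_subseq_LIMSEQ[OF lim r(1)] by (simp add: o_def)
    ultimately have "T l - z *\<^sub>R l = 0" by (rule LIMSEQ_unique)
    then have "l = 0" using ker by simp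
    moreover have "norm l = 1"
      using tendsto_norm[OF r(2)] u(1) by (simp add: LIMSEQ_const_iff)
    ultimately show False by simp
  qed
  then show ?thesis
    using ker by (auto intro: regularI)
qed

text \<open>An orthonormal sequence of eigenvectors is annihilated by T - z, so
  \<open>compact_resolving\<close> would extract a convergent subsequence from it. The span is over
  the reals.\<close>

lemma finite_dim_eigenspace:
  assumes z: "compact_resolving z"
  shows "\<exists>B. finite B \<and> B \<subseteq> {x. T x = z *\<^sub>R x} \<and> {x. T x = z *\<^sub>R x} \<subseteq> span B"
proof (rule ccontr)
  assume "\<not> ?thesis"
  then have inf: "\<not> {x. T x = z *\<^sub>R x} \<subseteq> span B" if "finite B" "B \<subseteq> {x. T x = z *\<^sub>R x}" for B
    using that by blast
  have sub: "subspace {x. T x = z *\<^sub>R x}"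
    by (auto simp: subspace_def T.zero T.add T.scaleR scaleR_add_right)
  obtain e :: "nat \<Rightarrow> 'h" where e: "range e \<subseteq> {x. T x = z *\<^sub>R x}" "\<And>n. norm (e n) = 1"
    "\<And>m n. m \<noteq> n \<Longrightarrow> inner (e m) (e n) = 0"
    using infinite_orthonormal_sequence[OF sub inf] by metis
  have "(\<lambda>n. T (e n) - z *\<^sub>R e n) \<longlonglongrightarrow> 0" using e(1) by (auto simp: image_subset_iff)
  moreover have "bounded (range e)" using e(2) by (auto simp: bounded_iff)
  ultimately obtain r where "strict_mono r" "convergent (e \<circ> r)"
    using z unfolding compact_resolving_def by blast
  then show False using orthonormal_not_convergent[of e r] e(2,3) by blast
qed

lemma eigenvalues_isolated:
  assumes z: "compact_resolving z"
  shows "\<exists>d>0. \<forall>w x. w \<noteq> z \<longrightarrow> \<bar>w - z\<bar> < d \<longrightarrow> T x = w *\<^sub>R x \<longrightarrow> x = 0"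
proof (rule ccontr)
  assume *: "\<not> ?thesis"
  define P where "P w \<longleftrightarrow> w \<noteq> z \<and> (\<exists>x. norm x = 1 \<and> T x = w *\<^sub>R x)" for w
  have step: "\<exists>w. P w \<and> \<bar>w - z\<bar> < d" if "d > 0" for d
  proof -
    have "\<not> (\<forall>w x. w \<noteq> z \<longrightarrow> \<bar>w - z\<bar> < d \<longrightarrow> T x = w *\<^sub>R x \<longrightarrow> x = 0)"
      using * that by blast
    then obtain w x where w: "w \<noteq> z" "\<bar>w - z\<bar> < d" "T x = w *\<^sub>R x" "x \<noteq> 0"
      by blast
    then have "norm (x /\<^sub>R norm x) = 1 \<and> T (x /\<^sub>R norm x) = w *\<^sub>R (x /\<^sub>R norm x)"
      by (simp add: T.scaleR)
    with w show ?thesis unfolding P_def by blast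
  qed
  \<comment> \<open>Each new eigenvalue is taken strictly closer to z, so the eigenvalues are
    pairwise distinct and symmetry makes their eigenvectors orthogonal.\<close>
  have "\<exists>w. \<forall>n::nat. (P (w n) \<and> \<bar>w n - z\<bar> < 1 / Suc n) \<and> \<bar>w (Suc n) - z\<bar> < \<bar>w n - z\<bar>"
  proof (rule dependent_nat_choice)
    show "\<exists>w. P w \<and> \<bar>w - z\<bar> < 1 / Suc 0" using step[of 1] by simp
    fix w and n :: nat assume w: "P w \<and> \<bar>w - z\<bar> < 1 / Suc n"
    then show "\<exists>v. (P v \<and> \<bar>v - z\<bar> < 1 / Suc (Suc n)) \<and> \<bar>v - z\<bar> < \<bar>w - z\<bar>"
      using step[of "min (1 / Suc (Suc n)) \<bar>w - z\<bar>"] by (auto simp: P_def)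
  qed
  then obtain w where w: "\<And>n. P (w n)" "\<And>n. \<bar>w n - z\<bar> < 1 / Suc n" "\<And>n. \<bar>w (Suc n) - z\<bar> < \<bar>w n - z\<bar>"
    by blast
  obtain e where e: "\<And>n. norm (e n) = 1" "\<And>n. T (e n) = w n *\<^sub>R e n"
    using w(1) unfolding P_def by metis
  have dec: "\<bar>w n - z\<bar> < \<bar>w m - z\<bar>" if "m < n" for m n
    using that by (induction rule: less_Suc_induct) (use w(3) in auto)
  have orth: "inner (e m) (e n) = 0" if "m \<noteq> n" for m n
  proof -
    have "w m \<noteq> w n" using dec[of m n] dec[of n m] that by (cases m n rule: linorder_cases) auto
    moreover have "w m * inner (e m) (e n) = w n * inner (e m) (e n)"
      using symmetric[of "e m" "e n"] by (simp add: e)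
    ultimately show ?thesis by simp
  qed
  have "(\<lambda>n. norm (T (e n) - z *\<^sub>R e n)) \<longlonglongrightarrow> 0"
  proof (rule tendsto_sandwich[OF _ _ tendsto_const LIMSEQ_inverse_real_of_nat])
    have "T (e n) - z *\<^sub>R e n = (w n - z) *\<^sub>R e n" for n
      by (simp add: e(2) scaleR_diff_left)
    then have "norm (T (e n) - z *\<^sub>R e n) = \<bar>w n - z\<bar>" for n
      by (simp add: e(1))
    then show "\<forall>\<^sub>F n in sequentially. norm (T (e n) - z *\<^sub>R e n) \<le> inverse (real (Suc n))"
      using w(2) by (auto simp: inverse_eq_divide less_imp_le intro!: always_eventually)
  qed auto
  then have "(\<lambda>n. T (e n) - z *\<^sub>R e n) \<longlonglongrightarrow> 0" by (rule tendsto_norm_zero_cancel)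
  moreover have "bounded (range e)" using e(1) by (auto simp: bounded_iff)
  ultimately obtain r where "strict_mono r" "convergent (e \<circ> r)"
    using z unfolding compact_resolving_def by blast
  then show False using orthonormal_not_convergent[of e r] e(1) orth by blast
qed

end

section \<open>The Hilbert space of square-integrable functions\<close>

lemma L2_measurable: "u \<in> L2 M \<Longrightarrow> u \<in> borel_measurable M"
  by (simp add: L2_def)

lemma L2_integrable_square: "u \<in> L2 M \<Longrightarrow> integrable M (\<lambda>x. (cmod (u x))\<^sup>2)"
  by (simp add: L2_def)

lemma L2I_bound:
  assumes "u \<in> borel_measurable M" "integrable M g" "\<And>x. (cmod (u x))\<^sup>2 \<le> g x"
  shows "u \<in> L2 M"
proof -
  have "norm ((cmod (u x))\<^sup>2) \<le> norm (g x)" for x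
    using assms(3)[of x] by (auto intro: order_trans[OF _ abs_ge_self])
  then have "integrable M (\<lambda>x. (cmod (u x))\<^sup>2)"
    using assms(1) by (intro Bochner_Integration.integrable_bound[OF assms(2)]) auto
  then show ?thesis using assms(1) by (simp add: L2_def)
qed

lemma L2_zero: "(\<lambda>x. 0) \<in> L2 M"
  by (simp add: L2_def)

lemma L2_add:
  assumes u: "u \<in> L2 M" and v: "v \<in> L2 M"
  shows "(\<lambda>x. u x + v x) \<in> L2 M"
proof (rule L2I_bound)
  show "integrable M (\<lambda>x. 2 * (cmod (u x))\<^sup>2 + 2 * (cmod (v x))\<^sup>2)"
    using u v by (intro Bochner_Integration.integrable_add integrable_mult_right L2_integrable_square)
  show "(cmod (u x + v x))\<^sup>2 \<le> 2 * (cmod (u x))\<^sup>2 + 2 * (cmod (v x))\<^sup>2" for x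
  proof -
    have "(cmod (u x + v x))\<^sup>2 \<le> (cmod (u x) + cmod (v x))\<^sup>2"
      by (intro power_mono norm_triangle_ineq) auto
    also have "\<dots> \<le> 2 * (cmod (u x))\<^sup>2 + 2 * (cmod (v x))\<^sup>2"
      using sum_squares_bound[of "cmod (u x)" "cmod (v x)"] by (simp add: power2_sum)
    finally show ?thesis .
  qed
qed (use u v in \<open>auto simp: L2_measurable intro: borel_measurable_add\<close>)

lemma L2_mult_bounded:
  assumes u: "u \<in> L2 M" and b: "b \<in> borel_measurable M" "\<And>x. cmod (b x) \<le> K"
  shows "(\<lambda>x. b x * u x) \<in> L2 M"
proof (rule L2I_bound)
  show "integrable M (\<lambda>x. K\<^sup>2 * (cmod (u x))\<^sup>2)"
    using u by (intro integrable_mult_right L2_integrable_square)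
  show "(cmod (b x * u x))\<^sup>2 \<le> K\<^sup>2 * (cmod (u x))\<^sup>2" for x
    using b(2)[of x] by (auto simp: norm_mult power_mult_distrib intro!: mult_right_mono power_mono)
qed (use u b in \<open>auto simp: L2_measurable intro: borel_measurable_times\<close>)

lemma L2_scale: "u \<in> L2 M \<Longrightarrow> (\<lambda>x. c * u x) \<in> L2 M"
  by (rule L2_mult_bounded[where K = "cmod c"]) auto

lemma L2_diff: "u \<in> L2 M \<Longrightarrow> v \<in> L2 M \<Longrightarrow> (\<lambda>x. u x - v x) \<in> L2 M"
  using L2_add[of u M "\<lambda>x. - 1 * v x"] L2_scale[of v M "- 1"] by simp

lemma L2_sum: "finite B \<Longrightarrow> (\<And>b. b \<in> B \<Longrightarrow> f b \<in> L2 M) \<Longrightarrow> (\<lambda>x. \<Sum>b\<in>B. f b x) \<in> L2 M"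
  by (induction B rule: finite_induct) (auto simp: L2_zero L2_add)

lemma L2_cong_AE:
  assumes "u \<in> L2 M" "v \<in> borel_measurable M" "AE x in M. u x = v x"
  shows "v \<in> L2 M"
proof -
  have "integrable M (\<lambda>x. (cmod (v x))\<^sup>2)"
    using assms by (subst integrable_cong_AE[where g = "\<lambda>x. (cmod (u x))\<^sup>2"]) (auto simp: L2_def)
  then show ?thesis using assms by (simp add: L2_def)
qed

lemma L2_iff_nn_integral:
  "u \<in> L2 M \<longleftrightarrow> u \<in> borel_measurable M \<and> (\<integral>\<^sup>+x. (cmod (u x))\<^sup>2 \<partial>M) < \<infinity>"
  by (auto simp: L2_def integrable_iff_bounded)

lemma L2_nn_integral:
  assumes "u \<in> L2 M"
  shows "(\<integral>\<^sup>+x. (cmod (u x))\<^sup>2 \<partial>M) = ennreal ((L2_norm_on M u)\<^sup>2)"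
  using assms by (subst nn_integral_eq_integral) (auto simp: L2_def L2_norm_on_def)

lemma L2_inner_integrable:
  assumes u: "u \<in> L2 M" and v: "v \<in> L2 M"
  shows "integrable M (\<lambda>x. u x \<bullet> v x)"
proof (rule Bochner_Integration.integrable_bound)
  show "integrable M (\<lambda>x. (cmod (u x))\<^sup>2 + (cmod (v x))\<^sup>2)"
    using u v by (intro Bochner_Integration.integrable_add L2_integrable_square)
  show "AE x in M. norm (u x \<bullet> v x) \<le> norm ((cmod (u x))\<^sup>2 + (cmod (v x))\<^sup>2)"
  proof (rule AE_I2)
    fix x
    have "norm (u x \<bullet> v x) \<le> cmod (u x) * cmod (v x)"
      using Cauchy_Schwarz_ineq2[of "u x" "v x"] by simp
    also have "\<dots> \<le> (cmod (u x))\<^sup>2 + (cmod (v x))\<^sup>2"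
      using sum_squares_bound[of "cmod (u x)" "cmod (v x)"]
        mult_nonneg_nonneg[OF norm_ge_zero[of "u x"] norm_ge_zero[of "v x"]] by linarith
    finally show "norm (u x \<bullet> v x) \<le> norm ((cmod (u x))\<^sup>2 + (cmod (v x))\<^sup>2)" by simp
  qed
qed (use u v in \<open>auto intro!: borel_measurable_inner simp: L2_measurable\<close>)

lemma ae_eq_refl [simp]: "ae_eq M u u"
  by (simp add: ae_eq_def)

lemma ae_eq_sym: "ae_eq M u v \<Longrightarrow> ae_eq M v u"
  by (auto simp: ae_eq_def)

lemma ae_eq_trans: "ae_eq M u v \<Longrightarrow> ae_eq M v w \<Longrightarrow> ae_eq M u w"
  by (auto simp: ae_eq_def)

\<comment> \<open>A genuine type is needed to instantiate \<open>real_inner\<close> and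
  \<open>complete_space\<close> and so to apply the abstract operator theory. The quotient is
  partial, since only functions in \<open>L2 lebesgue\<close> have a class.\<close>
quotient_type (overloaded) 'a lsq = "'a::euclidean_space \<Rightarrow> complex" /
  partial: "\<lambda>u v. u \<in> L2 lebesgue \<and> v \<in> L2 lebesgue \<and> ae_eq lebesgue u v"
  morphisms rep_lsq lsq
proof (rule part_equivpI)
  show "\<exists>x::'a \<Rightarrow> complex. x \<in> L2 lebesgue \<and> x \<in> L2 lebesgue \<and> ae_eq lebesgue x x"
    using L2_zero by (auto intro: exI[of _ "\<lambda>x. 0"])
qed (auto simp: symp_def transp_def intro: ae_eq_sym ae_eq_trans)

instantiation lsq :: (euclidean_space) real_vector
begin

lift_definition zero_lsq :: "'a lsq" is "\<lambda>x. 0" by (simp add: L2_zero)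

lift_definition plus_lsq :: "'a lsq \<Rightarrow> 'a lsq \<Rightarrow> 'a lsq" is "\<lambda>u v x. u x + v x"
  by (auto simp: L2_add ae_eq_def)

lift_definition minus_lsq :: "'a lsq \<Rightarrow> 'a lsq \<Rightarrow> 'a lsq" is "\<lambda>u v x. u x - v x"
  by (auto simp: L2_diff ae_eq_def)

lift_definition uminus_lsq :: "'a lsq \<Rightarrow> 'a lsq" is "\<lambda>u x. - u x"
  using L2_scale[of _ _ "- 1"] by (auto simp: ae_eq_def)

lift_definition scaleR_lsq :: "real \<Rightarrow> 'a lsq \<Rightarrow> 'a lsq" is "\<lambda>r u x. complex_of_real r * u x"
  by (auto simp: L2_scale ae_eq_def)

instance
proof
  fix x y z :: "'a lsq" and r s :: real
  show "x + y + z = x + (y + z)"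
    by transfer (simp add: L2_add add.assoc)
  show "x + y = y + x"
    by transfer (simp add: L2_add add.commute)
  show "0 + x = x"
    by transfer simp
  show "- x + x = 0"
    by transfer (simp add: L2_zero)
  show "x - y = x + - y"
    by transfer (simp add: L2_diff)
  show "r *\<^sub>R (x + y) = r *\<^sub>R x + r *\<^sub>R y"
    by transfer (simp add: L2_add L2_scale distrib_left)
  show "(r + s) *\<^sub>R x = r *\<^sub>R x + s *\<^sub>R x"
    by transfer (simp add: L2_add L2_scale distrib_right)
  show "r *\<^sub>R s *\<^sub>R x = (r * s) *\<^sub>R x"
    by transfer (simp add: L2_scale mult.assoc)
  show "1 *\<^sub>R x = x"
    by transfer simp
qed

end

instantiation lsq :: (euclidean_space) real_inner
begin

text \<open>The integrand is the product of two complex numbers as plane vectors, so this is the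
  real part of the Hermitian product.\<close>

lift_definition inner_lsq :: "'a lsq \<Rightarrow> 'a lsq \<Rightarrow> real" is "\<lambda>u v. \<integral>x. u x \<bullet> v x \<partial>lebesgue"
  by (intro integral_cong_AE) (auto intro!: borel_measurable_inner simp: L2_measurable ae_eq_def)

definition norm_lsq :: "'a lsq \<Rightarrow> real" where "norm_lsq x = sqrt (inner x x)"
definition dist_lsq :: "'a lsq \<Rightarrow> 'a lsq \<Rightarrow> real" where "dist_lsq x y = norm (x - y)"
definition sgn_lsq :: "'a lsq \<Rightarrow> 'a lsq" where "sgn_lsq x = x /\<^sub>R norm x"
definition uniformity_lsq :: "('a lsq \<times> 'a lsq) filter" where
  "uniformity_lsq = (INF e\<in>{0<..}. principal {(x, y). dist x y < e})"
definition open_lsq :: "'a lsq set \<Rightarrow> bool" where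
  "open_lsq S \<longleftrightarrow> (\<forall>x\<in>S. \<forall>\<^sub>F (x', y) in uniformity. x' = x \<longrightarrow> y \<in> S)"

instance
proof
  show "inner x y = inner y x" for x y :: "'a lsq"
    by transfer (simp add: inner_commute)
  show "inner (x + y) z = inner x z + inner y z" for x y z :: "'a lsq"
    by transfer (simp add: inner_add_left L2_inner_integrable)
  show "inner (scaleR r x) y = r * inner x y" for r and x y :: "'a lsq"
    by transfer (simp add: scaleR_conv_of_real[symmetric])
  show "0 \<le> inner x x" for x :: "'a lsq"
    by transfer simp
  show "inner x x = 0 \<longleftrightarrow> x = 0" for x :: "'a lsq"
  proof transfer
    fix x :: "'a \<Rightarrow> complex" assume x: "x \<in> L2 lebesgue \<and> x \<in> L2 lebesgue \<and> ae_eq lebesgue x x"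
    then show "((\<integral>y. x y \<bullet> x y \<partial>lebesgue) = 0) =
        (x \<in> L2 lebesgue \<and> (\<lambda>x. 0) \<in> L2 lebesgue \<and> ae_eq lebesgue x (\<lambda>x. 0))"
      by (subst integral_nonneg_eq_0_iff_AE) (auto simp: L2_inner_integrable L2_zero ae_eq_def)
  qed
qed (simp_all add: norm_lsq_def dist_lsq_def sgn_lsq_def uniformity_lsq_def open_lsq_def)

end

section \<open>Computing with classes through representatives\<close>

lemma lsq_eq_iff: "u \<in> L2 lebesgue \<Longrightarrow> v \<in> L2 lebesgue \<Longrightarrow> lsq u = lsq v \<longleftrightarrow> ae_eq lebesgue u v"
  using Quotient3_rel[OF Quotient3_lsq, of u v] by simp

lemma rep_lsq_L2: "rep_lsq x \<in> L2 lebesgue"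
  using Quotient3_rep_reflp[OF Quotient3_lsq, of x] by simp

lemma lsq_rep [simp]: "lsq (rep_lsq x) = x"
  using Quotient3_abs_rep[OF Quotient3_lsq] .

lemma lsq_cases: obtains u where "u \<in> L2 lebesgue" "x = lsq u"
  using that[OF rep_lsq_L2[of x]] by simp

lemma rep_lsq_ae_eq: "u \<in> L2 lebesgue \<Longrightarrow> ae_eq lebesgue (rep_lsq (lsq u)) u"
  by (simp add: rep_lsq_L2 flip: lsq_eq_iff)

lemma lsq_add: "u \<in> L2 lebesgue \<Longrightarrow> v \<in> L2 lebesgue \<Longrightarrow> lsq u + lsq v = lsq (\<lambda>x. u x + v x)"
  by (simp add: plus_lsq.abs_eq)

lemma lsq_diff: "u \<in> L2 lebesgue \<Longrightarrow> v \<in> L2 lebesgue \<Longrightarrow> lsq u - lsq v = lsq (\<lambda>x. u x - v x)"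
  by (simp add: minus_lsq.abs_eq)

lemma lsq_scaleR: "u \<in> L2 lebesgue \<Longrightarrow> r *\<^sub>R lsq u = lsq (\<lambda>x. complex_of_real r * u x)"
  by (simp add: scaleR_lsq.abs_eq)

lemma lsq_zero: "0 = lsq (\<lambda>x. 0)"
  by (simp add: zero_lsq_def)

lemma lsq_inner: "u \<in> L2 lebesgue \<Longrightarrow> v \<in> L2 lebesgue \<Longrightarrow> inner (lsq u) (lsq v) = (\<integral>x. u x \<bullet> v x \<partial>lebesgue)"
  by (simp add: inner_lsq.abs_eq)

lemma lsq_norm: "u \<in> L2 lebesgue \<Longrightarrow> norm (lsq u) = L2_norm_on lebesgue u"
  by (simp add: norm_lsq_def lsq_inner L2_norm_on_def power2_norm_eq_inner)

lemma lsq_norm_nn_integral: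
  "u \<in> L2 lebesgue \<Longrightarrow> ennreal ((norm (lsq u))\<^sup>2) = (\<integral>\<^sup>+x. (cmod (u x))\<^sup>2 \<partial>lebesgue)"
  by (simp add: L2_nn_integral lsq_norm)

section \<open>Completeness of L2\<close>

lemma L2_Fatou:
  assumes u: "\<And>n. u n \<in> L2 M" and l: "l \<in> borel_measurable M" and "K \<ge> 0"
    and lim: "AE x in M. (\<lambda>n. u n x) \<longlonglongrightarrow> l x"
    and bound: "\<And>n. n \<ge> N \<Longrightarrow> (\<integral>\<^sup>+x. (cmod (u n x))\<^sup>2 \<partial>M) \<le> ennreal K"
  shows "l \<in> L2 M" "(\<integral>\<^sup>+x. (cmod (l x))\<^sup>2 \<partial>M) \<le> ennreal K"
proof -
  have [measurable]: "u n \<in> borel_measurable M" for n using u by (rule L2_measurable)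
  note l[measurable]
  have "(\<integral>\<^sup>+x. (cmod (l x))\<^sup>2 \<partial>M) = (\<integral>\<^sup>+x. liminf (\<lambda>n. ennreal ((cmod (u n x))\<^sup>2)) \<partial>M)"
  proof (rule nn_integral_cong_AE)
    show "AE x in M. ennreal ((cmod (l x))\<^sup>2) = liminf (\<lambda>n. ennreal ((cmod (u n x))\<^sup>2))"
      using lim
    proof eventually_elim
      case (elim x)
      then have "(\<lambda>n. ennreal ((cmod (u n x))\<^sup>2)) \<longlonglongrightarrow> ennreal ((cmod (l x))\<^sup>2)"
        by (intro tendsto_intros)
      then show ?case by (intro lim_imp_Liminf[symmetric]) auto
    qed
  qed
  also have "\<dots> \<le> liminf (\<lambda>n. (\<integral>\<^sup>+x. (cmod (u n x))\<^sup>2 \<partial>M))"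
    by (intro nn_integral_liminf) measurable
  also have "\<dots> \<le> ennreal K"
    by (intro Liminf_le) (auto simp: eventually_sequentially intro!: exI[of _ N] bound)
  finally show "(\<integral>\<^sup>+x. (cmod (l x))\<^sup>2 \<partial>M) \<le> ennreal K" .
  then show "l \<in> L2 M" using l by (auto simp: L2_iff_nn_integral intro: le_less_trans)
qed

text \<open>The weight 2^n bounds the increments by a multiple of (1 / sqrt 2)^n, which is summable;
  the sequence is a telescoping sum of its increments.\<close>

lemma convergent_geometric_bound:
  fixes f :: "nat \<Rightarrow> complex"
  assumes "\<And>n. 2 ^ n * (cmod (f (Suc n) - f n))\<^sup>2 \<le> K"
  shows "convergent f"
proof -
  have K: "K \<ge> 0" using assms[of 0] by (auto intro: order_trans[rotated])
  define q where "q = sqrt (1/2 :: real)"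
  have q: "0 < q" "q < 1" "q\<^sup>2 = 1/2" by (auto simp: q_def real_sqrt_less_iff)
  have bound: "cmod (f (Suc n) - f n) \<le> sqrt K * q ^ n" for n
  proof (rule power2_le_imp_le)
    have "(cmod (f (Suc n) - f n))\<^sup>2 \<le> K / 2 ^ n"
      using assms[of n] by (simp add: field_simps)
    also have "\<dots> = (sqrt K * q ^ n)\<^sup>2"
    proof -
      have "(q ^ n)\<^sup>2 = (1/2) ^ n" using q(3) by (metis mult.commute power_mult)
      then show ?thesis using K by (simp add: power_mult_distrib power_divide)
    qed
    finally show "(cmod (f (Suc n) - f n))\<^sup>2 \<le> (sqrt K * q ^ n)\<^sup>2" .
  qed (use K q in auto)
  have "summable (\<lambda>n. sqrt K * q ^ n)"
    using q by (intro summable_mult summable_geometric) auto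
  then have "summable (\<lambda>n. f (Suc n) - f n)"
    by (rule summable_comparison_test'[where N = 0]) (rule bound)
  then have "convergent (\<lambda>n. \<Sum>k<n. f (Suc k) - f k)"
    by (simp add: summable_iff_convergent)
  then have "convergent (\<lambda>n. f n - f 0)"
    by (simp add: sum_lessThan_telescope)
  then have "convergent (\<lambda>n. (f n - f 0) + f 0)"
    by (intro convergent_add convergent_const)
  then show ?thesis by simp
qed

text \<open>Riesz--Fischer: along a rapidly Cauchy subsequence \<open>\<Sum> 2\<^sup>n |u\<^sub>n\<^sub>+\<^sub>1 - u\<^sub>n|\<^sup>2\<close> has a finite integral,
  so the subsequence converges almost everywhere; Fatou's lemma does the rest.\<close>

instance lsq :: (euclidean_space) complete_space
proof
  fix X :: "nat \<Rightarrow> 'a lsq" assume X: "Cauchy X"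
  \<comment> \<open>The rate (1/4)^n gives squared norms (1/16)^n, so that the weighted series with
    factors 2^n is dominated by the sum of (1/8)^n.\<close>
  have step: "\<exists>N. \<forall>p\<ge>N. \<forall>q\<ge>N. norm (X p - X q) < (1/4) ^ n" for n :: nat
    using X unfolding Cauchy_iff by (metis zero_less_divide_1_iff zero_less_numeral zero_less_power)
  have "\<exists>r. \<forall>n::nat. (\<forall>p\<ge>r n. \<forall>q\<ge>r n. norm (X p - X q) < (1/4) ^ n) \<and> (r n :: nat) < r (Suc n)"
  proof (rule dependent_nat_choice)
    fix x n :: nat
    obtain N where N: "\<forall>p\<ge>N. \<forall>q\<ge>N. norm (X p - X q) < (1/4) ^ Suc n" using step by blast
    show "\<exists>y. (\<forall>p\<ge>y. \<forall>q\<ge>y. norm (X p - X q) < (1/4) ^ Suc n) \<and> x < y"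
      by (rule exI[of _ "max N (Suc x)"]) (use N in auto)
  qed (rule step)
  then obtain r where r: "\<And>n p q. p \<ge> r n \<Longrightarrow> q \<ge> r n \<Longrightarrow> norm (X p - X q) < (1/4) ^ n"
    and mono: "strict_mono r"
    unfolding strict_mono_Suc_iff by metis
  define u where "u n = rep_lsq (X (r n))" for n
  have u: "u n \<in> L2 lebesgue" "lsq (u n) = X (r n)" for n
    by (auto simp: u_def rep_lsq_L2)
  have [measurable]: "u n \<in> borel_measurable lebesgue" for n using u(1) by (rule L2_measurable)
  have close: "(\<integral>\<^sup>+x. (cmod (u p x - u n x))\<^sup>2 \<partial>lebesgue) \<le> ennreal ((1/16) ^ n)" if "p \<ge> n" for p n
  proof -
    have "norm (X (r p) - X (r n)) \<le> (1/4) ^ n"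
      using that mono by (intro less_imp_le[OF r]) (auto simp: strict_mono_less_eq)
    then have "(norm (X (r p) - X (r n)))\<^sup>2 \<le> ((1/4) ^ n)\<^sup>2" by (rule power_mono) auto
    also have "((1/4) ^ n)\<^sup>2 = (1/16 :: real) ^ n"
      by (simp add: power2_eq_square flip: power_mult_distrib)
    also have "X (r p) - X (r n) = lsq (\<lambda>x. u p x - u n x)"
      using u by (simp add: lsq_diff flip: u(2))
    finally show ?thesis
      using u by (simp add: lsq_norm_nn_integral[symmetric] L2_diff ennreal_leI)
  qed
  have "(\<integral>\<^sup>+x. (\<Sum>n. ennreal (2 ^ n * (cmod (u (Suc n) x - u n x))\<^sup>2)) \<partial>lebesgue)
      = (\<Sum>n. \<integral>\<^sup>+x. ennreal (2 ^ n * (cmod (u (Suc n) x - u n x))\<^sup>2) \<partial>lebesgue)"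
    by (rule nn_integral_suminf) measurable
  also have "\<dots> \<le> (\<Sum>n. ennreal ((1/8) ^ n))"
  proof (rule suminf_le)
    fix n
    have "(\<integral>\<^sup>+x. ennreal (2 ^ n * (cmod (u (Suc n) x - u n x))\<^sup>2) \<partial>lebesgue)
        = ennreal (2 ^ n) * (\<integral>\<^sup>+x. ennreal ((cmod (u (Suc n) x - u n x))\<^sup>2) \<partial>lebesgue)"
      by (subst nn_integral_cmult[symmetric]) (auto simp: ennreal_mult')
    also have "\<dots> \<le> ennreal (2 ^ n) * ennreal ((1/16) ^ n)"
      by (intro mult_left_mono close) auto
    also have "\<dots> = ennreal ((1/8) ^ n)"
      by (simp flip: ennreal_mult' power_mult_distrib)
    finally show "(\<integral>\<^sup>+x. ennreal (2 ^ n * (cmod (u (Suc n) x - u n x))\<^sup>2) \<partial>lebesgue) \<le> ennreal ((1/8) ^ n)" .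
  qed auto
  also have "\<dots> < \<infinity>"
    by (subst suminf_ennreal2) (auto intro: summable_geometric)
  finally have "AE x in lebesgue. (\<Sum>n. ennreal (2 ^ n * (cmod (u (Suc n) x - u n x))\<^sup>2)) \<noteq> \<infinity>"
    by (intro nn_integral_PInf_AE) auto
  then have conv: "AE x in lebesgue. convergent (\<lambda>n. u n x)"
  proof eventually_elim
    case (elim x)
    define S where "S = (\<Sum>n. ennreal (2 ^ n * (cmod (u (Suc n) x - u n x))\<^sup>2))"
    have S: "S = ennreal (enn2real S)" using elim by (simp add: S_def less_top)
    show ?case
    proof (rule convergent_geometric_bound)
      fix n
      have "(\<Sum>k\<in>{n}. ennreal (2 ^ k * (cmod (u (Suc k) x - u k x))\<^sup>2)) \<le> S"
        unfolding S_def by (rule sum_le_suminf) auto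
      then show "2 ^ n * (cmod (u (Suc n) x - u n x))\<^sup>2 \<le> enn2real S"
        by (subst (asm) S) simp
    qed
  qed
  \<comment> \<open>The value of \<open>lim\<close> is unspecified where the sequence diverges, but
    only on a null set.\<close>
  define l where "l x = lim (\<lambda>n. u n x)" for x
  have lim: "AE x in lebesgue. (\<lambda>n. u n x) \<longlonglongrightarrow> l x"
    using conv by eventually_elim (simp add: l_def convergent_LIMSEQ_iff)
  have [measurable]: "l \<in> borel_measurable lebesgue"
    unfolding l_def by measurable
  \<comment> \<open>This lets p tend to infinity in \<open>close\<close>; the function l itself is
    then in L2 as the sum of l - u 0 and u 0.\<close>
  have lu: "(\<lambda>x. l x - u m x) \<in> L2 lebesgue"
      "(\<integral>\<^sup>+x. (cmod (l x - u m x))\<^sup>2 \<partial>lebesgue) \<le> ennreal ((1/16) ^ m)" for m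
  proof -
    have *: "AE x in lebesgue. (\<lambda>n. u n x - u m x) \<longlonglongrightarrow> l x - u m x"
      using lim by eventually_elim (intro tendsto_intros)
    have 1: "(\<lambda>x. l x - u m x) \<in> borel_measurable lebesgue" by measurable
    note F = L2_Fatou[where u = "\<lambda>n x. u n x - u m x" and N = m, OF L2_diff[OF u(1) u(1)] 1 _ * close]
    show "(\<lambda>x. l x - u m x) \<in> L2 lebesgue" by (rule F) auto
    show "(\<integral>\<^sup>+x. (cmod (l x - u m x))\<^sup>2 \<partial>lebesgue) \<le> ennreal ((1/16) ^ m)" by (rule F) auto
  qed
  have l: "l \<in> L2 lebesgue"
    using L2_add[OF lu(1)[of 0] u(1)[of 0]] by simp
  have "norm (lsq l - X (r m)) \<le> (1/4) ^ m" for m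
  proof (rule power2_le_imp_le)
    have "ennreal ((norm (lsq l - X (r m)))\<^sup>2) \<le> ennreal ((1/16) ^ m)"
      using lu[of m] l u(1)[of m] by (simp add: lsq_diff lsq_norm_nn_integral flip: u(2))
    then show "(norm (lsq l - X (r m)))\<^sup>2 \<le> ((1/4) ^ m)\<^sup>2"
      by (simp add: power2_eq_square flip: power_mult_distrib)
  qed auto
  then have "(\<lambda>m. norm (X (r m) - lsq l)) \<longlonglongrightarrow> 0"
    by (intro tendsto_sandwich[OF _ _ tendsto_const LIMSEQ_realpow_zero[of "1/4"]])
       (auto simp: norm_minus_commute)
  then have "(X \<circ> r) \<longlonglongrightarrow> lsq l"
    by (simp add: comp_def LIM_zero_iff tendsto_norm_zero_iff)
  then show "convergent X"
    using Cauchy_converges_subseq X mono unfolding convergent_def by blast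
qed

section \<open>Density of compactly supported continuous functions\<close>

lemma lborel_distr_minus: "distr lborel borel (\<lambda>y. c - y) = (lborel :: 'a::euclidean_space measure)"
  using lborel_affine[of "-1" c] by (simp add: density_1)

lemma lborel_distr_diff: "distr lborel borel (\<lambda>y. y - c) = (lborel :: 'a::euclidean_space measure)"
  using lborel_affine[of 1 "- c"] by (simp add: density_1)

lemma nn_integral_lborel_minus:
  fixes c :: "'a::euclidean_space"
  assumes [measurable]: "f \<in> borel_measurable borel"
  shows "(\<integral>\<^sup>+y. f (c - y) \<partial>lborel) = (\<integral>\<^sup>+y. f y \<partial>lborel)"
  by (subst (2) lborel_distr_minus[of c, symmetric]) (simp add: nn_integral_distr)

lemma nn_integral_lborel_diff:
  fixes c :: "'a::euclidean_space"
  assumes [measurable]: "f \<in> borel_measurable borel"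
  shows "(\<integral>\<^sup>+y. f (y - c) \<partial>lborel) = (\<integral>\<^sup>+y. f y \<partial>lborel)"
  by (subst (2) lborel_distr_diff[of c, symmetric]) (simp add: nn_integral_distr)

lemma integral_lborel_minus:
  fixes c :: "'a::euclidean_space" and f :: "'a \<Rightarrow> 'b::{banach, second_countable_topology}"
  assumes [measurable]: "f \<in> borel_measurable borel"
  shows "(\<integral>y. f (c - y) \<partial>lborel) = (\<integral>y. f y \<partial>lborel)"
  by (subst (2) lborel_distr_minus[of c, symmetric]) (simp add: integral_distr)

lemma integral_lborel_diff:
  fixes c :: "'a::euclidean_space" and f :: "'a \<Rightarrow> 'b::{banach, second_countable_topology}"
  assumes [measurable]: "f \<in> borel_measurable borel"
  shows "(\<integral>y. f (y - c) \<partial>lborel) = (\<integral>y. f y \<partial>lborel)"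
  by (subst (2) lborel_distr_diff[of c, symmetric]) (simp add: integral_distr)

lemma integrable_lborel_minus:
  fixes c :: "'a::euclidean_space" and f :: "'a \<Rightarrow> 'b::{banach, second_countable_topology}"
  assumes [measurable]: "f \<in> borel_measurable borel"
  shows "integrable lborel (\<lambda>y. f (c - y)) \<longleftrightarrow> integrable lborel f"
  by (subst (2) lborel_distr_minus[of c, symmetric]) (simp add: integrable_distr_eq)

lemma integrable_lborel_diff:
  fixes c :: "'a::euclidean_space" and f :: "'a \<Rightarrow> 'b::{banach, second_countable_topology}"
  assumes [measurable]: "f \<in> borel_measurable borel"
  shows "integrable lborel (\<lambda>y. f (y - c)) \<longleftrightarrow> integrable lborel f"
  by (subst (2) lborel_distr_diff[of c, symmetric]) (simp add: integrable_distr_eq)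

lemma AE_lborel_minus:
  fixes c :: "'a::euclidean_space"
  assumes "AE y in lborel. P y"
  shows "AE y in lborel. P (c - y)"
proof -
  obtain N where N: "N \<in> null_sets lborel" "{x. \<not> P x} \<subseteq> N"
    using AE_E[OF assms] by (auto simp: null_sets_def)
  have "emeasure (distr lborel borel (\<lambda>y. c - y)) N = 0"
    using N(1) unfolding lborel_distr_minus by (simp add: null_sets_def)
  then have "(\<lambda>y. c - y) -` N \<in> null_sets lborel"
    using N(1) by (subst (asm) emeasure_distr) (use measurable_sets[of "\<lambda>y. c - y" borel borel N] in \<open>auto simp: null_sets_def\<close>)
  then show ?thesis by (rule AE_I') (use N(2) in auto)
qed

lemma borel_imp_lebesgue_measurable: "f \<in> borel_measurable borel \<Longrightarrow> f \<in> borel_measurable lebesgue"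
  by (rule measurable_completion) simp

lemma integral_lebesgue_borel:
  fixes f :: "'a::euclidean_space \<Rightarrow> 'b::{banach, second_countable_topology}"
  shows "f \<in> borel_measurable borel \<Longrightarrow> integral\<^sup>L lebesgue f = integral\<^sup>L lborel f"
  by (rule integral_completion) simp

lemma L2_lebesgue_borel: "f \<in> borel_measurable borel \<Longrightarrow> f \<in> L2 lebesgue \<longleftrightarrow> f \<in> L2 lborel"
  by (simp add: L2_def borel_imp_lebesgue_measurable integrable_completion)

text \<open>Fubini arguments for convolutions need (x, y) -> f (x - y) to be jointly measurable,
  which is immediate for Borel f. Replacing f by a Borel function changes it only on a null
  set.\<close>

lemma lebesgue_borel_representative:
  fixes f :: "'a::euclidean_space \<Rightarrow> complex"
  assumes f: "f \<in> borel_measurable lebesgue"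
  obtains g where "g \<in> borel_measurable borel" "AE x in lebesgue. f x = g x"
proof -
  have "(\<lambda>x. Re (f x)) \<in> borel_measurable lebesgue" "(\<lambda>x. Im (f x)) \<in> borel_measurable lebesgue"
    using f by auto
  from this[THEN completion_ex_borel_measurable_real] obtain p q
    where pq: "p \<in> borel_measurable lborel" "AE x in lborel. Re (f x) = p x"
      "q \<in> borel_measurable lborel" "AE x in lborel. Im (f x) = q x" by blast
  show ?thesis
  proof
    show "(\<lambda>x. Complex (p x) (q x)) \<in> borel_measurable borel"
      using pq(1,3) by (simp add: borel_measurable_complex_iff)
    have "AE x in lborel. f x = Complex (p x) (q x)"
      using pq(2,4) by eventually_elim (simp add: complex_eq_iff)
    then show "AE x in lebesgue. f x = Complex (p x) (q x)" by (rule AE_completion)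
  qed
qed

lemma lsq_borel_cases:
  obtains u where "u \<in> borel_measurable borel" "u \<in> L2 lborel" "x = lsq u"
proof -
  obtain v where v: "v \<in> L2 lebesgue" "x = lsq v" by (rule lsq_cases)
  obtain u where u: "u \<in> borel_measurable borel" "AE x in lebesgue. v x = u x"
    using lebesgue_borel_representative[OF L2_measurable[OF v(1)]] .
  have "u \<in> L2 lebesgue"
    using v(1) u by (auto intro: L2_cong_AE simp: borel_imp_lebesgue_measurable)
  with u v show ?thesis
    by (intro that[of u]) (auto simp: lsq_eq_iff ae_eq_def L2_lebesgue_borel)
qed

section \<open>Compactly supported continuous functions\<close>

definition Cc :: "('a::euclidean_space \<Rightarrow> complex) set" where
  "Cc = {\<phi>. continuous_on UNIV \<phi> \<and> (\<exists>R. \<forall>x. R < norm x \<longrightarrow> \<phi> x = 0)}"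

lemma Cc_borel: "\<phi> \<in> Cc \<Longrightarrow> \<phi> \<in> borel_measurable borel"
  by (auto simp: Cc_def intro: borel_measurable_continuous_onI)

lemma Cc_support:
  assumes "\<phi> \<in> Cc"
  obtains R where "R > 0" "\<And>x. R < norm x \<Longrightarrow> \<phi> x = 0"
proof -
  obtain R where "\<And>x. R < norm x \<Longrightarrow> \<phi> x = 0" using assms by (auto simp: Cc_def)
  then show ?thesis by (intro that[of "max R 1"]) auto
qed

lemma Cc_bounded:
  assumes "\<phi> \<in> Cc"
  obtains M where "M > 0" "\<And>x. cmod (\<phi> x) \<le> M"
proof -
  obtain R where R: "R > 0" "\<And>x. R < norm x \<Longrightarrow> \<phi> x = 0" using Cc_support[OF assms] by blast
  have "continuous_on (cball 0 R) \<phi>" using assms by (auto simp: Cc_def intro: continuous_on_subset)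
  then have "bounded (\<phi> ` cball 0 R)" by (intro compact_imp_bounded compact_continuous_image) auto
  then obtain M where M: "M > 0" "\<And>x. norm x \<le> R \<Longrightarrow> cmod (\<phi> x) \<le> M"
    by (auto simp: bounded_pos)
  show ?thesis
    by (rule that[of M]) (use M R in \<open>auto simp: not_le intro: less_imp_le\<close>, metis M less_imp_le linorder_not_less norm_zero)
qed

text \<open>Two points at distance below 1 either both lie in the ball of radius R + 1, where
  compactness gives uniform continuity, or both lie outside the support.\<close>

lemma Cc_uniformly_continuous:
  assumes "\<phi> \<in> Cc" "e > 0"
  obtains d where "d > 0" "\<And>x y. norm (x - y) < d \<Longrightarrow> cmod (\<phi> x - \<phi> y) < e"
proof -
  obtain R where R: "R > 0" "\<And>x. R < norm x \<Longrightarrow> \<phi> x = 0" using Cc_support[OF assms(1)] by blast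
  have "continuous_on (cball 0 (R + 1)) \<phi>" using assms by (auto simp: Cc_def intro: continuous_on_subset)
  then have "uniformly_continuous_on (cball 0 (R + 1)) \<phi>"
    by (rule compact_uniformly_continuous) auto
  then obtain d where d: "d > 0"
    "\<And>x y. norm x \<le> R + 1 \<Longrightarrow> norm y \<le> R + 1 \<Longrightarrow> norm (x - y) < d \<Longrightarrow> cmod (\<phi> x - \<phi> y) < e"
    using \<open>e > 0\<close> unfolding uniformly_continuous_on_def by (force simp: dist_norm norm_minus_commute)
  show ?thesis
  proof (rule that[of "min d 1"])
    fix x y :: 'a assume xy: "norm (x - y) < min d 1"
    have "norm x \<le> norm y + norm (x - y)" "norm y \<le> norm x + norm (x - y)"
      using norm_triangle_sub[of x y] norm_triangle_sub[of y x] by (simp_all add: norm_minus_commute)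
    then consider "norm x \<le> R + 1" "norm y \<le> R + 1" | "norm x > R" "norm y > R"
      using xy by linarith
    then show "cmod (\<phi> x - \<phi> y) < e"
      by cases (use d xy R \<open>e > 0\<close> in auto)
  qed (use d in auto)
qed

lemma integrable_bounded_support:
  fixes f :: "'a::euclidean_space \<Rightarrow> 'b::{banach, second_countable_topology}"
  assumes "f \<in> borel_measurable borel" "\<And>x. norm (f x) \<le> M" "\<And>x. R < norm x \<Longrightarrow> f x = 0"
  shows "integrable lborel f"
proof (rule Bochner_Integration.integrable_bound)
  show "integrable lborel (\<lambda>x. indicator (cball 0 R) x * M)"
    by (intro integrable_mult_left integrable_real_indicator) (auto simp: emeasure_compact_finite[simplified])
  show "AE x in lborel. norm (f x) \<le> norm (indicator (cball 0 R) x * M)"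
  proof (rule AE_I2)
    fix x show "norm (f x) \<le> norm (indicator (cball 0 R) x * M)"
      using assms(2)[of x] assms(3)[of x] by (cases "norm x \<le> R") (auto intro: order_trans[OF _ abs_ge_self])
  qed
qed (use assms in auto)

lemma Cc_integrable: "\<phi> \<in> Cc \<Longrightarrow> integrable lborel \<phi>"
  by (metis Cc_borel Cc_bounded Cc_support integrable_bounded_support)

lemma L2_bounded_support:
  fixes f :: "'a::euclidean_space \<Rightarrow> complex"
  assumes "f \<in> borel_measurable borel" "\<And>x. norm (f x) \<le> M" "\<And>x. R < norm x \<Longrightarrow> f x = 0"
  shows "f \<in> L2 lborel"
proof -
  have "integrable lborel (\<lambda>x. (cmod (f x))\<^sup>2)"
    by (rule integrable_bounded_support[where M = "M\<^sup>2" and R = R])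
       (use assms in \<open>auto intro!: power_mono\<close>)
  then show ?thesis using assms(1) by (simp add: L2_def)
qed

lemma Cc_L2: "\<phi> \<in> Cc \<Longrightarrow> \<phi> \<in> L2 lborel"
  by (metis Cc_borel Cc_bounded Cc_support L2_bounded_support)

lemma Cc_add: "\<phi> \<in> Cc \<Longrightarrow> \<psi> \<in> Cc \<Longrightarrow> (\<lambda>x. \<phi> x + \<psi> x) \<in> Cc"
proof -
  assume *: "\<phi> \<in> Cc" "\<psi> \<in> Cc"
  obtain R where R: "\<And>x. R < norm x \<Longrightarrow> \<phi> x = 0" using Cc_support[OF *(1)] by blast
  obtain S where S: "\<And>x. S < norm x \<Longrightarrow> \<psi> x = 0" using Cc_support[OF *(2)] by blast
  show ?thesis
    using * R S unfolding Cc_def by (auto intro!: continuous_intros exI[of _ "max R S"])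
qed

lemma Cc_mult_right: "\<phi> \<in> Cc \<Longrightarrow> (\<lambda>x. \<phi> x * c) \<in> Cc"
  by (force simp: Cc_def intro!: continuous_intros)

lemma Cc_reflect_cnj: "\<phi> \<in> Cc \<Longrightarrow> (\<lambda>x. cnj (\<phi> (- x))) \<in> Cc"
  unfolding Cc_def
  by (auto intro!: continuous_intros intro: continuous_on_compose2[of UNIV \<phi>]) (metis norm_minus_cancel)

text \<open>Membership in the L1 closure of \<open>Cc\<close>, phrased as a predicate whose closure
  properties are those required by \<open>integrable_induct\<close>.\<close>

definition Cc_approximable :: "('a::euclidean_space \<Rightarrow> complex) \<Rightarrow> bool" where
  "Cc_approximable f \<longleftrightarrow> (\<forall>e>0. \<exists>\<phi>\<in>Cc. (\<integral>x. cmod (f x - \<phi> x) \<partial>lborel) < e)"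

text \<open>Dominated convergence upgrades the pointwise limit to an L1 limit; a late member of the
  sequence and its own approximant contribute e / 2 each.\<close>

lemma Cc_approximable_lim:
  assumes s: "\<And>i. integrable lborel (s i)" "\<And>i. Cc_approximable (s i)"
    and f: "integrable lborel f" and w: "integrable lborel w"
    and lim: "\<And>x. (\<lambda>i. s i x) \<longlonglongrightarrow> f x" and bound: "\<And>i x. cmod (s i x) \<le> w x"
  shows "Cc_approximable f"
  unfolding Cc_approximable_def
proof (intro allI impI)
  fix e :: real assume "e > 0"
  have "(\<lambda>i. \<integral>x. cmod (f x - s i x) \<partial>lborel) \<longlonglongrightarrow> (\<integral>x. 0 \<partial>(lborel :: 'a measure))"
  proof (rule integral_dominated_convergence[where w = "\<lambda>x. cmod (f x) + w x"])
    show "AE x in lborel. (\<lambda>i. cmod (f x - s i x)) \<longlonglongrightarrow> 0"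
      using lim by (intro AE_I2) (auto intro!: tendsto_eq_intros)
    show "AE x in lborel. norm (cmod (f x - s i x)) \<le> cmod (f x) + w x" for i
      using bound by (intro AE_I2) (auto intro!: order_trans[OF norm_triangle_ineq4])
  qed (use s f w in auto)
  then have "(\<lambda>i. \<integral>x. cmod (f x - s i x) \<partial>lborel) \<longlonglongrightarrow> 0" by simp
  then have "\<forall>\<^sub>F i in sequentially. (\<integral>x. cmod (f x - s i x) \<partial>lborel) < e / 2"
    using \<open>e > 0\<close> by (intro order_tendstoD) auto
  then obtain i where i: "(\<integral>x. cmod (f x - s i x) \<partial>lborel) < e / 2"
    by (auto simp: eventually_sequentially)
  obtain \<phi> where \<phi>: "\<phi> \<in> Cc" "(\<integral>x. cmod (s i x - \<phi> x) \<partial>lborel) < e / 2"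
    using s(2)[of i] \<open>e > 0\<close> unfolding Cc_approximable_def by (meson half_gt_zero)
  have "(\<integral>x. cmod (f x - \<phi> x) \<partial>lborel) \<le> (\<integral>x. cmod (f x - s i x) + cmod (s i x - \<phi> x) \<partial>lborel)"
    using s f \<phi>(1) by (intro integral_mono) (auto simp: Cc_integrable intro: norm_diff_triangle_le)
  also have "\<dots> < e"
    using s f \<phi> i by (subst Bochner_Integration.integral_add) (auto simp: Cc_integrable)
  finally show "\<exists>\<phi>\<in>Cc. (\<integral>x. cmod (f x - \<phi> x) \<partial>lborel) < e" using \<phi>(1) by blast
qed

text \<open>Continuous cutoffs that decay linearly with the distance from K, at growing slope,
  decrease to the indicator. They all vanish at distance 1 from K and hence share a bounded
  support.\<close>

lemma Cc_approximable_compact: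
  fixes K :: "'a::euclidean_space set"
  assumes K: "compact K"
  shows "Cc_approximable (indicator K :: 'a \<Rightarrow> complex)"
\<comment> \<open>The distance to the empty set is 0 by convention, so the cutoffs would be
  constantly 1 there.\<close>
proof (cases "K = {}")
  case True
  then show ?thesis
    unfolding Cc_approximable_def by (auto simp: Cc_def intro!: exI[of _ "\<lambda>x. 0"])
next
  case False
  define s where "s i x = complex_of_real (max 0 (1 - real (Suc i) * infdist x K))" for i x
  obtain R where R: "\<And>x. x \<in> K \<Longrightarrow> norm x \<le> R"
    using compact_imp_bounded[OF K] by (auto simp: bounded_iff)
  have supp: "s i x = 0" if "R + 1 < norm x" for i x
  proof -
    have "1 \<le> infdist x K"
      unfolding infdist_notempty[OF False]
    proof (rule cINF_greatest[OF False])
      fix y assume "y \<in> K"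
      then show "1 \<le> dist x y"
        using R[of y] that norm_triangle_sub[of x y] by (simp add: dist_norm)
    qed
    then have "1 \<le> real (Suc i) * infdist x K"
      using mult_mono[of 1 "real (Suc i)" 1 "infdist x K"] by simp
    then show ?thesis by (simp add: s_def)
  qed
  have cont: "continuous_on UNIV (s i)" for i
    unfolding s_def by (intro continuous_intros)
  have s: "s i \<in> Cc" for i using cont supp by (auto simp: Cc_def)
  show ?thesis
  proof (rule Cc_approximable_lim)
    show "integrable lborel (s i)" for i by (rule Cc_integrable[OF s])
    show "Cc_approximable (s i)" for i
      unfolding Cc_approximable_def using s[of i] by (auto intro!: bexI[of _ "s i"])
    show "integrable lborel (indicator K :: 'a \<Rightarrow> complex)"
      by (rule integrable_bounded_support[where M = 1 and R = R])
         (use K R in \<open>auto simp: indicator_def not_le[symmetric] compact_imp_closed\<close>)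
    show "integrable lborel (\<lambda>x. norm (s 0 x))"
      by (intro integrable_norm Cc_integrable s)
    show "cmod (s i x) \<le> norm (s 0 x)" for i x
    proof -
      have "infdist x K \<le> real (Suc i) * infdist x K"
        using mult_mono[of 1 "real (Suc i)" "infdist x K" "infdist x K"] by (simp add: infdist_nonneg)
      then show ?thesis by (simp add: s_def)
    qed
    fix x
    show "(\<lambda>i. s i x) \<longlonglongrightarrow> indicator K x"
    proof (cases "x \<in> K")
      case True then show ?thesis by (simp add: s_def)
    next
      case not_in: False
      then have pos: "infdist x K > 0"
        using K False by (metis compact_imp_closed in_closed_iff_infdist_zero infdist_nonneg less_eq_real_def)
      obtain N where N: "1 / infdist x K < real N" using reals_Archimedean2 by blast
      have "s i x = 0" if "i \<ge> N" for i
      proof -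
        have "1 / infdist x K \<le> real (Suc i)" using N that by simp
        then have "1 \<le> real (Suc i) * infdist x K" using pos by (simp only: pos_divide_le_eq)
        then show ?thesis by (simp add: s_def)
      qed
      then have "\<forall>\<^sub>F i in sequentially. s i x = 0" by (auto simp: eventually_sequentially)
      then show ?thesis using not_in by (simp add: tendsto_eventually)
    qed
  qed
qed

lemma Cc_approximable_add:
  assumes f: "integrable lborel f" "Cc_approximable f" and g: "integrable lborel g" "Cc_approximable g"
  shows "Cc_approximable (\<lambda>x. f x + g x)"
  unfolding Cc_approximable_def
proof (intro allI impI)
  fix e :: real assume "e > 0"
  obtain \<phi> where \<phi>: "\<phi> \<in> Cc" "(\<integral>x. cmod (f x - \<phi> x) \<partial>lborel) < e / 2"
    using f(2) \<open>e > 0\<close> unfolding Cc_approximable_def by (meson half_gt_zero)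
  obtain \<psi> where \<psi>: "\<psi> \<in> Cc" "(\<integral>x. cmod (g x - \<psi> x) \<partial>lborel) < e / 2"
    using g(2) \<open>e > 0\<close> unfolding Cc_approximable_def by (meson half_gt_zero)
  have "(\<integral>x. cmod (f x + g x - (\<phi> x + \<psi> x)) \<partial>lborel)
      \<le> (\<integral>x. cmod (f x - \<phi> x) + cmod (g x - \<psi> x) \<partial>lborel)"
    using f g \<phi>(1) \<psi>(1) by (intro integral_mono) (auto simp: Cc_integrable intro: norm_diff_triangle_ineq)
  also have "\<dots> < e"
    using f g \<phi> \<psi> by (subst Bochner_Integration.integral_add) (auto simp: Cc_integrable)
  finally show "\<exists>\<phi>\<in>Cc. (\<integral>x. cmod (f x + g x - \<phi> x) \<partial>lborel) < e"
    by (intro bexI[of _ "\<lambda>x. \<phi> x + \<psi> x"] Cc_add \<phi>(1) \<psi>(1))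
qed

lemma Cc_approximable_mult_right:
  assumes "Cc_approximable f"
  shows "Cc_approximable (\<lambda>x. f x * c)"
  unfolding Cc_approximable_def
proof (intro allI impI)
  fix e :: real assume "e > 0"
  then have "e / (cmod c + 1) > 0" by (simp add: add_nonneg_pos)
  then obtain \<phi> where \<phi>: "\<phi> \<in> Cc" "(\<integral>x. cmod (f x - \<phi> x) \<partial>lborel) < e / (cmod c + 1)"
    using assms unfolding Cc_approximable_def by blast
  have "(\<integral>x. cmod (f x * c - \<phi> x * c) \<partial>lborel) = (\<integral>x. cmod (f x - \<phi> x) \<partial>lborel) * cmod c"
    by (simp add: norm_mult flip: left_diff_distrib)
  also have "\<dots> \<le> (\<integral>x. cmod (f x - \<phi> x) \<partial>lborel) * (cmod c + 1)"
    by (intro mult_left_mono) auto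
  also have "\<dots> < e" using \<phi>(2) by (simp add: pos_less_divide_eq add_nonneg_pos)
  finally show "\<exists>\<phi>\<in>Cc. (\<integral>x. cmod (f x * c - \<phi> x) \<partial>lborel) < e"
    by (intro bexI[of _ "\<lambda>x. \<phi> x * c"] Cc_mult_right \<phi>(1))
qed

lemma integrable_complex_indicator:
  "A \<in> sets M \<Longrightarrow> emeasure M A < \<infinity> \<Longrightarrow> integrable M (indicator A :: 'a \<Rightarrow> complex)"
  using integrable_of_real[OF integrable_real_indicator[of A M], where 'a = complex]
  by (simp add: of_real_indicator cong: Bochner_Integration.integrable_cong)

text \<open>Inner regularity: a closed T inside A misses only a set of small measure, and the
  indicator of T is the limit of indicators of its compact pieces in growing balls.\<close>

lemma Cc_approximable_set:
  fixes A :: "'a::euclidean_space set"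
  assumes A: "A \<in> sets borel" "emeasure lborel A < \<infinity>"
  shows "Cc_approximable (indicator A :: 'a \<Rightarrow> complex)"
  unfolding Cc_approximable_def
proof (intro allI impI)
  fix e :: real assume "e > 0"
  obtain T where T: "closed T" "T \<subseteq> A" "A - T \<in> lmeasurable" "emeasure lebesgue (A - T) < ennreal (e / 2)"
    using sets_lebesgue_inner_closed[of A "e / 2"] A \<open>e > 0\<close> by auto
  have TB: "T \<in> sets borel" using T(1) by simp
  have fin: "emeasure lborel T < \<infinity>"
    using emeasure_mono[of T A lborel] T A by (auto intro: le_less_trans)
  have intT: "integrable lborel (indicator T :: 'a \<Rightarrow> complex)"
    using TB fin by (intro integrable_complex_indicator) auto
  have intA: "integrable lborel (indicator A :: 'a \<Rightarrow> complex)"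
    using A by (intro integrable_complex_indicator) auto
  have "Cc_approximable (indicator T :: 'a \<Rightarrow> complex)"
  proof (rule Cc_approximable_lim)
    fix i :: nat
    have c: "compact (T \<inter> cball 0 (real i))" using T(1) by (intro closed_Int_compact) auto
    show "Cc_approximable (indicator (T \<inter> cball 0 (real i)) :: 'a \<Rightarrow> complex)"
      by (rule Cc_approximable_compact[OF c])
    show "integrable lborel (indicator (T \<inter> cball 0 (real i)) :: 'a \<Rightarrow> complex)"
      using emeasure_compact_finite[OF c] c by (intro integrable_complex_indicator) (auto simp: compact_imp_closed)
    show "cmod (indicator (T \<inter> cball 0 (real i)) x) \<le> cmod (indicator T x)" for x
      by (auto simp: indicator_def)
  next
    fix x :: 'a
    obtain N where "norm x \<le> real N" using real_arch_simple by blast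
    then have "(indicator (T \<inter> cball 0 (real i)) x :: complex) = indicator T x" if "i \<ge> N" for i
      using that by (auto simp: indicator_def)
    then show "(\<lambda>i. indicator (T \<inter> cball 0 (real i)) x :: complex) \<longlonglongrightarrow> indicator T x"
      by (intro tendsto_eventually) (auto simp: eventually_sequentially)
  qed (use intT in auto)
  then obtain \<phi> where \<phi>: "\<phi> \<in> Cc" "(\<integral>x. cmod (indicator T x - \<phi> x) \<partial>lborel) < e / 2"
    using \<open>e > 0\<close> unfolding Cc_approximable_def by (meson half_gt_zero)
  have "(\<integral>x. cmod (indicator A x - indicator T x) \<partial>lborel) = measure lborel (A - T)"
  proof -
    have "cmod (indicator A x - indicator T x) = indicator (A - T) x" for x
      using T(2) by (auto simp: indicator_def)
    then show ?thesis by simp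
  qed
  also have "\<dots> < e / 2"
  proof -
    have "emeasure lborel (A - T) < ennreal (e / 2)"
      using T(4) A TB by (simp add: emeasure_completion)
    then have "ennreal (measure lborel (A - T)) < ennreal (e / 2)"
      by (subst emeasure_eq_ennreal_measure[symmetric]) auto
    then show ?thesis by (simp add: ennreal_less_iff)
  qed
  finally have AT: "(\<integral>x. cmod (indicator A x - indicator T x) \<partial>lborel) < e / 2" .
  have "(\<integral>x. cmod (indicator A x - \<phi> x) \<partial>lborel)
      \<le> (\<integral>x. cmod (indicator A x - indicator T x) + cmod (indicator T x - \<phi> x) \<partial>lborel)"
    using intA intT \<phi>(1) by (intro integral_mono) (auto simp: Cc_integrable intro: norm_diff_triangle_le)
  also have "\<dots> < e"
    using intA intT \<phi> AT by (subst Bochner_Integration.integral_add) (auto simp: Cc_integrable)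
  finally show "\<exists>\<phi>\<in>Cc. (\<integral>x. cmod (indicator A x - \<phi> x) \<partial>lborel) < e" using \<phi>(1) by blast
qed

lemma integrable_Cc_approximable:
  fixes f :: "'a::euclidean_space \<Rightarrow> complex"
  assumes "integrable lborel f"
  shows "Cc_approximable f"
  using assms
proof (induction rule: integrable_induct)
  case (base A c)
  have "(\<lambda>x. indicator A x *\<^sub>R c) = (\<lambda>x. indicator A x * c)"
    by (auto simp: indicator_def fun_eq_iff)
  then show ?case
    using base Cc_approximable_mult_right[OF Cc_approximable_set[of A], of c] by simp
next
  case (add f g) then show ?case by (intro Cc_approximable_add)
next
  case (lim f s)
  show ?case
    by (rule Cc_approximable_lim[of s f "\<lambda>x. 2 * cmod (f x)"]) (use lim in auto)
qed

lemma L1_dense_Cc: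
  fixes f :: "'a::euclidean_space \<Rightarrow> complex"
  assumes "integrable lborel f" "e > 0"
  obtains \<phi> where "\<phi> \<in> Cc" "(\<integral>x. cmod (f x - \<phi> x) \<partial>lborel) < e"
  using integrable_Cc_approximable[OF assms(1)] assms(2) unfolding Cc_approximable_def by blast

text \<open>Truncation in space and in size makes f bounded with bounded support, hence integrable,
  so that L1 density applies. The quarters of e come from |x + y|^2 \<le> 2 |x|^2 + 2 |y|^2.\<close>

lemma L2_dense_Cc:
  fixes f :: "'a::euclidean_space \<Rightarrow> complex"
  assumes f: "f \<in> borel_measurable borel" "f \<in> L2 lborel" and "e > 0"
  obtains \<phi> where "\<phi> \<in> Cc" "(\<integral>x. (cmod (f x - \<phi> x))\<^sup>2 \<partial>lborel) < e"
proof -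
  define s where "s n x = (if norm x \<le> real n \<and> cmod (f x) \<le> real n then f x else 0)" for n x
  note f(1)[measurable]
  have [measurable]: "s n \<in> borel_measurable borel" for n unfolding s_def by measurable
  have sb: "cmod (s n x) \<le> real n" "real n < norm x \<Longrightarrow> s n x = 0" for n x
    by (auto simp: s_def)
  have "(\<lambda>n. \<integral>x. (cmod (f x - s n x))\<^sup>2 \<partial>lborel) \<longlonglongrightarrow> (\<integral>x. 0 \<partial>(lborel :: 'a measure))"
  proof (rule integral_dominated_convergence[where w = "\<lambda>x. (cmod (f x))\<^sup>2"])
    show "AE x in lborel. (\<lambda>n. (cmod (f x - s n x))\<^sup>2) \<longlonglongrightarrow> 0"
    proof (rule AE_I2)
      fix x
      obtain N where N: "max (norm x) (cmod (f x)) \<le> real N" using real_arch_simple by blast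
      then have "(cmod (f x - s n x))\<^sup>2 = 0" if "n \<ge> N" for n
        using that by (auto simp: s_def)
      then show "(\<lambda>n. (cmod (f x - s n x))\<^sup>2) \<longlonglongrightarrow> 0"
        by (intro tendsto_eventually) (auto simp: eventually_sequentially)
    qed
    show "AE x in lborel. norm ((cmod (f x - s n x))\<^sup>2) \<le> (cmod (f x))\<^sup>2" for n
      by (intro AE_I2) (auto simp: s_def)
  qed (use f(2) in \<open>auto simp: L2_integrable_square\<close>)
  then have "(\<lambda>n. \<integral>x. (cmod (f x - s n x))\<^sup>2 \<partial>lborel) \<longlonglongrightarrow> 0" by simp
  then have "\<forall>\<^sub>F n in sequentially. (\<integral>x. (cmod (f x - s n x))\<^sup>2 \<partial>lborel) < e / 4"
    using \<open>e > 0\<close> by (intro order_tendstoD) auto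
  then obtain n where n: "(\<integral>x. (cmod (f x - s n x))\<^sup>2 \<partial>lborel) < e / 4"
    by (auto simp: eventually_sequentially)
  have sL: "s n \<in> L2 lborel"
    by (rule L2_bounded_support[where R = "real n", OF _ sb]) auto
  have sL1: "integrable lborel (s n)"
    by (rule integrable_bounded_support[where R = "real n", OF _ sb]) auto
  \<comment> \<open>After the retraction below, |s n - \<phi>| is at most 2 n + 1, so its square is
    at most (2 n + 1) |s n - \<psi>|. The summand 1 keeps the divisor positive for n = 0.\<close>
  obtain \<psi> where \<psi>: "\<psi> \<in> Cc" "(\<integral>x. cmod (s n x - \<psi> x) \<partial>lborel) < e / 4 / (2 * real n + 1)"
    using L1_dense_Cc[OF sL1, of "e / 4 / (2 * real n + 1)"] \<open>e > 0\<close> by auto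
  text \<open>Retracting onto the disc of radius \<open>n\<close> keeps the approximant bounded, which turns the
    \<open>L\<^sub>1\<close> estimate into an \<open>L\<^sub>2\<close> estimate.\<close>
  define p where "p = closest_point (cball (0::complex) (real n))"
  define \<phi> where "\<phi> x = p (\<psi> x)" for x
  have p: "dist (p x) (p y) \<le> dist x y" for x y
    unfolding p_def by (rule closest_point_lipschitz) auto
  have p_in: "cmod (p x) \<le> real n" for x
    using closest_point_in_set[of "cball (0::complex) (real n)" x] by (auto simp: p_def)
  have p_self: "cmod x \<le> real n \<Longrightarrow> p x = x" for x
    unfolding p_def by (rule closest_point_self) auto
  have "continuous_on UNIV p" unfolding p_def by (rule continuous_on_closest_point) auto
  then have "continuous_on UNIV \<phi>"
    using \<psi>(1) unfolding Cc_def \<phi>_def by (auto intro: continuous_on_compose2)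
  moreover obtain R where "\<And>x. R < norm x \<Longrightarrow> \<psi> x = 0" using Cc_support[OF \<psi>(1)] by blast
  ultimately have "\<phi> \<in> Cc"
    using p_self[of 0] unfolding Cc_def \<phi>_def by (auto intro!: exI[of _ R])
  have close: "cmod (s n x - \<phi> x) \<le> cmod (s n x - \<psi> x)" for x
    using p[of "s n x" "\<psi> x"] sb(1)[of n x] by (simp add: \<phi>_def dist_norm p_self)
  have "(\<integral>x. (cmod (s n x - \<phi> x))\<^sup>2 \<partial>lborel) \<le> (\<integral>x. (2 * real n + 1) * cmod (s n x - \<psi> x) \<partial>lborel)"
  proof (rule integral_mono)
    show "integrable lborel (\<lambda>x. (cmod (s n x - \<phi> x))\<^sup>2)"
      by (intro L2_integrable_square L2_diff sL Cc_L2 \<open>\<phi> \<in> Cc\<close>)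
    show "integrable lborel (\<lambda>x. (2 * real n + 1) * cmod (s n x - \<psi> x))"
      using sL1 \<psi>(1) by (auto simp: Cc_integrable)
    fix x
    have "cmod (s n x - \<phi> x) \<le> 2 * real n + 1"
      using norm_triangle_ineq4[of "s n x" "\<phi> x"] sb(1)[of n x] p_in[of "\<psi> x"] by (simp add: \<phi>_def)
    then show "(cmod (s n x - \<phi> x))\<^sup>2 \<le> (2 * real n + 1) * cmod (s n x - \<psi> x)"
      unfolding power2_eq_square using close[of x] by (intro mult_mono) auto
  qed
  also have "\<dots> < e / 4"
    using \<psi>(2) by (subst integral_mult_right_zero) (simp add: pos_less_divide_eq algebra_simps)
  finally have sphi: "(\<integral>x. (cmod (s n x - \<phi> x))\<^sup>2 \<partial>lborel) < e / 4" .
  have ints: "integrable lborel (\<lambda>x. (cmod (f x - s n x))\<^sup>2)" "integrable lborel (\<lambda>x. (cmod (s n x - \<phi> x))\<^sup>2)"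
    "integrable lborel (\<lambda>x. (cmod (f x - \<phi> x))\<^sup>2)"
    by (intro L2_integrable_square L2_diff sL f Cc_L2 \<open>\<phi> \<in> Cc\<close>)+
  have "(\<integral>x. (cmod (f x - \<phi> x))\<^sup>2 \<partial>lborel) \<le> (\<integral>x. 2 * (cmod (f x - s n x))\<^sup>2 + 2 * (cmod (s n x - \<phi> x))\<^sup>2 \<partial>lborel)"
  proof (rule integral_mono)
    fix x
    have "cmod (f x - \<phi> x) \<le> cmod (f x - s n x) + cmod (s n x - \<phi> x)"
      by (rule norm_diff_triangle_le) auto
    then have "(cmod (f x - \<phi> x))\<^sup>2 \<le> (cmod (f x - s n x) + cmod (s n x - \<phi> x))\<^sup>2"
      by (intro power_mono) auto
    then show "(cmod (f x - \<phi> x))\<^sup>2 \<le> 2 * (cmod (f x - s n x))\<^sup>2 + 2 * (cmod (s n x - \<phi> x))\<^sup>2"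
      using sum_squares_bound[of "cmod (f x - s n x)" "cmod (s n x - \<phi> x)"] by (simp add: power2_sum)
  qed (use ints in auto)
  also have "\<dots> = 2 * (\<integral>x. (cmod (f x - s n x))\<^sup>2 \<partial>lborel) + 2 * (\<integral>x. (cmod (s n x - \<phi> x))\<^sup>2 \<partial>lborel)"
    using ints by (subst Bochner_Integration.integral_add) auto
  also have "\<dots> < e" using n sphi by simp
  finally show ?thesis using that \<open>\<phi> \<in> Cc\<close> by blast
qed

lemma lsq_dense_Cc:
  fixes x :: "'a::euclidean_space lsq"
  assumes "e > 0"
  obtains \<phi> where "\<phi> \<in> Cc" "norm (x - lsq \<phi>) < e"
proof -
  obtain u where u: "u \<in> borel_measurable borel" "u \<in> L2 lborel" "x = lsq u" by (rule lsq_borel_cases)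
  obtain \<phi> where \<phi>: "\<phi> \<in> Cc" "(\<integral>x. (cmod (u x - \<phi> x))\<^sup>2 \<partial>lborel) < e\<^sup>2"
    using L2_dense_Cc[OF u(1,2), of "e\<^sup>2"] assms by auto
  note [measurable] = u(1) Cc_borel[OF \<phi>(1)]
  have "u \<in> L2 lebesgue" "\<phi> \<in> L2 lebesgue"
    using u \<phi> by (auto simp: L2_lebesgue_borel Cc_L2)
  then have "norm (x - lsq \<phi>) = sqrt (\<integral>x. (cmod (u x - \<phi> x))\<^sup>2 \<partial>lborel)"
    by (simp add: u(3) lsq_diff lsq_norm L2_diff L2_norm_on_def integral_lebesgue_borel)
  also have "\<dots> < e" using \<phi>(2) assms by (simp add: real_less_lsqrt)
  finally show ?thesis using that \<phi>(1) by blast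
qed

section \<open>Convolution\<close>

text \<open>The integral is taken over \<open>lebesgue\<close>, so that this is literally the first
  summand of \<open>conv_potential_op\<close>.\<close>

definition conv :: "('a::euclidean_space \<Rightarrow> complex) \<Rightarrow> ('a \<Rightarrow> complex) \<Rightarrow> 'a \<Rightarrow> complex" where
  "conv f g x = (\<integral>y. f (x - y) * g y \<partial>lebesgue)"

lemma minus_measurable_lebesgue: "(\<lambda>y. c - y) \<in> lebesgue \<rightarrow>\<^sub>M (lebesgue :: 'a::euclidean_space measure)"
  using lebesgue_affine_measurable[of "\<lambda>_. -1" c]
  by (simp add: scaleR_sum_right [symmetric] euclidean_representation sum_negf)

text \<open>Equality holds at every point x, not just almost everywhere, because y -> x - y
  preserves null sets and an integral ignores them.\<close>

lemma conv_cong_AE: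
  assumes [measurable]: "f \<in> borel_measurable lebesgue" "f' \<in> borel_measurable lebesgue"
    "g \<in> borel_measurable lebesgue" "g' \<in> borel_measurable lebesgue"
    and ff': "AE x in lebesgue. f x = f' x" and gg': "AE x in lebesgue. g x = g' x"
  shows "conv f g = conv f' g'"
proof
  fix x
  have [measurable]: "(\<lambda>y. f (x - y)) \<in> borel_measurable lebesgue" "(\<lambda>y. f' (x - y)) \<in> borel_measurable lebesgue"
    using measurable_compose[OF minus_measurable_lebesgue] assms(1,2) by blast+
  have "AE y in lebesgue. f (x - y) = f' (x - y)"
    using AE_lborel_minus[of "\<lambda>y. f y = f' y"] ff' by (simp add: AE_completion_iff)
  with gg' show "conv f g x = conv f' g' x"
    unfolding conv_def by (intro integral_cong_AE) auto
qed

lemma conv_lborel: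
  assumes [measurable]: "f \<in> borel_measurable borel" "g \<in> borel_measurable borel"
  shows "conv f g x = (\<integral>y. f (x - y) * g y \<partial>lborel)"
  unfolding conv_def by (rule integral_lebesgue_borel) measurable

lemma borel_measurable_conv [measurable]:
  assumes [measurable]: "f \<in> borel_measurable borel" "g \<in> borel_measurable borel"
  shows "conv f g \<in> borel_measurable borel"
proof -
  have "(\<lambda>x. \<integral>y. f (x - y) * g y \<partial>lborel) \<in> borel_measurable borel" by measurable
  then show ?thesis by (simp add: conv_lborel[OF assms] cong: measurable_cong)
qed

lemma conv_commute:
  assumes [measurable]: "f \<in> borel_measurable borel" "g \<in> borel_measurable borel"
  shows "conv f g x = conv g f x"
proof -
  have "(\<integral>y. f (x - y) * g y \<partial>lborel) = (\<integral>y. f (x - (x - y)) * g (x - y) \<partial>lborel)"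
    by (rule integral_lborel_minus[of "\<lambda>y. f (x - y) * g y", symmetric]) measurable
  then show ?thesis by (simp add: conv_lborel mult.commute)
qed

lemma norm_conv_le:
  assumes [measurable]: "f \<in> borel_measurable borel" "g \<in> borel_measurable borel"
  shows "ennreal (cmod (conv f g x)) \<le> (\<integral>\<^sup>+y. ennreal (cmod (f (x - y)) * cmod (g y)) \<partial>lborel)"
proof (cases "integrable lborel (\<lambda>y. f (x - y) * g y)")
  case True
  then show ?thesis
    using integral_norm_bound_ennreal[OF True] by (simp add: conv_lborel norm_mult)
next
  \<comment> \<open>Here the Bochner integral is 0 by convention.\<close>
  case False
  then show ?thesis by (simp add: conv_lborel not_integrable_integral_eq)
qed

text \<open>Tonelli: once the order is exchanged, a translation removes y from the integral of
  f.\<close>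

lemma nn_integral_conv:
  fixes f g :: "'a::euclidean_space \<Rightarrow> real"
  assumes [measurable]: "f \<in> borel_measurable borel" "g \<in> borel_measurable borel"
    and nonneg: "\<And>x. f x \<ge> 0" "\<And>x. g x \<ge> 0"
  shows "(\<integral>\<^sup>+x. (\<integral>\<^sup>+y. ennreal (f (x - y) * g y) \<partial>lborel) \<partial>lborel)
    = (\<integral>\<^sup>+x. ennreal (f x) \<partial>lborel) * (\<integral>\<^sup>+x. ennreal (g x) \<partial>lborel)"
proof -
  have "(\<integral>\<^sup>+x. (\<integral>\<^sup>+y. ennreal (f (x - y) * g y) \<partial>lborel) \<partial>lborel)
      = (\<integral>\<^sup>+y. (\<integral>\<^sup>+x. ennreal (f (x - y) * g y) \<partial>lborel) \<partial>lborel)"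
    by (rule lborel_pair.Fubini'[symmetric]) measurable
  also have "\<dots> = (\<integral>\<^sup>+y. (\<integral>\<^sup>+x. ennreal (f x) \<partial>lborel) * ennreal (g y) \<partial>lborel)"
    using nonneg
    by (intro nn_integral_cong)
       (simp add: ennreal_mult nn_integral_multc nn_integral_lborel_diff[of "\<lambda>x. ennreal (f x)"])
  also have "\<dots> = (\<integral>\<^sup>+x. ennreal (f x) \<partial>lborel) * (\<integral>\<^sup>+x. ennreal (g x) \<partial>lborel)"
    by (rule nn_integral_cmult) measurable
  finally show ?thesis .
qed

text \<open>Cauchy--Schwarz with respect to the measure \<open>f(x - y) dy\<close>.\<close>

lemma nn_integral_Young:
  fixes f g :: "'a::euclidean_space \<Rightarrow> real"
  assumes [measurable]: "f \<in> borel_measurable borel" "g \<in> borel_measurable borel"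
    and nonneg: "\<And>x. f x \<ge> 0" "\<And>x. g x \<ge> 0"
  shows "(\<integral>\<^sup>+x. (\<integral>\<^sup>+y. ennreal (f (x - y) * g y) \<partial>lborel)\<^sup>2 \<partial>lborel)
    \<le> (\<integral>\<^sup>+x. ennreal (f x) \<partial>lborel)\<^sup>2 * (\<integral>\<^sup>+x. ennreal ((g x)\<^sup>2) \<partial>lborel)"
proof -
  let ?F = "\<integral>\<^sup>+x. ennreal (f x) \<partial>lborel"
  have CS: "(\<integral>\<^sup>+y. ennreal (f (x - y) * g y) \<partial>lborel)\<^sup>2
      \<le> ?F * (\<integral>\<^sup>+y. ennreal (f (x - y) * (g y)\<^sup>2) \<partial>lborel)" for x
  proof -
    \<comment> \<open>With this splitting the square of the first factor integrates to the whole
      mass of f, independently of x.\<close>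
    have 1: "ennreal (f (x - y) * g y) = ennreal (sqrt (f (x - y))) * ennreal (sqrt (f (x - y)) * g y)" for y
      using nonneg by (simp add: mult.assoc[symmetric] flip: ennreal_mult')
    have 2: "(ennreal (sqrt (f (x - y))))\<^sup>2 = ennreal (f (x - y))" for y
      using nonneg by (simp add: ennreal_power)
    have 3: "(ennreal (sqrt (f (x - y)) * g y))\<^sup>2 = ennreal (f (x - y) * (g y)\<^sup>2)" for y
      using nonneg by (simp add: ennreal_power power_mult_distrib)
    have "(\<integral>\<^sup>+y. ennreal (sqrt (f (x - y))) * ennreal (sqrt (f (x - y)) * g y) \<partial>lborel)\<^sup>2
        \<le> (\<integral>\<^sup>+y. (ennreal (sqrt (f (x - y))))\<^sup>2 \<partial>lborel)
          * (\<integral>\<^sup>+y. (ennreal (sqrt (f (x - y)) * g y))\<^sup>2 \<partial>lborel)"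
      by (rule Cauchy_Schwarz_nn_integral) measurable
    then show ?thesis
      unfolding 2 3 by (simp only: 1[symmetric] nn_integral_lborel_minus[of "\<lambda>y. ennreal (f y)"] assms measurable_compose[OF assms(1) measurable_ennreal])
  qed
  have "(\<integral>\<^sup>+x. (\<integral>\<^sup>+y. ennreal (f (x - y) * g y) \<partial>lborel)\<^sup>2 \<partial>lborel)
      \<le> (\<integral>\<^sup>+x. ?F * (\<integral>\<^sup>+y. ennreal (f (x - y) * (g y)\<^sup>2) \<partial>lborel) \<partial>lborel)"
    by (intro nn_integral_mono CS)
  also have "\<dots> = ?F * (\<integral>\<^sup>+x. (\<integral>\<^sup>+y. ennreal (f (x - y) * (g y)\<^sup>2) \<partial>lborel) \<partial>lborel)"
    by (rule nn_integral_cmult) measurable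
  also have "\<dots> = ?F * (?F * (\<integral>\<^sup>+x. ennreal ((g x)\<^sup>2) \<partial>lborel))"
    using nonneg by (subst nn_integral_conv[of f "\<lambda>y. (g y)\<^sup>2"]) auto
  finally show ?thesis by (simp add: power2_eq_square mult.assoc)
qed

lemma ennreal_square_less_top: "(x :: ennreal)\<^sup>2 < top \<Longrightarrow> x < top"
  by (auto simp: power2_eq_square ennreal_mult_less_top)

lemma nn_integral_cmod_integrable:
  "integrable M f \<Longrightarrow> (\<integral>\<^sup>+x. ennreal (cmod (f x)) \<partial>M) = ennreal (\<integral>x. cmod (f x) \<partial>M)"
  by (rule nn_integral_eq_integral) auto

lemma nn_integral_conv_square:
  fixes a u :: "'a::euclidean_space \<Rightarrow> complex"
  assumes a: "integrable lborel a" and u: "u \<in> L2 lborel"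
  shows "(\<integral>\<^sup>+x. (\<integral>\<^sup>+y. ennreal (cmod (a (x - y)) * cmod (u y)) \<partial>lborel)\<^sup>2 \<partial>lborel)
    \<le> ennreal (((\<integral>x. cmod (a x) \<partial>lborel) * L2_norm_on lborel u)\<^sup>2)"
proof -
  have [measurable]: "a \<in> borel_measurable borel" "u \<in> borel_measurable borel"
    using a u L2_measurable[OF u] by auto
  have "(\<integral>\<^sup>+x. (\<integral>\<^sup>+y. ennreal (cmod (a (x - y)) * cmod (u y)) \<partial>lborel)\<^sup>2 \<partial>lborel)
     \<le> (\<integral>\<^sup>+x. ennreal (cmod (a x)) \<partial>lborel)\<^sup>2 * (\<integral>\<^sup>+x. ennreal ((cmod (u x))\<^sup>2) \<partial>lborel)"
    by (rule nn_integral_Young[of "\<lambda>x. cmod (a x)" "\<lambda>x. cmod (u x)"]) auto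
  also have "\<dots> = ennreal (((\<integral>x. cmod (a x) \<partial>lborel) * L2_norm_on lborel u)\<^sup>2)"
    using a u
    by (simp add: nn_integral_cmod_integrable L2_nn_integral ennreal_power power_mult_distrib flip: ennreal_mult')
  finally show ?thesis .
qed

text \<open>All three claims follow from Young's inequality for |a| and |u|: the convolution of the
  moduli has a finite square integral, so it is finite almost everywhere and dominates
  \<open>conv a u\<close>.\<close>

lemma conv_L2:
  fixes a u :: "'a::euclidean_space \<Rightarrow> complex"
  assumes a: "integrable lborel a" and u: "u \<in> L2 lborel"
  shows conv_in_L2: "conv a u \<in> L2 lborel"
    and L2_norm_conv: "L2_norm_on lborel (conv a u) \<le> (\<integral>x. cmod (a x) \<partial>lborel) * L2_norm_on lborel u"
    and AE_integrable_conv: "AE x in lborel. integrable lborel (\<lambda>y. a (x - y) * u y)"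
proof -
  have [measurable]: "a \<in> borel_measurable borel" "u \<in> borel_measurable borel"
    using a u L2_measurable[OF u] by auto
  note bound = nn_integral_conv_square[OF a u]
  have le: "(\<integral>\<^sup>+x. ennreal ((cmod (conv a u x))\<^sup>2) \<partial>lborel)
      \<le> ennreal (((\<integral>x. cmod (a x) \<partial>lborel) * L2_norm_on lborel u)\<^sup>2)"
    by (rule order_trans[OF nn_integral_mono bound])
       (auto simp: ennreal_power[symmetric] intro!: power_mono norm_conv_le)
  then show L2: "conv a u \<in> L2 lborel"
    by (auto simp: L2_iff_nn_integral intro: le_less_trans)
  have "(L2_norm_on lborel (conv a u))\<^sup>2 \<le> ((\<integral>x. cmod (a x) \<partial>lborel) * L2_norm_on lborel u)\<^sup>2"
    using le by (simp add: L2_nn_integral[OF L2])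
  then show "L2_norm_on lborel (conv a u) \<le> (\<integral>x. cmod (a x) \<partial>lborel) * L2_norm_on lborel u"
    by (rule power2_le_imp_le) (auto simp: L2_norm_on_def)
  have "AE x in lborel. (\<integral>\<^sup>+y. ennreal (cmod (a (x - y)) * cmod (u y)) \<partial>lborel)\<^sup>2 \<noteq> \<infinity>"
    using bound by (intro nn_integral_PInf_AE) (auto simp: top_unique)
  then show "AE x in lborel. integrable lborel (\<lambda>y. a (x - y) * u y)"
  proof eventually_elim
    case (elim x)
    then have "(\<integral>\<^sup>+y. ennreal (cmod (a (x - y)) * cmod (u y)) \<partial>lborel) < \<infinity>"
      by (auto simp: less_top[symmetric] intro: ennreal_square_less_top)
    then show ?case by (auto intro!: integrableI_bounded simp: norm_mult)
  qed
qed

lemma integrable_conv_product: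
  fixes f g :: "'a::euclidean_space \<Rightarrow> complex"
  assumes f: "integrable lborel f" and g: "integrable lborel g"
  shows "integrable (lborel \<Otimes>\<^sub>M lborel) (\<lambda>(x, y). f (x - y) * g y)"
proof (rule integrableI_bounded)
  have [measurable]: "f \<in> borel_measurable borel" "g \<in> borel_measurable borel" using f g by auto
  show "(\<lambda>(x, y). f (x - y) * g y) \<in> borel_measurable (lborel \<Otimes>\<^sub>M lborel)" by measurable
  have "(\<integral>\<^sup>+p. ennreal (norm (case p of (x, y) \<Rightarrow> f (x - y) * g y)) \<partial>(lborel \<Otimes>\<^sub>M lborel))
      = (\<integral>\<^sup>+x. \<integral>\<^sup>+y. ennreal (norm (case (x, y) of (x, y) \<Rightarrow> f (x - y) * g y)) \<partial>lborel \<partial>lborel)"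
    by (rule lborel.nn_integral_fst[symmetric]) measurable
  also have "\<dots> = ennreal (\<integral>x. cmod (f x) \<partial>lborel) * ennreal (\<integral>x. cmod (g x) \<partial>lborel)"
    using nn_integral_conv[of "\<lambda>x. cmod (f x)" "\<lambda>x. cmod (g x)"] f g
    by (simp add: norm_mult nn_integral_cmod_integrable)
  also have "\<dots> < \<infinity>" by (simp add: ennreal_mult_less_top)
  finally show "(\<integral>\<^sup>+p. ennreal (norm (case p of (x, y) \<Rightarrow> f (x - y) * g y)) \<partial>(lborel \<Otimes>\<^sub>M lborel)) < \<infinity>" .
qed

lemma integrable_conv:
  assumes f: "integrable lborel f" and g: "integrable lborel g"
  shows "integrable lborel (conv f g)"
proof -
  have [measurable]: "f \<in> borel_measurable borel" "g \<in> borel_measurable borel" using f g by auto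
  have "integrable lborel (\<lambda>x. \<integral>y. (case (x, y) of (x, y) \<Rightarrow> f (x - y) * g y) \<partial>lborel)"
    by (rule lborel_pair.integrable_fst'[OF integrable_conv_product[OF f g]])
  then show ?thesis by (simp add: conv_lborel cong: Bochner_Integration.integrable_cong)
qed

lemma integrable_bounded_kernel:
  fixes \<phi> g :: "'a::euclidean_space \<Rightarrow> complex"
  assumes [measurable]: "\<phi> \<in> borel_measurable borel" and M: "\<And>x. cmod (\<phi> x) \<le> M"
    and g: "integrable lborel g"
  shows "integrable lborel (\<lambda>y. \<phi> (x - y) * g y)"
proof -
  have [measurable]: "g \<in> borel_measurable borel" using g by auto
  have "0 \<le> M" using M[of 0] norm_ge_zero order_trans by blast
  then show ?thesis
    by (intro Bochner_Integration.integrable_bound[OF integrable_mult_right[OF g, of "complex_of_real M"]])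
       (use g M in \<open>auto simp: norm_mult intro!: mult_right_mono\<close>)
qed

lemma norm_conv_bounded_kernel:
  fixes \<phi> g :: "'a::euclidean_space \<Rightarrow> complex"
  assumes [measurable]: "\<phi> \<in> borel_measurable borel" and M: "\<And>x. cmod (\<phi> x) \<le> M"
    and g: "integrable lborel g"
  shows "cmod (conv \<phi> g x) \<le> M * (\<integral>y. cmod (g y) \<partial>lborel)"
proof -
  have [measurable]: "g \<in> borel_measurable borel" using g by auto
  have "cmod (conv \<phi> g x) \<le> (\<integral>y. cmod (\<phi> (x - y) * g y) \<partial>lborel)"
    unfolding conv_lborel[OF assms(1) \<open>g \<in> _\<close>] by (rule integral_norm_bound)
  also have "\<dots> \<le> (\<integral>y. M * cmod (g y) \<partial>lborel)"
    using M g by (intro integral_mono[OF integrable_norm[OF integrable_bounded_kernel[OF assms]]])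
      (auto simp: norm_mult intro!: mult_right_mono)
  finally show ?thesis by simp
qed

text \<open>The increment of the convolution is the convolution of g with an increment of \<phi>,
  which is uniformly small. As d depends on g only through the bound C of its L1 norm, whole
  families are equicontinuous.\<close>

lemma conv_Cc_equicontinuous:
  fixes \<phi> :: "'a::euclidean_space \<Rightarrow> complex"
  assumes \<phi>: "\<phi> \<in> Cc" and "e > 0"
  obtains d where "d > 0" "\<And>g x x'. integrable lborel g \<Longrightarrow> (\<integral>y. cmod (g y) \<partial>lborel) \<le> C \<Longrightarrow>
    norm (x' - x) < d \<Longrightarrow> cmod (conv \<phi> g x' - conv \<phi> g x) < e"
proof -
  note [measurable] = Cc_borel[OF \<phi>]
  \<comment> \<open>C may be zero or negative, so a positive number above it is used as
    divisor.\<close>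
  define G where "G = \<bar>C\<bar> + 1"
  have "G > 0" "C < G" by (auto simp: G_def)
  obtain M where M: "\<And>x. cmod (\<phi> x) \<le> M" using Cc_bounded[OF \<phi>] by blast
  obtain d where d: "d > 0" "\<And>x y. norm (x - y) < d \<Longrightarrow> cmod (\<phi> x - \<phi> y) < e / G"
    using Cc_uniformly_continuous[OF \<phi>, of "e / G"] \<open>e > 0\<close> \<open>G > 0\<close> by auto
  show ?thesis
  proof (rule that[OF d(1)])
    fix g :: "'a \<Rightarrow> complex" and x x' :: 'a
    assume g: "integrable lborel g" "(\<integral>y. cmod (g y) \<partial>lborel) \<le> C" and x': "norm (x' - x) < d"
    have [measurable]: "g \<in> borel_measurable borel" using g by auto
    have int: "integrable lborel (\<lambda>y. \<phi> (z - y) * g y)" for z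
      by (rule integrable_bounded_kernel[OF _ M g(1)]) measurable
    let ?\<psi> = "\<lambda>z. \<phi> (z + (x' - x)) - \<phi> z"
    have "conv ?\<psi> g x = (\<integral>y. ?\<psi> (x - y) * g y \<partial>lborel)"
      by (rule conv_lborel) measurable
    also have "\<dots> = (\<integral>y. \<phi> (x' - y) * g y - \<phi> (x - y) * g y \<partial>lborel)"
      by (simp add: left_diff_distrib algebra_simps)
    also have "\<dots> = conv \<phi> g x' - conv \<phi> g x"
      using int by (simp add: conv_lborel)
    finally have "conv ?\<psi> g x = conv \<phi> g x' - conv \<phi> g x" .
    then have "cmod (conv \<phi> g x' - conv \<phi> g x) = cmod (conv ?\<psi> g x)" by (simp only:)
    also have "\<dots> \<le> e / G * (\<integral>y. cmod (g y) \<partial>lborel)"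
      using d(2) x' by (intro norm_conv_bounded_kernel g) (auto intro: less_imp_le)
    also have "\<dots> \<le> e / G * C"
      using g(2) \<open>e > 0\<close> \<open>G > 0\<close> by (intro mult_left_mono) auto
    also have "\<dots> < e"
      using \<open>e > 0\<close> \<open>G > 0\<close> \<open>C < G\<close> by (simp add: field_simps)
    finally show "cmod (conv \<phi> g x' - conv \<phi> g x) < e" .
  qed
qed

lemma conv_Cc_continuous:
  assumes \<phi>: "\<phi> \<in> Cc" and g: "integrable lborel g"
  shows "continuous_on UNIV (conv \<phi> g)"
  unfolding continuous_on_iff dist_norm
proof (intro ballI allI impI)
  fix x :: 'a and e :: real assume "e > 0"
  show "\<exists>d>0. \<forall>x'\<in>UNIV. norm (x' - x) < d \<longrightarrow> cmod (conv \<phi> g x' - conv \<phi> g x) < e"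
    by (rule conv_Cc_equicontinuous[OF \<phi> \<open>e > 0\<close>, of "\<integral>y. cmod (g y) \<partial>lborel"]) (use g in auto)
qed

lemma conv_Cc_bounded:
  assumes \<phi>: "\<phi> \<in> Cc" and g: "integrable lborel g"
  obtains M where "\<And>x. cmod (conv \<phi> g x) \<le> M"
proof -
  obtain M where "\<And>x. cmod (\<phi> x) \<le> M" using Cc_bounded[OF \<phi>] by blast
  then show ?thesis using that norm_conv_bounded_kernel[OF Cc_borel[OF \<phi>] _ g] by blast
qed

text \<open>The kernel of the adjoint of convolution with a.\<close>

definition adj :: "('a::euclidean_space \<Rightarrow> complex) \<Rightarrow> 'a \<Rightarrow> complex" where
  "adj a x = cnj (a (- x))"

lemma adj_borel [measurable]:
  assumes [measurable]: "a \<in> borel_measurable borel" shows "adj a \<in> borel_measurable borel"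
proof -
  have "continuous_on UNIV cnj" by (intro continuous_intros)
  then have [measurable]: "cnj \<in> borel_measurable borel" by (rule borel_measurable_continuous_onI)
  show ?thesis unfolding adj_def by measurable
qed

lemma inner_complex_mult_cnj: "x \<bullet> y = Re (x * cnj y)" for x y :: complex
  by (simp add: inner_complex_def)

text \<open>Fubini. The double integral converges absolutely by Cauchy-Schwarz for v and the
  convolution of |a| with |u|, whose L2 norm Young's inequality controls.\<close>

lemma conv_adjoint:
  fixes a u v :: "'a::euclidean_space \<Rightarrow> complex"
  assumes a: "integrable lborel a" and u: "u \<in> L2 lborel" and v: "v \<in> L2 lborel"
  shows "(\<integral>x. conv a u x * cnj (v x) \<partial>lborel) = (\<integral>y. u y * cnj (conv (adj a) v y) \<partial>lborel)"
proof -
  have am[measurable]: "a \<in> borel_measurable borel" and um[measurable]: "u \<in> borel_measurable borel"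
    and vm[measurable]: "v \<in> borel_measurable borel"
    using a L2_measurable[OF u] L2_measurable[OF v] by auto
  have "continuous_on UNIV cnj" by (intro continuous_intros)
  then have [measurable]: "cnj \<in> borel_measurable borel" by (rule borel_measurable_continuous_onI)
  let ?k = "\<lambda>x y. a (x - y) * u y * cnj (v x)"
  have int: "integrable (lborel \<Otimes>\<^sub>M lborel) (\<lambda>(x, y). ?k x y)"
  proof (rule integrableI_bounded)
    show "(\<lambda>(x, y). ?k x y) \<in> borel_measurable (lborel \<Otimes>\<^sub>M lborel)" by measurable
    let ?h = "\<lambda>x. \<integral>\<^sup>+y. ennreal (cmod (a (x - y)) * cmod (u y)) \<partial>lborel"
    have "(\<integral>\<^sup>+p. ennreal (norm (case p of (x, y) \<Rightarrow> ?k x y)) \<partial>(lborel \<Otimes>\<^sub>M lborel))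
        = (\<integral>\<^sup>+x. \<integral>\<^sup>+y. ennreal (norm (case (x, y) of (x, y) \<Rightarrow> ?k x y)) \<partial>lborel \<partial>lborel)"
      by (rule lborel.nn_integral_fst[symmetric]) measurable
    also have "\<dots> = (\<integral>\<^sup>+x. ?h x * ennreal (cmod (v x)) \<partial>lborel)"
      by (intro nn_integral_cong) (simp add: norm_mult ennreal_mult nn_integral_multc)
    finally have eq: "(\<integral>\<^sup>+p. ennreal (norm (case p of (x, y) \<Rightarrow> ?k x y)) \<partial>(lborel \<Otimes>\<^sub>M lborel))
        = (\<integral>\<^sup>+x. ?h x * ennreal (cmod (v x)) \<partial>lborel)" .
    have "(\<integral>\<^sup>+x. ?h x * ennreal (cmod (v x)) \<partial>lborel)\<^sup>2
        \<le> (\<integral>\<^sup>+x. (?h x)\<^sup>2 \<partial>lborel) * (\<integral>\<^sup>+x. (ennreal (cmod (v x)))\<^sup>2 \<partial>lborel)"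
      by (rule Cauchy_Schwarz_nn_integral) measurable
    also have "\<dots> < \<infinity>"
      using nn_integral_conv_square[OF a u] v
      by (auto simp: ennreal_mult_less_top L2_nn_integral ennreal_power intro: le_less_trans)
    finally show "(\<integral>\<^sup>+p. ennreal (norm (case p of (x, y) \<Rightarrow> ?k x y)) \<partial>(lborel \<Otimes>\<^sub>M lborel)) < \<infinity>"
      unfolding eq by (simp add: ennreal_square_less_top)
  qed
  have "(\<integral>x. conv a u x * cnj (v x) \<partial>lborel) = (\<integral>x. (\<integral>y. ?k x y \<partial>lborel) \<partial>lborel)"
    by (simp add: conv_lborel)
  also have "\<dots> = (\<integral>y. (\<integral>x. ?k x y \<partial>lborel) \<partial>lborel)"
    by (rule lborel_pair.Fubini_integral[symmetric]) (use int in simp)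
  also have "\<dots> = (\<integral>y. u y * cnj (conv (adj a) v y) \<partial>lborel)"
  proof (rule Bochner_Integration.integral_cong[OF refl])
    fix y
    have "cnj (conv (adj a) v y) = (\<integral>x. cnj (adj a (y - x) * v x) \<partial>lborel)"
      by (subst conv_lborel) (simp_all add: Bochner_Integration.integral_cnj[symmetric] del: Bochner_Integration.integral_cnj)
    then have "u y * cnj (conv (adj a) v y) = (\<integral>x. u y * cnj (adj a (y - x) * v x) \<partial>lborel)"
      by simp
    then show "(\<integral>x. ?k x y \<partial>lborel) = u y * cnj (conv (adj a) v y)"
      by (auto simp: adj_def mult_ac)
  qed
  finally show ?thesis .
qed

section \<open>Convolution as an operator on \<open>lsq\<close>\<close>

definition conv_op :: "('a::euclidean_space \<Rightarrow> complex) \<Rightarrow> 'a lsq \<Rightarrow> 'a lsq" where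
  "conv_op a x = lsq (conv a (rep_lsq x))"

lemma conv_lebesgue_L2:
  fixes a u :: "'a::euclidean_space \<Rightarrow> complex"
  assumes a: "integrable lborel a" and u: "u \<in> L2 lebesgue"
  shows "conv a u \<in> L2 lebesgue" "AE x in lebesgue. integrable lebesgue (\<lambda>y. a (x - y) * u y)"
    "L2_norm_on lebesgue (conv a u) \<le> (\<integral>x. cmod (a x) \<partial>lborel) * L2_norm_on lebesgue u"
proof -
  have am[measurable]: "a \<in> borel_measurable borel" using a by auto
  obtain v where v[measurable]: "v \<in> borel_measurable borel" and uv: "AE x in lebesgue. u x = v x"
    using lebesgue_borel_representative[OF L2_measurable[OF u]] .
  have vL: "v \<in> L2 lebesgue" using L2_cong_AE[OF u] uv by (simp add: borel_imp_lebesgue_measurable)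
  then have vB: "v \<in> L2 lborel" by (simp add: L2_lebesgue_borel)
  have eq: "conv a u = conv a v"
    using uv L2_measurable[OF u] by (intro conv_cong_AE) (auto simp: borel_imp_lebesgue_measurable)
  have [measurable]: "u \<in> borel_measurable lebesgue" "v \<in> borel_measurable lebesgue"
    using L2_measurable[OF u] L2_measurable[OF vL] by auto
  show "conv a u \<in> L2 lebesgue"
    using conv_in_L2[OF a vB] by (simp add: eq L2_lebesgue_borel)
  have "L2_norm_on lebesgue u = L2_norm_on lborel v"
  proof -
    have "(\<integral>x. (cmod (u x))\<^sup>2 \<partial>lebesgue) = (\<integral>x. (cmod (v x))\<^sup>2 \<partial>lebesgue)"
      by (rule integral_cong_AE) (use uv in auto)
    then show ?thesis by (simp add: L2_norm_on_def integral_lebesgue_borel)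
  qed
  moreover have "L2_norm_on lebesgue (conv a v) = L2_norm_on lborel (conv a v)"
    by (simp add: L2_norm_on_def integral_lebesgue_borel)
  ultimately show "L2_norm_on lebesgue (conv a u) \<le> (\<integral>x. cmod (a x) \<partial>lborel) * L2_norm_on lebesgue u"
    using L2_norm_conv[OF a vB] by (simp add: eq)
  show "AE x in lebesgue. integrable lebesgue (\<lambda>y. a (x - y) * u y)"
  proof -
    have "AE x in lebesgue. integrable lborel (\<lambda>y. a (x - y) * v y)"
      by (rule AE_completion[OF AE_integrable_conv[OF a vB]])
    then show ?thesis
    proof eventually_elim
      case (elim x)
      have [measurable]: "(\<lambda>y. a (x - y)) \<in> borel_measurable lebesgue"
        by (rule borel_imp_lebesgue_measurable) measurable
      have "integrable lebesgue (\<lambda>y. a (x - y) * v y)"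
        using elim by (subst integrable_completion) auto
      then show ?case
        using uv by (subst integrable_cong_AE[where g = "\<lambda>y. a (x - y) * v y"]) auto
    qed
  qed
qed

lemma conv_op_lsq:
  assumes a: "integrable lborel a" and u: "u \<in> L2 lebesgue"
  shows "conv_op a (lsq u) = lsq (conv a u)"
proof -
  have "conv a (rep_lsq (lsq u)) = conv a u"
    using rep_lsq_ae_eq[OF u] a L2_measurable[OF u] L2_measurable[OF rep_lsq_L2[of "lsq u"]]
    by (intro conv_cong_AE) (auto simp: borel_imp_lebesgue_measurable ae_eq_def)
  then show ?thesis by (simp add: conv_op_def)
qed

lemma conv_op_add:
  assumes a: "integrable lborel a"
  shows "conv_op a (x + y) = conv_op a x + conv_op a y"
proof -
  obtain u v where u: "u \<in> L2 lebesgue" "x = lsq u" and v: "v \<in> L2 lebesgue" "y = lsq v"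
    by (meson lsq_cases)
  \<comment> \<open>Additivity may fail where one of the integrals diverges and takes the
    conventional value 0; that happens only on a null set.\<close>
  have "ae_eq lebesgue (conv a (\<lambda>x. u x + v x)) (\<lambda>x. conv a u x + conv a v x)"
    using conv_lebesgue_L2(2)[OF a u(1)] conv_lebesgue_L2(2)[OF a v(1)]
    unfolding ae_eq_def by eventually_elim (simp add: conv_def distrib_left)
  then show ?thesis
    using u v a by (simp add: lsq_add conv_op_lsq L2_add conv_lebesgue_L2(1) lsq_eq_iff)
qed

lemma conv_op_scaleR:
  assumes a: "integrable lborel a"
  shows "conv_op a (r *\<^sub>R x) = r *\<^sub>R conv_op a x"
proof -
  obtain u where u: "u \<in> L2 lebesgue" "x = lsq u" by (rule lsq_cases)
  have "conv a (\<lambda>x. complex_of_real r * u x) = (\<lambda>x. complex_of_real r * conv a u x)"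
    by (simp add: conv_def fun_eq_iff mult.left_commute)
  then show ?thesis
    using u a by (simp add: lsq_scaleR conv_op_lsq L2_scale conv_lebesgue_L2(1))
qed

lemma norm_conv_op:
  assumes a: "integrable lborel a"
  shows "norm (conv_op a x) \<le> (\<integral>x. cmod (a x) \<partial>lborel) * norm x"
proof -
  obtain u where u: "u \<in> L2 lebesgue" "x = lsq u" by (rule lsq_cases)
  then show ?thesis using conv_lebesgue_L2[OF a u(1)] a by (simp add: conv_op_lsq lsq_norm)
qed

lemma bounded_linear_conv_op:
  assumes a: "integrable lborel a"
  shows "bounded_linear (conv_op a)"
  by (rule bounded_linear_intro[where K = "\<integral>x. cmod (a x) \<partial>lborel"])
     (use norm_conv_op[OF a] in \<open>auto simp: conv_op_add[OF a] conv_op_scaleR[OF a] mult.commute\<close>)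

lemma conv_op_diff_kernel:
  assumes a: "integrable lborel a" and b: "integrable lborel b"
  shows "conv_op (\<lambda>x. a x - b x) x = conv_op a x - conv_op b x"
proof -
  obtain u where u: "u \<in> L2 lebesgue" "x = lsq u" by (rule lsq_cases)
  have ab: "integrable lborel (\<lambda>x. a x - b x)" using a b by auto
  have "ae_eq lebesgue (conv (\<lambda>x. a x - b x) u) (\<lambda>x. conv a u x - conv b u x)"
    using conv_lebesgue_L2(2)[OF a u(1)] conv_lebesgue_L2(2)[OF b u(1)]
    unfolding ae_eq_def by eventually_elim (simp add: conv_def left_diff_distrib)
  then show ?thesis
    using u a b ab by (simp add: lsq_diff conv_op_lsq L2_diff conv_lebesgue_L2(1) lsq_eq_iff)
qed

lemma conv_op_adjoint:
  assumes a: "integrable lborel a"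
  shows "inner (conv_op a x) y = inner x (conv_op (adj a) y)"
proof -
  have [measurable]: "a \<in> borel_measurable borel" using a by auto
  have a': "integrable lborel (adj a)"
  proof -
    have "integrable lborel (\<lambda>x. a (0 - x))"
      using a integrable_lborel_minus[of a 0] by simp
    then show ?thesis unfolding adj_def by simp
  qed
  obtain u where u: "u \<in> borel_measurable borel" "u \<in> L2 lborel" "x = lsq u" by (rule lsq_borel_cases)
  obtain v where v: "v \<in> borel_measurable borel" "v \<in> L2 lborel" "y = lsq v" by (rule lsq_borel_cases)
  note [measurable] = u(1) v(1)
  have uL: "u \<in> L2 lebesgue" and vL: "v \<in> L2 lebesgue"
    using u v by (auto simp: L2_lebesgue_borel)
  \<comment> \<open>The real and imaginary parts of f \<open>cnj g\<close> are the plane products of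
    f with g and with i g, both integrable for L2 functions.\<close>
  have mult_int: "integrable lborel (\<lambda>x. f x * cnj (g x))"
    if f: "f \<in> L2 lborel" and g: "g \<in> L2 lborel" for f g :: "'a \<Rightarrow> complex"
  proof -
    have 1: "integrable lborel (\<lambda>x. f x \<bullet> g x)" using L2_inner_integrable[OF f g] .
    have 2: "integrable lborel (\<lambda>x. f x \<bullet> (\<i> * g x))" using L2_inner_integrable[OF f L2_scale[OF g]] .
    have "f x * cnj (g x) = complex_of_real (f x \<bullet> g x) + \<i> * complex_of_real (f x \<bullet> (\<i> * g x))" for x
      by (simp add: inner_complex_def complex_eq_iff)
    then show ?thesis using 1 2 by simp
  qed
  have "inner (conv_op a x) y = (\<integral>x. Re (conv a u x * cnj (v x)) \<partial>lborel)"
    using conv_lebesgue_L2(1)[OF a uL] uL vL a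
    by (simp add: u(3) v(3) conv_op_lsq lsq_inner inner_complex_mult_cnj integral_lebesgue_borel)
  also have "\<dots> = Re (\<integral>x. conv a u x * cnj (v x) \<partial>lborel)"
    by (rule integral_Re[OF mult_int[OF conv_in_L2[OF a u(2)] v(2)]])
  also have "\<dots> = Re (\<integral>y. u y * cnj (conv (adj a) v y) \<partial>lborel)"
    by (simp only: conv_adjoint[OF a u(2) v(2)])
  also have "\<dots> = (\<integral>y. Re (u y * cnj (conv (adj a) v y)) \<partial>lborel)"
    by (rule integral_Re[OF mult_int[OF u(2) conv_in_L2[OF a' v(2)]], symmetric])
  also have "\<dots> = inner x (conv_op (adj a) y)"
    using conv_lebesgue_L2(1)[OF a' vL] uL vL a'
    by (simp add: u(3) v(3) conv_op_lsq lsq_inner inner_complex_mult_cnj integral_lebesgue_borel)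
  finally show ?thesis .
qed

section \<open>The Fourier transform\<close>

definition fkernel :: "real ^ 'd \<Rightarrow> real ^ 'd \<Rightarrow> complex" where
  "fkernel x \<xi> = exp (- \<i> * complex_of_real (x \<bullet> \<xi>))"

lemma norm_fkernel [simp]: "cmod (fkernel x \<xi>) = 1"
  by (simp add: fkernel_def norm_exp_eq_Re)

lemma fkernel_borel [measurable]: "fkernel x \<in> borel_measurable borel"
  unfolding fkernel_def by (intro borel_measurable_continuous_onI continuous_intros)

lemma fkernel_diff: "fkernel x (y - z) * fkernel x z = fkernel x y"
  by (simp add: fkernel_def inner_diff_right algebra_simps flip: exp_add)

lemma fkernel_commute: "fkernel x y = fkernel y x"
  by (simp add: fkernel_def inner_commute)

lemma fourier_lborel:
  assumes [measurable]: "u \<in> borel_measurable borel"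
  shows "fourier u x = (\<integral>\<xi>. u \<xi> * fkernel x \<xi> \<partial>lborel)"
  unfolding fourier_def fkernel_def[symmetric] by (rule integral_lebesgue_borel) measurable

lemma integrable_fkernel:
  assumes "integrable lborel u"
  shows "integrable lborel (\<lambda>\<xi>. u \<xi> * fkernel x \<xi>)"
  by (rule Bochner_Integration.integrable_bound[OF assms]) (use assms in \<open>auto simp: norm_mult\<close>)

lemma norm_fourier_le:
  assumes u: "integrable lborel u"
  shows "cmod (fourier u x) \<le> (\<integral>\<xi>. cmod (u \<xi>) \<partial>lborel)"
proof -
  have "u \<in> borel_measurable borel" using u by auto
  then show ?thesis
    using integral_norm_bound[of lborel "\<lambda>\<xi>. u \<xi> * fkernel x \<xi>"] by (simp add: fourier_lborel norm_mult)
qed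

lemma fourier_diff:
  assumes u: "integrable lborel u" and v: "integrable lborel v"
  shows "fourier (\<lambda>x. u x - v x) x = fourier u x - fourier v x"
proof -
  have [measurable]: "u \<in> borel_measurable borel" "v \<in> borel_measurable borel" using u v by auto
  show ?thesis
    using integrable_fkernel[OF u, of x] integrable_fkernel[OF v, of x]
    by (simp add: fourier_lborel left_diff_distrib)
qed

lemma fourier_mult_left:
  assumes u: "integrable lborel u"
  shows "fourier (\<lambda>x. c * u x) x = c * fourier u x"
proof -
  have [measurable]: "u \<in> borel_measurable borel" using u by auto
  show ?thesis by (simp add: fourier_lborel mult.assoc)
qed

lemma continuous_fourier:
  fixes u :: "real ^ 'd \<Rightarrow> complex"
  assumes u: "integrable lborel u"
  shows "continuous_on UNIV (fourier u)"
proof (rule continuous_on_sequentiallyI)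
  fix X :: "nat \<Rightarrow> real ^ 'd" and x assume X: "X \<longlonglongrightarrow> x"
  have [measurable]: "u \<in> borel_measurable borel" using u by auto
  have "(\<lambda>n. \<integral>\<xi>. u \<xi> * fkernel (X n) \<xi> \<partial>lborel) \<longlonglongrightarrow> (\<integral>\<xi>. u \<xi> * fkernel x \<xi> \<partial>lborel)"
  proof (rule integral_dominated_convergence[where w = "\<lambda>\<xi>. cmod (u \<xi>)"])
    show "AE \<xi> in lborel. (\<lambda>n. u \<xi> * fkernel (X n) \<xi>) \<longlonglongrightarrow> u \<xi> * fkernel x \<xi>"
      unfolding fkernel_def by (intro AE_I2 tendsto_intros X)
  qed (use u in \<open>auto simp: norm_mult\<close>)
  then show "(\<lambda>n. fourier u (X n)) \<longlonglongrightarrow> fourier u x" by (simp add: fourier_lborel)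
qed

lemma integral_conv:
  fixes f g :: "'a::euclidean_space \<Rightarrow> complex"
  assumes f: "integrable lborel f" and g: "integrable lborel g"
  shows "(\<integral>x. conv f g x \<partial>lborel) = (\<integral>x. f x \<partial>lborel) * (\<integral>x. g x \<partial>lborel)"
proof -
  have [measurable]: "f \<in> borel_measurable borel" "g \<in> borel_measurable borel" using f g by auto
  have "(\<integral>x. conv f g x \<partial>lborel) = (\<integral>x. \<integral>y. f (x - y) * g y \<partial>lborel \<partial>lborel)"
    by (simp add: conv_lborel)
  also have "\<dots> = (\<integral>y. \<integral>x. f (x - y) * g y \<partial>lborel \<partial>lborel)"
    by (rule lborel_pair.Fubini_integral[symmetric]) (rule integrable_conv_product[OF f g])
  also have "\<dots> = (\<integral>y. (\<integral>x. f x \<partial>lborel) * g y \<partial>lborel)"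
    by (simp add: integral_lborel_diff)
  finally show ?thesis by simp
qed

text \<open>Multiplying by a character commutes with convolution, so the claim reduces to the
  integral of a convolution.\<close>

lemma fourier_conv:
  assumes f: "integrable lborel f" and g: "integrable lborel g"
  shows "fourier (conv f g) x = fourier f x * fourier g x"
proof -
  have [measurable]: "f \<in> borel_measurable borel" "g \<in> borel_measurable borel" using f g by auto
  have "conv f g y * fkernel x y = conv (\<lambda>\<xi>. f \<xi> * fkernel x \<xi>) (\<lambda>\<xi>. g \<xi> * fkernel x \<xi>) y" for y
  proof -
    have "f (y - z) * g z * fkernel x y = f (y - z) * fkernel x (y - z) * (g z * fkernel x z)" for z
      using fkernel_diff[of x y z] by (metis (no_types, lifting) mult.assoc mult.left_commute)
    moreover have "conv f g y * fkernel x y = (\<integral>z. f (y - z) * g z * fkernel x y \<partial>lborel)"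
      by (simp add: conv_lborel)
    moreover have "conv (\<lambda>\<xi>. f \<xi> * fkernel x \<xi>) (\<lambda>\<xi>. g \<xi> * fkernel x \<xi>) y
        = (\<integral>z. f (y - z) * fkernel x (y - z) * (g z * fkernel x z) \<partial>lborel)"
      by (rule conv_lborel) measurable
    ultimately show ?thesis by (simp only:)
  qed
  then show ?thesis
    using integral_conv[OF integrable_fkernel[OF f] integrable_fkernel[OF g], of x x]
    by (simp add: fourier_lborel)
qed

lemma integrable_adj:
  fixes a :: "'a::euclidean_space \<Rightarrow> complex"
  assumes "integrable lborel a" shows "integrable lborel (adj a)"
proof -
  have "a \<in> borel_measurable borel" using assms by auto
  then have "integrable lborel (\<lambda>x. a (0 - x))"
    using assms integrable_lborel_minus[of a 0] by simp
  then show ?thesis unfolding adj_def by simp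
qed

lemma fourier_adj:
  assumes a: "integrable lborel a"
  shows "fourier (adj a) x = cnj (fourier a x)"
proof -
  have [measurable]: "a \<in> borel_measurable borel" using a by auto
  have "fourier (adj a) x = (\<integral>\<xi>. cnj (a (0 - \<xi>) * fkernel x (0 - \<xi>)) \<partial>lborel)"
    by (simp add: fourier_lborel adj_def fkernel_def exp_cnj)
  also have "\<dots> = cnj (\<integral>\<xi>. a (0 - \<xi>) * fkernel x (0 - \<xi>) \<partial>lborel)"
    by (rule Bochner_Integration.integral_cnj)
  also have "(\<integral>\<xi>. a (0 - \<xi>) * fkernel x (0 - \<xi>) \<partial>lborel) = (\<integral>\<xi>. a \<xi> * fkernel x \<xi> \<partial>lborel)"
    by (rule integral_lborel_minus[of "\<lambda>\<xi>. a \<xi> * fkernel x \<xi>" 0]) measurable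
  finally show ?thesis by (simp add: fourier_lborel)
qed

text \<open>A shift by half a period of the exponential, \<open>h = \<pi> x / |x|\<^sup>2\<close>, changes its sign.\<close>

lemma fourier_Cc_vanishes:
  fixes \<phi> :: "real ^ 'd \<Rightarrow> complex"
  assumes \<phi>: "\<phi> \<in> Cc" and "e > 0"
  shows "\<exists>R. \<forall>x. R < norm x \<longrightarrow> cmod (fourier \<phi> x) < e"
proof -
  note [measurable] = Cc_borel[OF \<phi>]
  obtain R where R: "R > 0" "\<And>x. R < norm x \<Longrightarrow> \<phi> x = 0" using Cc_support[OF \<phi>] by blast
  \<comment> \<open>A volume, increased by 1 to serve as a positive divisor.\<close>
  define V where "V = measure lborel (cball (0 :: real ^ 'd) (R + 1)) + 1"
  have "V > 0" unfolding V_def by (intro add_nonneg_pos) auto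
  obtain d where d: "d > 0" "\<And>x y. norm (x - y) < d \<Longrightarrow> cmod (\<phi> x - \<phi> y) < e / V"
    using Cc_uniformly_continuous[OF \<phi>, of "e / V"] \<open>e > 0\<close> \<open>V > 0\<close> by auto
  show ?thesis
  proof (intro exI allI impI)
    \<comment> \<open>Beyond this radius the shift, of length pi / norm x, is shorter than both d
      and 1: the first bound controls the increment of \<phi>, the second its support.\<close>
    fix x :: "real ^ 'd" assume x: "pi / min d 1 < norm x"
    have "0 < pi / min d 1" using d(1) by simp
    then have "norm x > 0" using x by (rule less_trans)
    define h where "h = (pi / (norm x)\<^sup>2) *\<^sub>R x"
    have hn: "norm h = pi / norm x" by (simp add: h_def power2_eq_square)
    define m where "m = min d 1"
    have "m > 0" "pi / m < norm x" using x d(1) by (auto simp: m_def)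
    then have "norm h < m"
      using \<open>norm x > 0\<close> unfolding hn by (simp add: field_simps)
    then have h: "norm h < d" "norm h < 1" by (auto simp: m_def)
    have "x \<bullet> h = pi" using \<open>norm x > 0\<close> by (simp add: h_def power2_norm_eq_inner)
    then have ek: "fkernel x h = - 1"
      using exp_minus[of "\<i> * complex_of_real pi"] by (simp add: fkernel_def exp_pi_i')
    have shift: "(\<integral>\<xi>. \<phi> (\<xi> - h) * fkernel x \<xi> \<partial>lborel) = - fourier \<phi> x"
    proof -
      have "(\<integral>\<xi>. \<phi> (\<xi> - h) * fkernel x \<xi> \<partial>lborel) = (\<integral>\<xi>. - (\<phi> (\<xi> - h) * fkernel x (\<xi> - h)) \<partial>lborel)"
      proof (intro Bochner_Integration.integral_cong refl)
        fix \<xi>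
        have "fkernel x \<xi> = - fkernel x (\<xi> - h)"
          using fkernel_diff[of x \<xi> h] by (simp add: ek)
        then show "\<phi> (\<xi> - h) * fkernel x \<xi> = - (\<phi> (\<xi> - h) * fkernel x (\<xi> - h))"
          by (simp only: mult_minus_right)
      qed
      also have "\<dots> = - (\<integral>\<xi>. \<phi> \<xi> * fkernel x \<xi> \<partial>lborel)"
        using integral_lborel_diff[of "\<lambda>\<xi>. \<phi> \<xi> * fkernel x \<xi>" h] by simp
      finally show ?thesis by (simp add: fourier_lborel)
    qed
    have int: "integrable lborel (\<lambda>\<xi>. \<phi> \<xi> * fkernel x \<xi>)" "integrable lborel (\<lambda>\<xi>. \<phi> (\<xi> - h) * fkernel x \<xi>)"
      using Cc_integrable[OF \<phi>] integrable_lborel_diff[of \<phi> h] by (auto intro!: integrable_fkernel)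
    \<comment> \<open>Subtracting the shifted integral, which is the negative of the transform,
      doubles the transform and leaves an increment of \<phi> supported in the ball of radius R +
      1.\<close>
    have "2 * cmod (fourier \<phi> x) = cmod (fourier \<phi> x - (- fourier \<phi> x))" by (simp only: diff_minus_eq_add mult_2[symmetric] norm_mult) simp
    also have "\<dots> = cmod (\<integral>\<xi>. (\<phi> \<xi> - \<phi> (\<xi> - h)) * fkernel x \<xi> \<partial>lborel)"
      using int by (simp only: shift[symmetric]) (simp add: left_diff_distrib fourier_lborel)
    also have "\<dots> \<le> (\<integral>\<xi>. cmod ((\<phi> \<xi> - \<phi> (\<xi> - h)) * fkernel x \<xi>) \<partial>lborel)"
      by (rule integral_norm_bound)
    also have "\<dots> \<le> (\<integral>\<xi>. e / V * indicator (cball (0 :: real ^ 'd) (R + 1)) \<xi> \<partial>lborel)"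
    proof (rule integral_mono)
      show "integrable lborel (\<lambda>\<xi>. cmod ((\<phi> \<xi> - \<phi> (\<xi> - h)) * fkernel x \<xi>))"
        using int by (simp add: left_diff_distrib)
      show "integrable lborel (\<lambda>\<xi>. e / V * indicator (cball (0 :: real ^ 'd) (R + 1)) \<xi>)"
        by (intro integrable_mult_right integrable_real_indicator) (auto simp: emeasure_compact_finite[simplified])
      fix \<xi> :: "real ^ 'd"
      show "cmod ((\<phi> \<xi> - \<phi> (\<xi> - h)) * fkernel x \<xi>) \<le> e / V * indicator (cball 0 (R + 1)) \<xi>"
      proof (cases "norm \<xi> \<le> R + 1")
        case True then show ?thesis using d(2)[of \<xi> "\<xi> - h"] h by (simp add: norm_mult less_imp_le)
      next
        case False
        then have "R < norm \<xi>" "R < norm (\<xi> - h)" using h norm_triangle_sub[of \<xi> h] by linarith+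
        then show ?thesis using R(2) \<open>e > 0\<close> \<open>V > 0\<close> by simp
      qed
    qed
    also have "\<dots> = e / V * (V - 1)" by (simp add: V_def)
    also have "\<dots> < 2 * e" using \<open>e > 0\<close> \<open>V > 0\<close> by (simp add: field_simps add_pos_pos)
    finally show "cmod (fourier \<phi> x) < e" by simp
  qed
qed

lemma Riemann_Lebesgue:
  fixes u :: "real ^ 'd \<Rightarrow> complex"
  assumes u: "integrable lborel u" and "e > 0"
  obtains R where "\<And>x. R < norm x \<Longrightarrow> cmod (fourier u x) < e"
proof -
  obtain \<phi> where \<phi>: "\<phi> \<in> Cc" "(\<integral>x. cmod (u x - \<phi> x) \<partial>lborel) < e / 2"
    using L1_dense_Cc[OF u, of "e / 2"] \<open>e > 0\<close> by auto
  obtain R where R: "\<And>x. R < norm x \<Longrightarrow> cmod (fourier \<phi> x) < e / 2"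
    using fourier_Cc_vanishes[OF \<phi>(1), of "e / 2"] \<open>e > 0\<close> by auto
  show ?thesis
  proof (rule that[of R])
    fix x :: "real ^ 'd" assume "R < norm x"
    have "cmod (fourier u x - fourier \<phi> x) < e / 2"
      using norm_fourier_le[of "\<lambda>x. u x - \<phi> x" x] u \<phi> by (simp add: fourier_diff Cc_integrable)
    then show "cmod (fourier u x) < e"
      using R[OF \<open>R < norm x\<close>] norm_triangle_sub[of "fourier u x" "fourier \<phi> x"] by linarith
  qed
qed

section \<open>Gaussians and positivity through the Fourier transform\<close>

definition gauss :: "real ^ 'd \<Rightarrow> real" where
  "gauss x = (\<Prod>b\<in>Basis. std_normal_density (x \<bullet> b))"

lemma gauss_nonneg: "gauss x \<ge> 0"
  by (simp add: gauss_def prod_nonneg)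

lemma gauss_borel [measurable]: "gauss \<in> borel_measurable borel"
  unfolding gauss_def by measurable

interpretation lborel_basis: product_sigma_finite "\<lambda>_::real ^ 'd. lborel :: real measure" ..

text \<open>Fubini over the coordinates: \<open>lborel\<close> is the image of the product of
  one-dimensional Lebesgue measures indexed by the basis.\<close>

lemma lborel_coordinate_prod:
  fixes f :: "real ^ 'd \<Rightarrow> real \<Rightarrow> complex"
  assumes f: "\<And>b. b \<in> Basis \<Longrightarrow> integrable lborel (f b)"
  shows "integrable lborel (\<lambda>x. \<Prod>b\<in>Basis. f b (x \<bullet> b))"
    "(\<integral>x. (\<Prod>b\<in>Basis. f b (x \<bullet> b)) \<partial>lborel) = (\<Prod>b\<in>Basis. \<integral>t. f b t \<partial>lborel)"
proof -
  have [measurable]: "f b \<in> borel_measurable borel" if "b \<in> Basis" for b using f[OF that] by auto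
  have eq: "(\<Sum>c\<in>Basis. y c *\<^sub>R c) \<bullet> b = y b" if "b \<in> Basis" for y and b :: "real ^ 'd"
    using that by (simp add: inner_sum_left inner_Basis if_distrib cong: if_cong)
  have prod_eq: "(\<Prod>b\<in>Basis. f b ((\<Sum>c\<in>Basis. y c *\<^sub>R c) \<bullet> b)) = (\<Prod>b\<in>Basis. f b (y b))" for y
    by (rule prod.cong) (simp_all add: eq)
  have m: "(\<lambda>x. \<Prod>b\<in>Basis. f b (x \<bullet> b)) \<in> borel_measurable borel" by measurable
  have s: "(\<lambda>y. \<Sum>c\<in>Basis. y c *\<^sub>R c) \<in> (\<Pi>\<^sub>M b\<in>Basis. lborel) \<rightarrow>\<^sub>M (borel :: (real ^ 'd) measure)"
    by measurable
  show "integrable lborel (\<lambda>x. \<Prod>b\<in>Basis. f b (x \<bullet> b))"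
    using lborel_basis.product_integrable_prod[of Basis f] f
    by (simp add: lborel_eq[where 'a = "real ^ 'd"] integrable_distr_eq[OF s m] prod_eq)
  show "(\<integral>x. (\<Prod>b\<in>Basis. f b (x \<bullet> b)) \<partial>lborel) = (\<Prod>b\<in>Basis. \<integral>t. f b t \<partial>lborel)"
    using lborel_basis.product_integral_prod[of Basis f] f
    by (simp add: lborel_eq[where 'a = "real ^ 'd"] integral_distr[OF s m] prod_eq)
qed

lemma gauss_kernel_eq:
  "complex_of_real (gauss \<xi>) * fkernel x \<xi>
    = (\<Prod>b\<in>Basis. complex_of_real (std_normal_density (\<xi> \<bullet> b)) * iexp (- (x \<bullet> b) * (\<xi> \<bullet> b)))"
proof -
  have "fkernel x \<xi> = (\<Prod>b\<in>Basis. iexp (- (x \<bullet> b) * (\<xi> \<bullet> b)))"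
    by (simp add: fkernel_def euclidean_inner[of x \<xi>] sum_distrib_left sum_negf flip: exp_sum)
  then show ?thesis by (simp add: gauss_def prod.distrib)
qed

lemma std_normal_fourier:
  "integrable lborel (\<lambda>t. complex_of_real (std_normal_density t) * iexp (s * t))"
  "(\<integral>t. complex_of_real (std_normal_density t) * iexp (s * t) \<partial>lborel) = complex_of_real (exp (- s\<^sup>2 / 2))"
proof -
  have "integrable lborel (\<lambda>t. complex_of_real (std_normal_density t))"
    using integrable_std_normal_moment[of 0] by simp
  then show "integrable lborel (\<lambda>t. complex_of_real (std_normal_density t) * iexp (s * t))"
    by (rule Bochner_Integration.integrable_bound) (auto simp: norm_mult)
  have "(\<integral>t. complex_of_real (std_normal_density t) * iexp (s * t) \<partial>lborel) = char std_normal_distribution s"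
    unfolding char_def by (subst integral_density) (auto simp: scaleR_conv_of_real)
  then show "(\<integral>t. complex_of_real (std_normal_density t) * iexp (s * t) \<partial>lborel) = complex_of_real (exp (- s\<^sup>2 / 2))"
    by (simp add: char_std_normal_distribution)
qed

lemma gauss_integrable: "integrable lborel gauss"
proof -
  have "integrable lborel (\<lambda>\<xi>. complex_of_real (gauss \<xi>) * fkernel (0 :: real ^ 'd) \<xi>)"
    unfolding gauss_kernel_eq by (rule lborel_coordinate_prod) (rule std_normal_fourier)
  then have "integrable lborel (\<lambda>\<xi> :: real ^ 'd. Re (complex_of_real (gauss \<xi>)))"
    by (intro integrable_Re) (simp add: fkernel_def)
  then show ?thesis by simp
qed

text \<open>Each coordinate contributes the characteristic function exp(- s^2 / 2), which is sqrt (2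
  pi) times the density again.\<close>

lemma fourier_gauss:
  "fourier (\<lambda>\<xi>. complex_of_real (gauss \<xi>)) (x :: real ^ 'd)
    = complex_of_real (sqrt (2 * pi) ^ DIM(real ^ 'd) * gauss x)"
proof -
  have "fourier (\<lambda>\<xi>. complex_of_real (gauss \<xi>)) x
      = (\<Prod>b\<in>Basis. \<integral>t. complex_of_real (std_normal_density t) * iexp (- (x \<bullet> b) * t) \<partial>lborel)"
  proof -
    have "(\<integral>\<xi>. (\<Prod>b\<in>Basis. complex_of_real (std_normal_density (\<xi> \<bullet> b)) * iexp (- (x \<bullet> b) * (\<xi> \<bullet> b))) \<partial>lborel)
        = (\<Prod>b\<in>Basis. \<integral>t. complex_of_real (std_normal_density t) * iexp (- (x \<bullet> b) * t) \<partial>lborel)"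
      by (rule lborel_coordinate_prod(2)[of "\<lambda>b t. complex_of_real (std_normal_density t) * iexp (- (x \<bullet> b) * t)"])
         (rule std_normal_fourier(1))
    then show ?thesis by (simp only: gauss_kernel_eq[symmetric]) (simp add: fourier_lborel)
  qed
  also have "\<dots> = (\<Prod>b\<in>(Basis :: (real ^ 'd) set). complex_of_real (exp (- (- (x \<bullet> b))\<^sup>2 / 2)))"
    by (simp only: std_normal_fourier(2))
  also have "\<dots> = (\<Prod>b\<in>(Basis :: (real ^ 'd) set). complex_of_real (sqrt (2 * pi) * std_normal_density (x \<bullet> b)))"
    by (intro prod.cong refl) (simp add: std_normal_density_def)
  also have "\<dots> = complex_of_real (sqrt (2 * pi) ^ DIM(real ^ 'd) * gauss x)"
    by (simp add: gauss_def prod.distrib)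
  finally show ?thesis .
qed


text \<open>Fubini, with a kernel that is symmetric in its two arguments.\<close>

lemma fourier_mult_formula:
  assumes f: "integrable lborel f" and g: "integrable lborel g"
  shows "(\<integral>x. fourier f x * g x \<partial>lborel) = (\<integral>x. f x * fourier g x \<partial>lborel)"
proof -
  have fm[measurable]: "f \<in> borel_measurable borel" and gm[measurable]: "g \<in> borel_measurable borel" using f g by auto
  have "(\<lambda>p. fkernel (fst p) (snd p)) \<in> borel_measurable (borel :: ((real ^ 'd) \<times> (real ^ 'd)) measure)"
    unfolding fkernel_def by (intro borel_measurable_continuous_onI continuous_intros)
  then have [measurable]: "(\<lambda>p. fkernel (fst p) (snd p)) \<in> borel_measurable (lborel \<Otimes>\<^sub>M lborel :: ((real ^ 'd) \<times> (real ^ 'd)) measure)"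
    by (simp add: lborel_prod)
  have int: "integrable (lborel \<Otimes>\<^sub>M lborel) (\<lambda>(x, \<xi>). f \<xi> * fkernel x \<xi> * g x)"
  proof (rule integrableI_bounded)
    show "(\<lambda>(x, \<xi>). f \<xi> * fkernel x \<xi> * g x) \<in> borel_measurable (lborel \<Otimes>\<^sub>M lborel)"
      unfolding case_prod_beta by measurable
    have "(\<integral>\<^sup>+p. ennreal (norm (case p of (x, \<xi>) \<Rightarrow> f \<xi> * fkernel x \<xi> * g x)) \<partial>(lborel \<Otimes>\<^sub>M lborel))
        = (\<integral>\<^sup>+p. ennreal (cmod (f (snd p)) * cmod (g (fst p))) \<partial>(lborel \<Otimes>\<^sub>M lborel))"
      by (intro nn_integral_cong) (auto simp: norm_mult)
    also have "\<dots> = (\<integral>\<^sup>+x. \<integral>\<^sup>+\<xi>. ennreal (cmod (f \<xi>) * cmod (g x)) \<partial>lborel \<partial>lborel)"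
      by (subst lborel.nn_integral_fst[symmetric]) auto
    also have "\<dots> = ennreal (\<integral>x. cmod (f x) \<partial>lborel) * ennreal (\<integral>x. cmod (g x) \<partial>lborel)"
      using f g by (simp add: ennreal_mult nn_integral_multc nn_integral_cmult nn_integral_cmod_integrable)
    also have "\<dots> < \<infinity>" by (simp add: ennreal_mult_less_top)
    finally show "(\<integral>\<^sup>+p. ennreal (norm (case p of (x, \<xi>) \<Rightarrow> f \<xi> * fkernel x \<xi> * g x)) \<partial>(lborel \<Otimes>\<^sub>M lborel)) < \<infinity>" .
  qed
  have "(\<integral>x. fourier f x * g x \<partial>lborel) = (\<integral>x. \<integral>\<xi>. f \<xi> * fkernel x \<xi> * g x \<partial>lborel \<partial>lborel)"
    by (simp add: fourier_lborel)
  also have "\<dots> = (\<integral>\<xi>. \<integral>x. f \<xi> * fkernel x \<xi> * g x \<partial>lborel \<partial>lborel)"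
    by (rule lborel_pair.Fubini_integral[symmetric]) (rule int)
  also have "\<dots> = (\<integral>\<xi>. f \<xi> * fourier g \<xi> \<partial>lborel)"
  proof -
    have "fourier g \<xi> = (\<integral>x. fkernel x \<xi> * g x \<partial>lborel)" for \<xi>
      by (simp add: fourier_lborel mult.commute fkernel_commute[of \<xi>])
    then show ?thesis by (simp add: mult.assoc)
  qed
  finally show ?thesis .
qed

lemma integral_lborel_scale:
  fixes f :: "'a::euclidean_space \<Rightarrow> complex"
  assumes [measurable]: "f \<in> borel_measurable borel" and "\<delta> > 0"
  shows "(\<integral>x. f x \<partial>lborel) = complex_of_real (\<delta> ^ DIM('a)) * (\<integral>x. f (\<delta> *\<^sub>R x) \<partial>lborel)"
    "integrable lborel f \<longleftrightarrow> integrable lborel (\<lambda>x. f (\<delta> *\<^sub>R x))"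
proof -
  have *: "(lborel :: 'a measure) = density (distr lborel borel (\<lambda>x. \<delta> *\<^sub>R x)) (\<lambda>_. ennreal (\<delta> ^ DIM('a)))"
    using lborel_affine[of \<delta> "0 :: 'a"] \<open>\<delta> > 0\<close> by simp
  show "(\<integral>x. f x \<partial>lborel) = complex_of_real (\<delta> ^ DIM('a)) * (\<integral>x. f (\<delta> *\<^sub>R x) \<partial>lborel)"
    by (subst *, subst integral_density) (use \<open>\<delta> > 0\<close> in \<open>auto simp: integral_distr scaleR_conv_of_real\<close>)
  show "integrable lborel f \<longleftrightarrow> integrable lborel (\<lambda>x. f (\<delta> *\<^sub>R x))"
  proof -
    let ?c = "complex_of_real (\<delta> ^ DIM('a))"
    have "integrable lborel f \<longleftrightarrow> integrable lborel (\<lambda>x. ?c * f (\<delta> *\<^sub>R x))"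
      by (subst *, subst integrable_density) (use \<open>\<delta> > 0\<close> in \<open>auto simp: integrable_distr_eq scaleR_conv_of_real\<close>)
    also have "\<dots> \<longleftrightarrow> integrable lborel (\<lambda>x. f (\<delta> *\<^sub>R x))"
    proof
      assume "integrable lborel (\<lambda>x. ?c * f (\<delta> *\<^sub>R x))"
      then have "integrable lborel (\<lambda>x. inverse ?c * (?c * f (\<delta> *\<^sub>R x)))" by (rule integrable_mult_right)
      then show "integrable lborel (\<lambda>x. f (\<delta> *\<^sub>R x))" using \<open>\<delta> > 0\<close> by (simp flip: mult.assoc)
    qed (rule integrable_mult_right)
    finally show ?thesis .
  qed
qed

text \<open>Pairing \<open>h(\<delta> x)\<close> with a Gaussian and letting \<open>\<delta> \<rightarrow> 0\<close> replaces Fourier inversion.\<close>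

lemma fourier_nonneg_imp_nonneg_at_0:
  fixes h :: "real ^ 'd \<Rightarrow> complex"
  assumes h: "integrable lborel h" and cont: "continuous_on UNIV h" and bounded: "\<And>x. cmod (h x) \<le> M"
    and pos: "\<And>\<xi>. Re (fourier h \<xi>) \<ge> 0"
  shows "Re (h 0) \<ge> 0"
proof -
  have [measurable]: "h \<in> borel_measurable borel" using h by auto
  have gi: "integrable lborel (\<lambda>x. complex_of_real (gauss (x :: real ^ 'd)))" by (rule integrable_of_real[OF gauss_integrable])
  define \<kappa> where "\<kappa> = sqrt (2 * pi) ^ DIM(real ^ 'd)"
  have "\<kappa> > 0" by (simp add: \<kappa>_def)
  define I where "I n = (\<integral>x. h (inverse (Suc n) *\<^sub>R x) * complex_of_real (gauss x) \<partial>lborel)" for n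
  have pos_I: "Re (I n) \<ge> 0" for n
  proof -
    define \<delta> :: real where "\<delta> = inverse (Suc n)"
    have \<delta>: "\<delta> > 0" by (simp add: \<delta>_def)
    \<comment> \<open>A dilation preserves the sign of the transform, since the transform of k is a
      positive multiple of a dilate of that of h. The multiplication formula then moves the
      transform from the Gaussian to k.\<close>
    define k where "k x = h (\<delta> *\<^sub>R x)" for x
    have k: "integrable lborel k" unfolding k_def using h integral_lborel_scale(2)[OF _ \<delta>, of h] by simp
    have [measurable]: "k \<in> borel_measurable borel" unfolding k_def by measurable
    have "fkernel (\<xi> /\<^sub>R \<delta>) (\<delta> *\<^sub>R x) = fkernel \<xi> x" for \<xi> x :: "real ^ 'd"
      using \<delta> by (simp add: fkernel_def flip: mult.assoc of_real_mult of_real_inverse)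
    then have "fourier h (\<xi> /\<^sub>R \<delta>) = complex_of_real (\<delta> ^ DIM(real ^ 'd)) * fourier k \<xi>" for \<xi>
      using integral_lborel_scale(1)[OF _ \<delta>, of "\<lambda>x. h x * fkernel (\<xi> /\<^sub>R \<delta>) x"] \<delta>
      by (simp add: fourier_lborel k_def)
    then have "Re (fourier h (\<xi> /\<^sub>R \<delta>)) = \<delta> ^ DIM(real ^ 'd) * Re (fourier k \<xi>)" for \<xi>
      by (simp del: of_real_power)
    then have kpos: "Re (fourier k \<xi>) \<ge> 0" for \<xi>
      using pos[of "\<xi> /\<^sub>R \<delta>"] zero_less_power[OF \<delta>, of "DIM(real ^ 'd)"] by (simp add: zero_le_mult_iff)
    have "complex_of_real \<kappa> * I n = (\<integral>x. k x * fourier (\<lambda>\<xi>. complex_of_real (gauss \<xi>)) x \<partial>lborel)"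
      by (simp add: fourier_gauss I_def k_def \<delta>_def \<kappa>_def mult_ac flip: integral_mult_right_zero)
    also have "\<dots> = (\<integral>x. fourier k x * complex_of_real (gauss x) \<partial>lborel)"
      by (rule fourier_mult_formula[OF k gi, symmetric])
    finally have eq: "complex_of_real \<kappa> * I n = (\<integral>x. fourier k x * complex_of_real (gauss x) \<partial>lborel)" .
    have [measurable]: "fourier k \<in> borel_measurable borel"
      by (rule borel_measurable_continuous_onI[OF continuous_fourier[OF k]])
    have "integrable lborel (\<lambda>x. fourier k x * complex_of_real (gauss x))"
    proof (rule Bochner_Integration.integrable_bound)
      show "integrable lborel (\<lambda>x. (\<integral>\<xi>. cmod (k \<xi>) \<partial>lborel) * gauss (x :: real ^ 'd))"
        by (intro integrable_mult_right gauss_integrable)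
      show "AE x in lborel. norm (fourier k x * complex_of_real (gauss x)) \<le> norm ((\<integral>\<xi>. cmod (k \<xi>) \<partial>lborel) * gauss x)"
        using norm_fourier_le[OF k] by (intro AE_I2) (auto simp: norm_mult abs_mult intro!: mult_right_mono)
    qed measurable
    then have "Re (\<integral>x. fourier k x * complex_of_real (gauss x) \<partial>lborel)
        = (\<integral>x. Re (fourier k x * complex_of_real (gauss x)) \<partial>lborel)"
      by (rule integral_Re[symmetric])
    also have "\<dots> \<ge> 0"
      by (intro Bochner_Integration.integral_nonneg) (simp add: kpos gauss_nonneg)
    finally have "Re (complex_of_real \<kappa> * I n) \<ge> 0" by (simp only: eq)
    then show ?thesis using \<open>\<kappa> > 0\<close> by (simp add: zero_le_mult_iff)
  qed
  \<comment> \<open>The limit is h 0 times the total mass of the Gaussian; that this mass is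
    positive is read off from \<open>fourier_gauss\<close> at 0.\<close>
  have lim: "I \<longlonglongrightarrow> (\<integral>x. h 0 * complex_of_real (gauss (x :: real ^ 'd)) \<partial>lborel)"
    unfolding I_def
  proof (rule integral_dominated_convergence[where w = "\<lambda>x. M * gauss x"])
    show "AE x in lborel. (\<lambda>n. h (inverse (Suc n) *\<^sub>R x) * complex_of_real (gauss x)) \<longlonglongrightarrow> h 0 * complex_of_real (gauss x)"
    proof (rule AE_I2)
      fix x :: "real ^ 'd"
      have "(\<lambda>n. inverse (real (Suc n)) *\<^sub>R x) \<longlonglongrightarrow> 0"
        using tendsto_scaleR[OF LIMSEQ_inverse_real_of_nat tendsto_const[of x]] by simp
      then have "(\<lambda>n. h (inverse (real (Suc n)) *\<^sub>R x)) \<longlonglongrightarrow> h 0"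
        by (rule continuous_on_tendsto_compose[OF cont]) auto
      then show "(\<lambda>n. h (inverse (Suc n) *\<^sub>R x) * complex_of_real (gauss x)) \<longlonglongrightarrow> h 0 * complex_of_real (gauss x)"
        by (intro tendsto_mult tendsto_const)
    qed
    show "AE x in lborel. norm (h (inverse (Suc n) *\<^sub>R x) * complex_of_real (gauss x)) \<le> M * gauss x" for n
      using bounded by (intro AE_I2) (auto simp: norm_mult gauss_nonneg intro!: mult_right_mono)
  qed (auto intro: gauss_integrable)
  have "(\<lambda>n. Re (I n)) \<longlonglongrightarrow> Re (\<integral>x. h 0 * complex_of_real (gauss (x :: real ^ 'd)) \<partial>lborel)"
    by (intro tendsto_Re lim)
  then have nonneg: "Re (\<integral>x. h 0 * complex_of_real (gauss (x :: real ^ 'd)) \<partial>lborel) \<ge> 0"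
    using pos_I by (intro tendsto_lowerbound) auto
  have "(\<integral>x. complex_of_real (gauss (x :: real ^ 'd)) \<partial>lborel) = complex_of_real (\<kappa> * gauss (0 :: real ^ 'd))"
    using fourier_gauss[of "0 :: real ^ 'd"] by (subst (asm) fourier_lborel) (auto simp: \<kappa>_def fkernel_def)
  then have "Re (\<integral>x. h 0 * complex_of_real (gauss (x :: real ^ 'd)) \<partial>lborel) = Re (h 0) * (\<kappa> * gauss (0 :: real ^ 'd))"
    by (simp only: integral_mult_right_zero) simp
  with nonneg have "0 \<le> Re (h 0) * (\<kappa> * gauss (0 :: real ^ 'd))" by (simp only:)
  moreover have "\<kappa> * gauss (0 :: real ^ 'd) > 0"
    using \<open>\<kappa> > 0\<close> by (simp add: gauss_def normal_density_pos)
  ultimately show ?thesis by (meson mult_neg_pos not_le)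
qed

text \<open>For u in \<open>Cc\<close> the function \<open>conv (adj u) w\<close>, with w = (A - m)
  u, is continuous and bounded, as the positivity criterion requires. Its transform is
  (\<open>fourier a\<close> - m) |\<open>fourier u\<close>|^2, and its value at 0 is the pairing of
  w with u.\<close>

lemma conv_op_form_ge_Cc:
  fixes a :: "real ^ 'd \<Rightarrow> complex"
  assumes a: "integrable lborel a" and m: "\<And>\<xi>. m \<le> Re (fourier a \<xi>)" and u: "u \<in> Cc"
  shows "m * (norm (lsq u))\<^sup>2 \<le> inner (conv_op a (lsq u)) (lsq u)"
proof -
  note [measurable] = Cc_borel[OF u]
  have am[measurable]: "a \<in> borel_measurable borel" using a by auto
  have ui: "integrable lborel u" by (rule Cc_integrable[OF u])
  have adj_u: "adj u \<in> Cc" using Cc_reflect_cnj[OF u] by (simp add: adj_def[abs_def])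
  define w where "w x = conv a u x - complex_of_real m * u x" for x
  have w: "integrable lborel w" unfolding w_def using integrable_conv[OF a ui] ui by auto
  have [measurable]: "w \<in> borel_measurable borel" unfolding w_def by measurable
  have wL: "w \<in> L2 lborel"
    unfolding w_def by (intro L2_diff L2_scale conv_in_L2[OF a] Cc_L2 u)
  have fw: "fourier w \<xi> = (fourier a \<xi> - complex_of_real m) * fourier u \<xi>" for \<xi>
    unfolding w_def using integrable_conv[OF a ui] ui a
    by (simp add: fourier_diff fourier_conv fourier_mult_left left_diff_distrib)
  obtain M where M: "\<And>x. cmod (conv (adj u) w x) \<le> M"
    using conv_Cc_bounded[OF adj_u w] by blast
  have "Re (conv (adj u) w 0) \<ge> 0"
  proof (rule fourier_nonneg_imp_nonneg_at_0)
    show "integrable lborel (conv (adj u) w)" by (rule integrable_conv[OF integrable_adj[OF ui] w])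
    show "continuous_on UNIV (conv (adj u) w)" by (rule conv_Cc_continuous[OF adj_u w])
    show "cmod (conv (adj u) w x) \<le> M" for x by (rule M)
    fix \<xi>
    have "fourier (conv (adj u) w) \<xi> = (fourier a \<xi> - complex_of_real m) * (fourier u \<xi> * cnj (fourier u \<xi>))"
      by (simp add: fourier_conv integrable_adj ui w fourier_adj fw)
    also have "Re \<dots> = (Re (fourier a \<xi>) - m) * (cmod (fourier u \<xi>))\<^sup>2"
      by (simp only: complex_norm_square[symmetric]) simp
    finally show "Re (fourier (conv (adj u) w) \<xi>) \<ge> 0" using m[of \<xi>] by simp
  qed
  moreover have "conv (adj u) w 0 = (\<integral>y. w y * cnj (u y) \<partial>lborel)"
    by (simp add: conv_lborel adj_def mult.commute)
  moreover have "Re (\<integral>y. w y * cnj (u y) \<partial>lborel) = (\<integral>y. w y \<bullet> u y \<partial>lborel)"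
  proof -
    obtain K where K: "K > 0" "\<And>x. cmod (u x) \<le> K" using Cc_bounded[OF u] by blast
    have "integrable lborel (\<lambda>y. w y * cnj (u y))"
    proof (rule Bochner_Integration.integrable_bound)
      show "integrable lborel (\<lambda>y. K * cmod (w y))" using w by simp
      have "continuous_on UNIV cnj" by (intro continuous_intros)
      then have [measurable]: "cnj \<in> borel_measurable borel" by (rule borel_measurable_continuous_onI)
      show "(\<lambda>y. w y * cnj (u y)) \<in> borel_measurable lborel" by measurable
      show "AE y in lborel. norm (w y * cnj (u y)) \<le> norm (K * cmod (w y))"
        using K by (intro AE_I2) (auto simp: norm_mult mult.commute[of K] abs_mult intro!: mult_left_mono)
    qed
    then show ?thesis by (simp only: inner_complex_mult_cnj integral_Re)
  qed
  moreover have "(\<integral>y. w y \<bullet> u y \<partial>lborel) = inner (conv_op a (lsq u)) (lsq u) - m * (norm (lsq u))\<^sup>2"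
  proof -
    have uL: "u \<in> L2 lebesgue" and wL': "w \<in> L2 lebesgue" and cL: "conv a u \<in> L2 lebesgue"
      using Cc_L2[OF u] wL conv_in_L2[OF a Cc_L2[OF u]] by (auto simp: L2_lebesgue_borel)
    have "(\<integral>y. w y \<bullet> u y \<partial>lborel) = inner (lsq w) (lsq u)"
      using wL' uL by (simp add: lsq_inner integral_lebesgue_borel)
    also have "lsq w = conv_op a (lsq u) - m *\<^sub>R lsq u"
      using uL cL a by (simp add: w_def[abs_def] conv_op_lsq lsq_scaleR lsq_diff L2_scale)
    finally show ?thesis by (simp add: inner_diff_left power2_norm_eq_inner)
  qed
  ultimately show ?thesis by simp
qed

lemma conv_op_form_ge:
  fixes a :: "real ^ 'd \<Rightarrow> complex"
  assumes a: "integrable lborel a" and m: "\<And>\<xi>. m \<le> Re (fourier a \<xi>)"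
  shows "m * (norm x)\<^sup>2 \<le> inner (conv_op a x) x"
proof -
  interpret A: bounded_linear "conv_op a" by (rule bounded_linear_conv_op[OF a])
  have "\<exists>\<phi>. \<phi> \<in> Cc \<and> norm (x - lsq \<phi>) < inverse (real (Suc n))" for n
    using lsq_dense_Cc[of "inverse (real (Suc n))" x] by (metis inverse_positive_iff_positive of_nat_0_less_iff zero_less_Suc)
  then obtain \<phi> where \<phi>: "\<And>n. \<phi> n \<in> Cc" "\<And>n. norm (x - lsq (\<phi> n)) < inverse (real (Suc n))" by metis
  have "(\<lambda>n. norm (lsq (\<phi> n) - x)) \<longlonglongrightarrow> 0"
    by (rule tendsto_sandwich[OF _ _ tendsto_const LIMSEQ_inverse_real_of_nat])
       (use \<phi>(2) in \<open>auto simp: norm_minus_commute less_imp_le\<close>)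
  then have lim: "(\<lambda>n. lsq (\<phi> n)) \<longlonglongrightarrow> x"
    by (simp add: tendsto_norm_zero_iff LIM_zero_iff)
  show ?thesis
  proof (rule LIMSEQ_le)
    show "(\<lambda>n. m * (norm (lsq (\<phi> n)))\<^sup>2) \<longlonglongrightarrow> m * (norm x)\<^sup>2"
      by (intro tendsto_intros lim)
    show "(\<lambda>n. inner (conv_op a (lsq (\<phi> n))) (lsq (\<phi> n))) \<longlonglongrightarrow> inner (conv_op a x) x"
      by (intro tendsto_intros lim A.tendsto)
  qed (use conv_op_form_ge_Cc[OF a m \<phi>(1)] in auto)
qed

lemma conv_op_form_le:
  fixes a :: "real ^ 'd \<Rightarrow> complex"
  assumes a: "integrable lborel a" and m: "\<And>\<xi>. Re (fourier a \<xi>) \<le> m"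
  shows "inner (conv_op a x) x \<le> m * (norm x)\<^sup>2"
proof -
  \<comment> \<open>The negative of a is written as a difference so that \<open>fourier_diff\<close>
    and \<open>conv_op_diff_kernel\<close> apply.\<close>
  let ?n = "\<lambda>x. 0 - a x"
  have n: "integrable lborel ?n" using a by simp
  have z: "integrable lborel (\<lambda>x :: real ^ 'd. 0 :: complex)" by simp
  have "fourier ?n \<xi> = - fourier a \<xi>" for \<xi>
    using fourier_diff[OF z a, of \<xi>] by (simp add: fourier_def)
  then have "- m * (norm x)\<^sup>2 \<le> inner (conv_op ?n x) x"
    using m by (intro conv_op_form_ge[OF n]) simp
  moreover have "conv_op ?n x = - conv_op a x"
  proof -
    have "conv_op (\<lambda>x :: real ^ 'd. 0) x = 0"
      by (simp add: conv_op_def conv_def[abs_def] lsq_zero)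
    then show ?thesis using conv_op_diff_kernel[OF z a, of x] by simp
  qed
  ultimately show ?thesis by simp
qed

section \<open>Multiplication operators and compactness\<close>

definition mult_op :: "('a::euclidean_space \<Rightarrow> complex) \<Rightarrow> 'a lsq \<Rightarrow> 'a lsq" where
  "mult_op b x = lsq (\<lambda>t. b t * rep_lsq x t)"

lemma mult_op_L2:
  assumes "b \<in> borel_measurable borel" "\<And>t. cmod (b t) \<le> K" "u \<in> L2 lebesgue"
  shows "(\<lambda>t. b t * u t) \<in> L2 lebesgue"
  using assms by (intro L2_mult_bounded) (auto simp: borel_imp_lebesgue_measurable)

lemma mult_op_lsq:
  assumes b: "b \<in> borel_measurable borel" "\<And>t. cmod (b t) \<le> K" and u: "u \<in> L2 lebesgue"
  shows "mult_op b (lsq u) = lsq (\<lambda>t. b t * u t)"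
  unfolding mult_op_def using rep_lsq_ae_eq[OF u] mult_op_L2[OF b u] mult_op_L2[OF b rep_lsq_L2]
  by (subst lsq_eq_iff) (auto simp: ae_eq_def)

lemma mult_op_add:
  assumes b: "b \<in> borel_measurable borel" "\<And>t. cmod (b t) \<le> K"
  shows "mult_op b (x + y) = mult_op b x + mult_op b y"
proof -
  obtain u v where "u \<in> L2 lebesgue" "x = lsq u" "v \<in> L2 lebesgue" "y = lsq v" by (meson lsq_cases)
  then show ?thesis
    by (simp add: lsq_add mult_op_lsq[OF b] L2_add mult_op_L2[OF b] distrib_left)
qed

lemma mult_op_scaleR:
  assumes b: "b \<in> borel_measurable borel" "\<And>t. cmod (b t) \<le> K"
  shows "mult_op b (r *\<^sub>R x) = r *\<^sub>R mult_op b x"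
proof -
  obtain u where "u \<in> L2 lebesgue" "x = lsq u" by (meson lsq_cases)
  then show ?thesis
    by (simp add: lsq_scaleR mult_op_lsq[OF b] L2_scale mult_op_L2[OF b] mult.left_commute)
qed

lemma lsq_norm_mono:
  assumes u: "u \<in> L2 lebesgue" and v: "v \<in> L2 lebesgue" and K: "K \<ge> 0"
    and le: "\<And>t. cmod (u t) \<le> K * cmod (v t)"
  shows "norm (lsq u) \<le> K * norm (lsq v)"
proof (rule power2_le_imp_le)
  have "(norm (lsq u))\<^sup>2 = (\<integral>t. (cmod (u t))\<^sup>2 \<partial>lebesgue)"
    using u by (simp add: lsq_norm L2_norm_on_def)
  also have "\<dots> \<le> (\<integral>t. K\<^sup>2 * (cmod (v t))\<^sup>2 \<partial>lebesgue)"
    using u v power_mono[OF le, of _ 2]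
    by (intro integral_mono) (auto simp: L2_integrable_square power_mult_distrib)
  also have "\<dots> = (K * norm (lsq v))\<^sup>2"
    using v by (simp add: lsq_norm L2_norm_on_def power_mult_distrib)
  finally show "(norm (lsq u))\<^sup>2 \<le> (K * norm (lsq v))\<^sup>2" .
qed (use K in auto)

lemma norm_mult_op:
  assumes b: "b \<in> borel_measurable borel" "\<And>t. cmod (b t) \<le> K"
  shows "norm (mult_op b x) \<le> K * norm x"
proof -
  obtain u where u: "u \<in> L2 lebesgue" "x = lsq u" by (meson lsq_cases)
  have "K \<ge> 0" using b(2) norm_ge_zero order_trans by blast
  then show ?thesis
    using u b(2) by (simp add: mult_op_lsq[OF b] lsq_norm_mono mult_op_L2[OF b] norm_mult mult_right_mono)
qed

lemma bounded_linear_mult_op: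
  assumes b: "b \<in> borel_measurable borel" "\<And>t. cmod (b t) \<le> K"
  shows "bounded_linear (mult_op b)"
  by (rule bounded_linear_intro[where K = K])
     (use norm_mult_op[OF b] in \<open>auto simp: mult_op_add[OF b] mult_op_scaleR[OF b] mult.commute\<close>)

lemma mult_op_adjoint:
  assumes b: "b \<in> borel_measurable borel" "\<And>t. cmod (b t) \<le> K"
    and c: "c \<in> borel_measurable borel" "\<And>t. cnj (b t) = c t"
  shows "inner (mult_op b x) y = inner x (mult_op c y)"
proof -
  obtain u v where *: "u \<in> L2 lebesgue" "x = lsq u" "v \<in> L2 lebesgue" "y = lsq v" by (meson lsq_cases)
  have c': "cmod (c t) \<le> K" for t using b(2)[of t] by (simp flip: c(2))
  have "(b t * u t) \<bullet> v t = u t \<bullet> (c t * v t)" for t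
    by (simp add: inner_complex_mult_cnj c(2)[symmetric] mult_ac)
  then show ?thesis
    using * by (simp add: mult_op_lsq[OF b] mult_op_lsq[OF c(1) c'] lsq_inner mult_op_L2[OF b] mult_op_L2[OF c(1) c'])
qed

lemma mult_op_diff_multiplier:
  assumes b: "b \<in> borel_measurable borel" "\<And>t. cmod (b t) \<le> K"
    and c: "c \<in> borel_measurable borel" "\<And>t. cmod (c t) \<le> L"
  shows "mult_op (\<lambda>t. b t - c t) x = mult_op b x - mult_op c x"
proof -
  obtain u where u: "u \<in> L2 lebesgue" "x = lsq u" by (meson lsq_cases)
  have d: "(\<lambda>t. b t - c t) \<in> borel_measurable borel" "\<And>t. cmod (b t - c t) \<le> K + L"
    using b c by (auto intro!: order_trans[OF norm_triangle_ineq4] add_mono)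
  show ?thesis
    using u by (simp add: mult_op_lsq[OF b] mult_op_lsq[OF c] mult_op_lsq[OF d] lsq_diff
        mult_op_L2[OF b] mult_op_L2[OF c] left_diff_distrib)
qed

lemma mult_op_of_real: "mult_op (\<lambda>_. complex_of_real r) x = r *\<^sub>R x"
proof -
  obtain u where u: "u \<in> L2 lebesgue" "x = lsq u" by (meson lsq_cases)
  then show ?thesis by (simp add: lsq_scaleR mult_op_lsq[where K = "\<bar>r\<bar>"])
qed

lemma mult_op_form_ge:
  assumes b: "b \<in> borel_measurable borel" "\<And>t. cmod (b t) \<le> K" and m: "\<And>t. m \<le> Re (b t)"
  shows "m * (norm x)\<^sup>2 \<le> inner (mult_op b x) x"
proof -
  obtain u where u: "u \<in> L2 lebesgue" "x = lsq u" by (meson lsq_cases)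
  have "m * (norm x)\<^sup>2 = (\<integral>t. m * (cmod (u t))\<^sup>2 \<partial>lebesgue)"
    using u by (simp add: lsq_norm L2_norm_on_def)
  also have "\<dots> \<le> (\<integral>t. (b t * u t) \<bullet> u t \<partial>lebesgue)"
  proof (rule integral_mono)
    show "integrable lebesgue (\<lambda>t. m * (cmod (u t))\<^sup>2)" using u by (simp add: L2_integrable_square)
    show "integrable lebesgue (\<lambda>t. (b t * u t) \<bullet> u t)"
      by (rule L2_inner_integrable[OF mult_op_L2[OF b u(1)] u(1)])
    show "m * (cmod (u t))\<^sup>2 \<le> (b t * u t) \<bullet> u t" for t
    proof -
      have "(b t * u t) \<bullet> u t = Re (b t) * (cmod (u t))\<^sup>2"
        by (simp only: inner_complex_mult_cnj mult.assoc complex_norm_square[symmetric]) simp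
      then show ?thesis using m[of t] by (simp add: mult_right_mono)
    qed
  qed
  also have "\<dots> = inner (mult_op b x) x"
    using u by (simp add: mult_op_lsq[OF b] lsq_inner mult_op_L2[OF b])
  finally show ?thesis .
qed

lemma mult_op_form_le:
  assumes b: "b \<in> borel_measurable borel" "\<And>t. cmod (b t) \<le> K" and m: "\<And>t. Re (b t) \<le> m"
  shows "inner (mult_op b x) x \<le> m * (norm x)\<^sup>2"
proof -
  have z: "(\<lambda>_. 0 :: complex) \<in> borel_measurable borel" "\<And>t. cmod (0 :: complex) \<le> 0" by auto
  have d: "(\<lambda>t. 0 - b t) \<in> borel_measurable borel" "\<And>t. cmod (0 - b t) \<le> K" using b by auto
  have "- m * (norm x)\<^sup>2 \<le> inner (mult_op (\<lambda>t. 0 - b t) x) x"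
    using m by (intro mult_op_form_ge[OF d]) simp
  also have "mult_op (\<lambda>t. 0 - b t) x = - mult_op b x"
    using mult_op_diff_multiplier[OF z b, of x] mult_op_of_real[of 0 x] by simp
  finally show ?thesis by simp
qed

lemma conv_op_mult_const:
  assumes a: "integrable lborel a"
  shows "conv_op a (mult_op (\<lambda>_. c) x) = mult_op (\<lambda>_. c) (conv_op a x)"
proof -
  obtain u where u: "u \<in> L2 lebesgue" "x = lsq u" by (meson lsq_cases)
  have "conv a (\<lambda>t. c * u t) = (\<lambda>t. c * conv a u t)"
    by (simp add: conv_def fun_eq_iff mult.left_commute)
  then show ?thesis
    using u a by (simp add: mult_op_lsq[where K = "cmod c"] conv_op_lsq L2_scale conv_lebesgue_L2(1))
qed

section \<open>Compactness of convolution composed with a vanishing multiplier\<close>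

lemma totally_bounded_convergent_subsequence:
  fixes y :: "nat \<Rightarrow> 'a::complete_space"
  assumes tb: "\<And>e. e > 0 \<Longrightarrow> \<exists>F. finite F \<and> range y \<subseteq> (\<Union>x\<in>F. ball x e)"
  obtains r where "strict_mono r" "convergent (y \<circ> r)"
proof -
  have "\<exists>F. finite F \<and> closure (range y) \<subseteq> (\<Union>x\<in>F. ball x e)" if "e > 0" for e
  proof -
    obtain F where F: "finite F" "range y \<subseteq> (\<Union>x\<in>F. ball x (e / 2))" using tb[of "e / 2"] \<open>e > 0\<close> by auto
    have "range y \<subseteq> (\<Union>x\<in>F. cball x (e / 2))"
      by (rule order_trans[OF F(2)]) (intro UN_mono order_refl ball_subset_cball)
    then have "closure (range y) \<subseteq> (\<Union>x\<in>F. cball x (e / 2))"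
      using F(1) by (intro closure_minimal closed_UN) auto
    also have "\<dots> \<subseteq> (\<Union>x\<in>F. ball x e)" using \<open>e > 0\<close> by force
    finally show ?thesis using F(1) by blast
  qed
  then have "compact (closure (range y))"
    unfolding compact_eq_totally_bounded by (auto simp: complete_eq_closed)
  then have "seq_compact (closure (range y))" by (rule compact_imp_seq_compact)
  moreover have "\<forall>n. y n \<in> closure (range y)" by (auto intro: closure_subset[THEN subsetD])
  ultimately obtain l r where "strict_mono r" "(y \<circ> r) \<longlonglongrightarrow> l"
    by (rule seq_compactE)
  then show ?thesis using that by (auto simp: convergent_def)
qed

text \<open>Uniform limits of precompact sequences are precompact. Failure of total boundedness
  gives an e-separated selection i; along it an e/4-close sequence has a Cauchy subsequence, so two
  of the separated points would be nearer than e. Since the hypothesis covers every selection i, no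
  diagonal argument arises.\<close>

lemma convergent_subsequence_approx:
  fixes y :: "nat \<Rightarrow> 'a::complete_space"
  assumes approx: "\<And>e. e > 0 \<Longrightarrow> \<exists>z. (\<forall>n. dist (y n) (z n) \<le> e) \<and>
      (\<forall>i :: nat \<Rightarrow> nat. \<exists>r. strict_mono r \<and> convergent (z \<circ> i \<circ> r))"
  obtains r where "strict_mono r" "convergent (y \<circ> r)"
proof (rule totally_bounded_convergent_subsequence)
  fix e :: real assume "e > 0"
  show "\<exists>F. finite F \<and> range y \<subseteq> (\<Union>x\<in>F. ball x e)"
  proof (rule ccontr)
    assume "\<not> ?thesis"
    then have *: "\<not> range y \<subseteq> (\<Union>x\<in>F. ball x e)" if "finite F" for F using that by blast
    define P where "P i k n \<longleftrightarrow> (\<forall>j<k. e \<le> dist (y (i j)) (y n))" for i :: "nat \<Rightarrow> nat" and k n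
    have "\<exists>i. \<forall>k. P i k (i k)"
    proof (rule dependent_wellorder_choice)
      fix i :: "nat \<Rightarrow> nat" and k :: nat
      have "\<not> range y \<subseteq> (\<Union>x\<in>(\<lambda>j. y (i j)) ` {..<k}. ball x e)" by (rule *) auto
      then obtain n where "y n \<notin> (\<Union>x\<in>(\<lambda>j. y (i j)) ` {..<k}. ball x e)" by blast
      then have "\<forall>j<k. \<not> dist (y (i j)) (y n) < e" by auto
      then show "\<exists>n. P i k n" by (auto simp: P_def not_less)
    qed (auto simp: P_def)
    then obtain i where "\<forall>k. P i k (i k)" ..
    then have i: "e \<le> dist (y (i j)) (y (i k))" if "j < k" for j k
      using that by (simp add: P_def)
    obtain z r where z: "\<And>n. dist (y n) (z n) \<le> e / 4" and r: "strict_mono r" "convergent (z \<circ> i \<circ> r)"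
    proof -
      obtain z where z: "\<forall>n. dist (y n) (z n) \<le> e / 4"
        "\<forall>i :: nat \<Rightarrow> nat. \<exists>r. strict_mono r \<and> convergent (z \<circ> i \<circ> r)"
        using approx[of "e / 4"] \<open>e > 0\<close> by auto
      obtain r where "strict_mono r" "convergent (z \<circ> i \<circ> r)" using z(2) by blast
      then show ?thesis using that z(1) by blast
    qed
    have "Cauchy (z \<circ> i \<circ> r)" using r(2) by (rule convergent_Cauchy)
    then obtain N where N: "\<And>m n. m \<ge> N \<Longrightarrow> n \<ge> N \<Longrightarrow> dist ((z \<circ> i \<circ> r) m) ((z \<circ> i \<circ> r) n) < e / 4"
      using \<open>e > 0\<close> unfolding Cauchy_def by (meson zero_less_divide_iff zero_less_numeral)
    let ?p = "i (r N)" and ?q = "i (r (Suc N))"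
    have "e \<le> dist (y ?p) (y ?q)" by (rule i) (use r(1) in \<open>auto simp: strict_mono_less\<close>)
    also have "\<dots> \<le> dist (y ?p) (z ?p) + dist (z ?p) (z ?q) + dist (z ?q) (y ?q)"
      by (metis add_right_mono dist_triangle order_trans)
    also have "\<dots> < e"
      using z[of ?p] z[of ?q] N[of N "Suc N"] \<open>e > 0\<close> by (simp add: dist_commute)
    finally show False by simp
  qed
qed (rule that)

lemma lsq_norm_bounded_support:
  fixes f :: "'a::euclidean_space \<Rightarrow> complex"
  assumes f: "f \<in> borel_measurable borel" and S: "S \<in> sets borel" "emeasure lborel S < \<infinity>"
    and d: "\<And>x. cmod (f x) \<le> d" and supp: "\<And>x. x \<notin> S \<Longrightarrow> f x = 0"
  shows "f \<in> L2 lebesgue" "(norm (lsq f))\<^sup>2 \<le> d\<^sup>2 * measure lborel S"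
proof -
  have int: "integrable lborel (\<lambda>x. d\<^sup>2 * indicator S x)"
    using S by (intro integrable_mult_right integrable_real_indicator) auto
  have le: "(cmod (f x))\<^sup>2 \<le> d\<^sup>2 * indicator S x" for x
    using power_mono[OF d[of x], of 2] supp[of x] by (cases "x \<in> S") auto
  have fL: "f \<in> L2 lborel" by (rule L2I_bound[OF _ int le]) (use f in simp)
  then show "f \<in> L2 lebesgue" by (simp add: L2_lebesgue_borel f)
  then have "(norm (lsq f))\<^sup>2 = (\<integral>x. (cmod (f x))\<^sup>2 \<partial>lebesgue)"
    by (simp add: lsq_norm L2_norm_on_def)
  also have "\<dots> = (\<integral>x. (cmod (f x))\<^sup>2 \<partial>lborel)"
    using f by (intro integral_lebesgue_borel) simp
  also have "\<dots> \<le> (\<integral>x. d\<^sup>2 * indicator S x \<partial>lborel)"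
    by (intro integral_mono int le L2_integrable_square fL)
  also have "\<dots> = d\<^sup>2 * measure lborel S" using S by simp
  finally show "(norm (lsq f))\<^sup>2 \<le> d\<^sup>2 * measure lborel S" .
qed

lemma conv_vanishes_outside:
  fixes \<phi> g :: "'a::euclidean_space \<Rightarrow> complex"
  assumes "\<And>x. R < norm x \<Longrightarrow> \<phi> x = 0" "\<And>x. S < norm x \<Longrightarrow> g x = 0" "R + S < norm x"
  shows "conv \<phi> g x = 0"
proof -
  have "\<phi> (x - y) * g y = 0" for y
  proof (cases "S < norm y")
    case False
    then have "R < norm (x - y)" using assms(3) norm_triangle_sub[of x y] by linarith
    then show ?thesis using assms(1) by simp
  qed (use assms(2) in simp)
  then show ?thesis unfolding conv_def by (simp only: integral_zero)
qed

text \<open>The functions \<open>\<phi> * (b w\<^sub>n)\<close> are uniformly bounded, equicontinuous and supported in a common ball,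
  so Arzela--Ascoli applies.\<close>

lemma conv_Cc_mult_compact:
  fixes \<phi> b :: "'a::euclidean_space \<Rightarrow> complex" and x :: "nat \<Rightarrow> 'a lsq"
  assumes \<phi>: "\<phi> \<in> Cc" and b: "b \<in> borel_measurable borel" "\<And>t. cmod (b t) \<le> K"
    and supp: "\<And>t. S < norm t \<Longrightarrow> b t = 0" and N: "\<And>n. norm (x n) \<le> N"
  obtains r where "strict_mono r" "convergent (\<lambda>n. conv_op \<phi> (mult_op b (x (r n))))"
proof -
  note [measurable] = Cc_borel[OF \<phi>] b(1)
  have "\<exists>g. g \<in> borel_measurable borel \<and> g \<in> L2 lborel \<and> x n = lsq g" for n
    using lsq_borel_cases[of "x n"] by metis
  then obtain g where g: "\<And>n. g n \<in> borel_measurable borel" "\<And>n. g n \<in> L2 lborel" "\<And>n. x n = lsq (g n)"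
    by metis
  note [measurable] = g(1)
  have gL: "g n \<in> L2 lebesgue" for n using g by (simp add: L2_lebesgue_borel)
  define f where "f n t = b t * g n t" for n t
  have [measurable]: "f n \<in> borel_measurable borel" for n unfolding f_def by measurable
  have bL: "b \<in> L2 lborel" by (rule L2_bounded_support[OF b supp])
  \<comment> \<open>A bound for all L1 norms of b g n at once, from |b g| \<le> |b|^2 + |g|^2. Here
    b is in L2 because it is bounded with bounded support.\<close>
  define C where "C = (\<integral>t. (cmod (b t))\<^sup>2 \<partial>lborel) + N\<^sup>2"
  have "integrable lborel (f n) \<and> (\<integral>t. cmod (f n t) \<partial>lborel) \<le> C" for n
  proof -
    have int: "integrable lborel (\<lambda>t. (cmod (b t))\<^sup>2 + (cmod (g n t))\<^sup>2)"
      by (intro Bochner_Integration.integrable_add L2_integrable_square bL g)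
    have le: "cmod (f n t) \<le> (cmod (b t))\<^sup>2 + (cmod (g n t))\<^sup>2" for t
      using sum_squares_bound[of "cmod (b t)" "cmod (g n t)"]
        mult_nonneg_nonneg[OF norm_ge_zero[of "b t"] norm_ge_zero[of "g n t"]]
      unfolding f_def norm_mult by linarith
    have f: "integrable lborel (f n)"
      by (rule Bochner_Integration.integrable_bound[OF int]) (use le in \<open>auto intro!: AE_I2 order_trans[OF le]\<close>)
    have "(\<integral>t. cmod (f n t) \<partial>lborel) \<le> (\<integral>t. (cmod (b t))\<^sup>2 + (cmod (g n t))\<^sup>2 \<partial>lborel)"
      using f int le by (intro integral_mono) auto
    also have "\<dots> = (\<integral>t. (cmod (b t))\<^sup>2 \<partial>lborel) + (\<integral>t. (cmod (g n t))\<^sup>2 \<partial>lborel)"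
      by (intro Bochner_Integration.integral_add L2_integrable_square bL g)
    also have "(\<integral>t. (cmod (g n t))\<^sup>2 \<partial>lborel) = (norm (x n))\<^sup>2"
      using gL[of n] by (simp add: g(3) lsq_norm L2_norm_on_def integral_lebesgue_borel)
    also have "\<dots> \<le> N\<^sup>2" using N[of n] by (intro power_mono) auto
    finally show ?thesis using f by (simp add: C_def)
  qed
  then have f: "integrable lborel (f n)" "(\<integral>t. cmod (f n t) \<partial>lborel) \<le> C" for n by auto
  define F where "F n = conv \<phi> (f n)" for n
  have [measurable]: "F n \<in> borel_measurable borel" for n unfolding F_def by measurable
  obtain M where M: "M > 0" "\<And>x. cmod (\<phi> x) \<le> M" using Cc_bounded[OF \<phi>] by blast
  obtain R where R: "R > 0" "\<And>x. R < norm x \<Longrightarrow> \<phi> x = 0" using Cc_support[OF \<phi>] by blast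
  define B where "B = cball (0 :: 'a) (R + S)"
  have F_supp: "F n t = 0" if "t \<notin> B" for n t
    unfolding F_def using that supp R(2)
    by (intro conv_vanishes_outside[of R \<phi> S "f n"]) (auto simp: B_def f_def)
  have "\<exists>h k. strict_mono (k :: nat \<Rightarrow> nat) \<and>
    (\<forall>e>0. \<exists>N. \<forall>n x. n \<ge> N \<and> x \<in> B \<longrightarrow> norm (F (k n) x - h x) < e)"
  proof (rule Arzela_Ascoli[of B F "M * C"])
    show "compact B" by (simp add: B_def)
    show "norm (F n x) \<le> M * C" for n x
      unfolding F_def
      by (rule order_trans[OF norm_conv_bounded_kernel[OF Cc_borel[OF \<phi>] M(2) f(1)] mult_left_mono[OF f(2)]])
         (use M(1) in simp)
    fix x :: 'a and e :: real assume "0 < e"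
    show "\<exists>d. 0 < d \<and> (\<forall>n y. y \<in> B \<and> norm (x - y) < d \<longrightarrow> norm (F n x - F n y) < e)"
      by (rule conv_Cc_equicontinuous[OF \<phi> \<open>0 < e\<close>, of C]) (use f in \<open>auto simp: F_def\<close>)
  next
    fix h :: "'a \<Rightarrow> complex" and k :: "nat \<Rightarrow> nat"
    assume "strict_mono k"
      "\<And>e. 0 < e \<Longrightarrow> \<exists>N. \<forall>n x. n \<ge> N \<and> x \<in> B \<longrightarrow> norm (F (k n) x - h x) < e"
    then show ?thesis by blast
  qed
  then obtain h and k :: "nat \<Rightarrow> nat" where k: "strict_mono k" and
    h: "\<forall>e>0. \<exists>N. \<forall>n x. n \<ge> N \<and> x \<in> B \<longrightarrow> norm (F (k n) x - h x) < e"
    by blast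
  have Fx: "conv_op \<phi> (mult_op b (x n)) = lsq (F n)" for n
    using gL mult_op_L2[OF b gL] by (simp add: g(3) mult_op_lsq[OF b] conv_op_lsq Cc_integrable \<phi> F_def f_def[abs_def])
  have FL: "F n \<in> L2 lebesgue" for n
    unfolding F_def f_def using conv_lebesgue_L2(1)[OF Cc_integrable[OF \<phi>] mult_op_L2[OF b gL]] .
  have "Cauchy (\<lambda>n. lsq (F (k n)))"
    unfolding Cauchy_iff
  proof (intro allI impI)
    fix e :: real assume "e > 0"
    \<comment> \<open>Uniform closeness 2 \<delta> = e / v on B yields L2 distance at most (e / v)
      sqrt (volume of B), which is below e. Thus uniform convergence on a bounded set becomes
      convergence in L2.\<close>
    define v where "v = sqrt (measure lborel B) + 1"
    have v: "v > 0" "measure lborel B < v\<^sup>2"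
      by (auto simp: v_def power2_sum intro: add_nonneg_pos add_pos_nonneg)
    define \<delta> where "\<delta> = e / v / 2"
    have "\<delta> > 0" using \<open>e > 0\<close> v by (simp add: \<delta>_def)
    obtain n0 where n0: "\<And>n x. n \<ge> n0 \<Longrightarrow> x \<in> B \<Longrightarrow> norm (F (k n) x - h x) < \<delta>"
      using h \<open>\<delta> > 0\<close> by meson
    show "\<exists>n0. \<forall>m\<ge>n0. \<forall>n\<ge>n0. norm (lsq (F (k m)) - lsq (F (k n))) < e"
    proof (intro exI allI impI)
      fix m n assume mn: "n0 \<le> m" "n0 \<le> n"
      have close: "cmod (F (k m) t - F (k n) t) \<le> 2 * \<delta>" for t
      proof (cases "t \<in> B")
        case True
        have "cmod (F (k m) t - F (k n) t) \<le> cmod (F (k m) t - h t) + cmod (F (k n) t - h t)"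
          using norm_triangle_ineq4[of "F (k m) t - h t" "F (k n) t - h t"] by simp
        then show ?thesis using n0[OF mn(1) True] n0[OF mn(2) True] by simp
      qed (use F_supp \<open>\<delta> > 0\<close> in simp)
      have "(norm (lsq (\<lambda>t. F (k m) t - F (k n) t)))\<^sup>2 \<le> (2 * \<delta>)\<^sup>2 * measure lborel B"
        by (rule lsq_norm_bounded_support(2)[OF _ _ _ close])
           (use F_supp in \<open>auto simp: B_def emeasure_compact_finite[simplified]\<close>)
      also have "\<dots> < (2 * \<delta>)\<^sup>2 * v\<^sup>2" using v \<open>\<delta> > 0\<close> by (intro mult_strict_left_mono) auto
      also have "\<dots> = e\<^sup>2" using v by (simp add: \<delta>_def flip: power_mult_distrib)
      finally show "norm (lsq (F (k m)) - lsq (F (k n))) < e"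
        using FL \<open>e > 0\<close> by (simp add: lsq_diff power2_less_imp_less)
    qed
  qed
  then have "convergent (\<lambda>n. lsq (F (k n)))" by (rule Cauchy_convergent)
  then show ?thesis using that[OF k] by (simp add: Fx)
qed

text \<open>A reduction to \<open>conv_Cc_mult_compact\<close> in operator norm: a is replaced by a
  kernel in \<open>Cc\<close> near it in L1, and b is cut off where it is already small.\<close>

lemma conv_mult_compact:
  fixes a b :: "'a::euclidean_space \<Rightarrow> complex" and x :: "nat \<Rightarrow> 'a lsq"
  assumes a: "integrable lborel a" and b: "b \<in> borel_measurable borel" "\<And>t. cmod (b t) \<le> K"
    and b0: "\<And>e. e > 0 \<Longrightarrow> \<exists>R. \<forall>t. R < norm t \<longrightarrow> cmod (b t) < e" and x: "bounded (range x)"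
  obtains r where "strict_mono r" "convergent (\<lambda>n. conv_op a (mult_op b (x (r n))))"
proof -
  obtain N where N: "N > 0" "\<And>n. norm (x n) \<le> N" using x by (auto simp: bounded_pos)
  have K: "K \<ge> 0" using b(2) norm_ge_zero order_trans by blast
  obtain r where "strict_mono r" "convergent ((\<lambda>n. conv_op a (mult_op b (x n))) \<circ> r)"
  proof (rule convergent_subsequence_approx)
    fix e :: real assume "e > 0"
    \<comment> \<open>The constants e1 and e2 make the errors from replacing a and from cutting off
      b equal to e / 2 each. K + 1 and P are positive upper bounds for K and for the L1 norm of
      \<phi>.\<close>
    define e1 where "e1 = e / 2 / ((K + 1) * N)"
    have KN: "(K + 1) * N > 0" using K N(1) by (intro mult_pos_pos) auto
    have "e1 > 0" unfolding e1_def using \<open>e > 0\<close> KN by simp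
    obtain \<phi> where \<phi>: "\<phi> \<in> Cc" "(\<integral>x. cmod (a x - \<phi> x) \<partial>lborel) < e1"
      using L1_dense_Cc[OF a \<open>e1 > 0\<close>] .
    define P where "P = (\<integral>x. cmod (\<phi> x) \<partial>lborel) + 1"
    have "P > 0" unfolding P_def by (intro add_nonneg_pos) auto
    define e2 where "e2 = e / 2 / (P * N)"
    have "e2 > 0" using \<open>e > 0\<close> \<open>P > 0\<close> N(1) by (simp add: e2_def)
    obtain R where R: "\<And>t. R < norm t \<Longrightarrow> cmod (b t) < e2" using b0[OF \<open>e2 > 0\<close>] by blast
    define c where "c t = (if norm t \<le> R then b t else 0)" for t
    have c: "c \<in> borel_measurable borel" "cmod (c t) \<le> K" "R < norm t \<Longrightarrow> c t = 0" for t
    proof -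
      note b(1)[measurable]
      show "c \<in> borel_measurable borel" unfolding c_def by measurable
    qed (use b(2) K in \<open>auto simp: c_def\<close>)
    have d: "(\<lambda>t. b t - c t) \<in> borel_measurable borel" "cmod (b t - c t) \<le> e2" for t
      using b c(1) R \<open>e2 > 0\<close> by (auto simp: c_def less_imp_le not_le)
    have \<phi>i: "integrable lborel \<phi>" by (rule Cc_integrable[OF \<phi>(1)])
    interpret \<Phi>: bounded_linear "conv_op \<phi>" by (rule bounded_linear_conv_op[OF \<phi>i])
    have "dist (conv_op a (mult_op b (x n))) (conv_op \<phi> (mult_op c (x n))) \<le> e" for n
    proof -
      have "conv_op a (mult_op b (x n)) - conv_op \<phi> (mult_op c (x n))
          = conv_op (\<lambda>t. a t - \<phi> t) (mult_op b (x n)) + conv_op \<phi> (mult_op (\<lambda>t. b t - c t) (x n))"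
        by (simp add: conv_op_diff_kernel[OF a \<phi>i] mult_op_diff_multiplier[OF b c(1,2)] \<Phi>.diff)
      then have "dist (conv_op a (mult_op b (x n))) (conv_op \<phi> (mult_op c (x n)))
          \<le> norm (conv_op (\<lambda>t. a t - \<phi> t) (mult_op b (x n))) + norm (conv_op \<phi> (mult_op (\<lambda>t. b t - c t) (x n)))"
        by (simp add: dist_norm norm_triangle_ineq)
      also have "\<dots> \<le> e1 * ((K + 1) * N) + P * (e2 * N)"
      proof (intro add_mono)
        have "norm (conv_op (\<lambda>t. a t - \<phi> t) (mult_op b (x n)))
            \<le> (\<integral>t. cmod (a t - \<phi> t) \<partial>lborel) * norm (mult_op b (x n))"
          using a \<phi>i by (intro norm_conv_op) auto
        also have "\<dots> \<le> e1 * ((K + 1) * N)"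
        proof (intro mult_mono)
          have "norm (mult_op b (x n)) \<le> K * norm (x n)" by (rule norm_mult_op[OF b])
          also have "\<dots> \<le> (K + 1) * N" using K N by (intro mult_mono) auto
          finally show "norm (mult_op b (x n)) \<le> (K + 1) * N" .
        qed (use \<phi> \<open>e1 > 0\<close> in auto)
        finally show "norm (conv_op (\<lambda>t. a t - \<phi> t) (mult_op b (x n))) \<le> e1 * ((K + 1) * N)" .
        have "norm (conv_op \<phi> (mult_op (\<lambda>t. b t - c t) (x n)))
            \<le> (\<integral>t. cmod (\<phi> t) \<partial>lborel) * norm (mult_op (\<lambda>t. b t - c t) (x n))"
          by (rule norm_conv_op[OF \<phi>i])
        also have "\<dots> \<le> P * (e2 * N)"
        proof (intro mult_mono)
          have "norm (mult_op (\<lambda>t. b t - c t) (x n)) \<le> e2 * norm (x n)" by (rule norm_mult_op[OF d])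
          also have "\<dots> \<le> e2 * N" using \<open>e2 > 0\<close> N by (intro mult_left_mono) auto
          finally show "norm (mult_op (\<lambda>t. b t - c t) (x n)) \<le> e2 * N" .
        qed (use \<open>P > 0\<close> in \<open>auto simp: P_def\<close>)
        finally show "norm (conv_op \<phi> (mult_op (\<lambda>t. b t - c t) (x n))) \<le> P * (e2 * N)" .
      qed
      also have "\<dots> = e"
      proof -
        have "e1 * ((K + 1) * N) = e / 2" unfolding e1_def using KN by (metis less_irrefl nonzero_eq_divide_eq)
        moreover have "P * (e2 * N) = e / 2" using \<open>P > 0\<close> N(1) by (simp add: e2_def)
        ultimately show ?thesis by simp
      qed
      finally show ?thesis .
    qed
    moreover have "\<exists>r. strict_mono r \<and> convergent ((\<lambda>n. conv_op \<phi> (mult_op c (x n))) \<circ> i \<circ> r)" for i :: "nat \<Rightarrow> nat"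
    proof -
      obtain r where "strict_mono r" "convergent (\<lambda>n. conv_op \<phi> (mult_op c ((x \<circ> i) (r n))))"
        by (rule conv_Cc_mult_compact[where x = "x \<circ> i" and N = N, OF \<phi>(1) c]) (use N(2) in auto)
      then show ?thesis by (auto simp: o_def)
    qed
    ultimately show "\<exists>z. (\<forall>n. dist (conv_op a (mult_op b (x n))) (z n) \<le> e) \<and>
        (\<forall>i :: nat \<Rightarrow> nat. \<exists>r. strict_mono r \<and> convergent (z \<circ> i \<circ> r))"
      by (intro exI[of _ "\<lambda>n. conv_op \<phi> (mult_op c (x n))"]) blast
  qed
  then show ?thesis using that by (simp add: o_def)
qed

section \<open>Approximate eigenvectors\<close>

lemma conv_op_approx:
  assumes a: "integrable lborel a" and \<phi>: "\<phi> \<in> Cc" "(\<integral>x. cmod (a x - \<phi> x) \<partial>lborel) < e"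
  shows "norm (conv_op a x - conv_op \<phi> x) \<le> e * norm x"
proof -
  have \<phi>i: "integrable lborel \<phi>" by (rule Cc_integrable[OF \<phi>(1)])
  have "norm (conv_op a x - conv_op \<phi> x) \<le> (\<integral>x. cmod (a x - \<phi> x) \<partial>lborel) * norm x"
    using a \<phi>i by (subst conv_op_diff_kernel[OF a \<phi>i, symmetric]) (intro norm_conv_op, auto)
  also have "\<dots> \<le> e * norm x" using \<phi>(2) by (intro mult_right_mono) auto
  finally show ?thesis .
qed

text \<open>Indicators of shrinking balls around \<open>x\<^sub>0\<close>: multiplication by \<open>V\<close> acts like \<open>V x\<^sub>0\<close>, and the
  convolution is small by Young's inequality, as \<open>L\<^sub>1\<close> norms are small relative to \<open>L\<^sub>2\<close> norms.\<close>

lemma approximate_eigenvector_multiplication: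
  fixes a V :: "'a::euclidean_space \<Rightarrow> complex"
  assumes a: "integrable lborel a" and V: "continuous_on UNIV V" "\<And>t. cmod (V t) \<le> K"
    and real: "Im (V x0) = 0" and "e > 0"
  obtains x where "x \<noteq> 0" "norm (conv_op a x + mult_op V x - Re (V x0) *\<^sub>R x) \<le> e * norm x"
proof -
  have Vb: "V \<in> borel_measurable borel" by (rule borel_measurable_continuous_onI[OF V(1)])
  obtain \<phi> where \<phi>: "\<phi> \<in> Cc" "(\<integral>x. cmod (a x - \<phi> x) \<partial>lborel) < e / 3"
    using L1_dense_Cc[OF a, of "e / 3"] \<open>e > 0\<close> by auto
  have \<phi>i: "integrable lborel \<phi>" by (rule Cc_integrable[OF \<phi>(1)])
  define P where "P = L2_norm_on lborel \<phi> + 1"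
  have P: "P > 0" "L2_norm_on lborel \<phi> \<le> P" unfolding P_def by (auto simp: L2_norm_on_def intro: add_nonneg_pos)
  obtain d where d: "d > 0" "\<And>t. dist t x0 < d \<Longrightarrow> cmod (V t - V x0) < e / 3"
    using V(1) \<open>e > 0\<close> unfolding continuous_on_iff
    by (metis UNIV_I dist_norm zero_less_divide_iff zero_less_numeral)
  define \<beta> where "\<beta> = unit_ball_vol (real DIM('a))"
  have \<beta>: "\<beta> > 0" by (simp add: \<beta>_def)
  \<comment> \<open>The first bound serves the continuity of V. The others give volume \<le> \<beta>
    r \<le> (e / 3 / P)^2, since r \<le> 1 makes its DIM-th power at most r.\<close>
  define r where "r = min (d / 2) (min 1 ((e / 3 / P)\<^sup>2 / \<beta>))"
  have r: "r > 0" "r < d" "r \<le> 1" "\<beta> * r \<le> (e / 3 / P)\<^sup>2"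
  proof -
    have "r \<le> (e / 3 / P)\<^sup>2 / \<beta>" by (simp add: r_def)
    then show "\<beta> * r \<le> (e / 3 / P)\<^sup>2" using \<beta> by (simp add: pos_le_divide_eq mult.commute)
  qed (use d \<beta> P \<open>e > 0\<close> in \<open>auto simp: r_def\<close>)
  define B where "B = cball x0 r"
  define w where "w = measure lborel B"
  have w: "w = \<beta> * r ^ DIM('a)" using r(1) by (simp add: w_def B_def \<beta>_def content_cball)
  have "w > 0" using r(1) \<beta> by (simp add: w)
  have "r ^ DIM('a) \<le> r ^ 1" by (intro power_decreasing) (use r in auto)
  then have "w \<le> \<beta> * r" using \<beta> by (simp add: w)
  then have w_le: "w \<le> (e / 3 / P)\<^sup>2" using r(4) by (rule order_trans)
  have sqrt_w: "sqrt w \<le> e / 3 / P"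
    by (rule real_le_lsqrt[OF _ w_le]) (use \<open>e > 0\<close> P(1) in simp)
  define u :: "'a \<Rightarrow> complex" where "u = indicator B"
  have [measurable]: "B \<in> sets borel" by (simp add: B_def)
  have um[measurable]: "u \<in> borel_measurable borel" unfolding u_def by measurable
  have Bfin: "emeasure lborel B < \<infinity>" by (simp add: B_def emeasure_compact_finite[simplified])
  have ui: "integrable lborel u" unfolding u_def by (rule integrable_complex_indicator[OF _ Bfin]) simp
  have cu: "cmod (u t) = indicator B t" for t by (simp add: u_def indicator_def)
  have L1: "(\<integral>t. cmod (u t) \<partial>lborel) = w" by (simp add: cu w_def)
  have uL: "u \<in> L2 lebesgue"
    by (rule lsq_norm_bounded_support(1)[OF um _ Bfin, of 1]) (auto simp: u_def indicator_def)
  have "(norm (lsq u))\<^sup>2 = (\<integral>t. (cmod (u t))\<^sup>2 \<partial>lborel)"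
    using uL by (simp add: lsq_norm L2_norm_on_def integral_lebesgue_borel)
  also have "\<dots> = (\<integral>t. indicator B t \<partial>lborel)"
    by (intro Bochner_Integration.integral_cong refl) (simp add: cu indicator_def)
  also have "\<dots> = w" by (simp add: w_def)
  finally have norm_u: "norm (lsq u) = sqrt w" by (metis norm_ge_zero real_sqrt_unique)
  have c1: "norm (conv_op a (lsq u) - conv_op \<phi> (lsq u)) \<le> e / 3 * norm (lsq u)"
    by (rule conv_op_approx[OF a \<phi>])
  have c2: "norm (conv_op \<phi> (lsq u)) \<le> e / 3 * norm (lsq u)"
  proof -
    \<comment> \<open>With the roles swapped, Young's inequality puts the L1 norm on the indicator.
      The resulting bound w P is sqrt w P times the L2 norm sqrt w of the indicator.\<close>
    have eq: "conv \<phi> u = conv u \<phi>" using conv_commute[OF Cc_borel[OF \<phi>(1)] um] by auto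
    have "norm (conv_op \<phi> (lsq u)) = L2_norm_on lebesgue (conv u \<phi>)"
      using conv_lebesgue_L2(1)[OF \<phi>i uL] uL by (simp add: conv_op_lsq \<phi>i lsq_norm eq)
    also have "\<dots> = L2_norm_on lborel (conv u \<phi>)"
      using Cc_borel[OF \<phi>(1)] by (simp add: L2_norm_on_def integral_lebesgue_borel)
    also have "\<dots> \<le> w * P"
      using L2_norm_conv[OF ui Cc_L2[OF \<phi>(1)]] P(2) \<open>w > 0\<close> by (simp add: L1) (meson mult_left_mono less_imp_le order_trans)
    also have "\<dots> = sqrt w * P * sqrt w" using \<open>w > 0\<close> by simp
    also have "\<dots> \<le> e / 3 * sqrt w"
      using sqrt_w P(1) \<open>w > 0\<close> by (intro mult_right_mono) (auto simp: pos_le_divide_eq)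
    finally show ?thesis by (simp add: norm_u)
  qed
  have c3: "norm (mult_op V (lsq u) - Re (V x0) *\<^sub>R lsq u) \<le> e / 3 * norm (lsq u)"
  proof -
    have "mult_op V (lsq u) - Re (V x0) *\<^sub>R lsq u = lsq (\<lambda>t. V t * u t - complex_of_real (Re (V x0)) * u t)"
      using uL mult_op_L2[OF Vb V(2) uL] by (simp add: mult_op_lsq[OF Vb V(2)] lsq_scaleR lsq_diff L2_scale)
    also have "\<dots> = lsq (\<lambda>t. (V t - V x0) * u t)"
      using real by (simp add: left_diff_distrib complex_is_Real_iff[symmetric])
    also have "norm \<dots> \<le> e / 3 * norm (lsq u)"
    proof (rule lsq_norm_mono[OF _ uL])
      show "(\<lambda>t. (V t - V x0) * u t) \<in> L2 lebesgue"
        using L2_diff[OF mult_op_L2[OF Vb V(2) uL] L2_scale[OF uL]] by (simp add: left_diff_distrib)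
      show "cmod ((V t - V x0) * u t) \<le> e / 3 * cmod (u t)" for t
        using d(2)[of t] r(2) by (auto simp: norm_mult cu B_def indicator_def dist_commute less_imp_le)
    qed (use \<open>e > 0\<close> in simp)
    finally show ?thesis .
  qed
  show ?thesis
  proof (rule that)
    show "lsq u \<noteq> 0" using norm_u \<open>w > 0\<close> by auto
    have "conv_op a (lsq u) + mult_op V (lsq u) - Re (V x0) *\<^sub>R lsq u
        = (conv_op a (lsq u) - conv_op \<phi> (lsq u)) + conv_op \<phi> (lsq u) + (mult_op V (lsq u) - Re (V x0) *\<^sub>R lsq u)"
      by simp
    also have "norm \<dots> \<le> e / 3 * norm (lsq u) + e / 3 * norm (lsq u) + e / 3 * norm (lsq u)"
      by (intro norm_triangle_le add_mono c1 c2 c3)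
    finally show "norm (conv_op a (lsq u) + mult_op V (lsq u) - Re (V x0) *\<^sub>R lsq u) \<le> e * norm (lsq u)" by simp
  qed
qed

text \<open>Plane waves \<open>exp (i \<xi> x)\<close> cut off to a ball of large radius, far from the origin: the convolution with
  a kernel supported in the ball of radius \<open>\<rho>\<close> acts as \<open>fourier \<phi> \<xi>\<close> except in a shell of width \<open>2 \<rho>\<close>.\<close>

definition wave_packet :: "real ^ 'd \<Rightarrow> real ^ 'd \<Rightarrow> real \<Rightarrow> real ^ 'd \<Rightarrow> complex" where
  "wave_packet \<xi> c R x = fkernel (- \<xi>) x * indicator (cball c R) x"

lemma wave_packet_borel [measurable]: "wave_packet \<xi> c R \<in> borel_measurable borel"
  unfolding wave_packet_def
  by (intro borel_measurable_times fkernel_borel borel_measurable_indicator) auto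

lemma norm_wave_packet: "cmod (wave_packet \<xi> c R x) = indicator (cball c R) x"
  by (simp add: wave_packet_def norm_mult indicator_def)

lemma wave_packet_integrable: "integrable lborel (wave_packet \<xi> c R)"
proof -
  have "integrable lborel (indicator (cball c R) :: _ \<Rightarrow> real)"
    by (intro integrable_real_indicator) (auto simp: emeasure_compact_finite[simplified])
  then show ?thesis
    by (rule Bochner_Integration.integrable_bound) (auto simp: norm_wave_packet)
qed

lemma wave_packet_L2: "wave_packet \<xi> c R \<in> L2 lebesgue"
  by (rule lsq_norm_bounded_support(1)[of _ "cball c R" 1])
     (auto simp: norm_wave_packet emeasure_compact_finite[simplified], auto simp: wave_packet_def indicator_def)

lemma lsq_norm_wave_packet:
  "(norm (lsq (wave_packet \<xi> c R)))\<^sup>2 = measure lborel (cball c R)"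
proof -
  have "(norm (lsq (wave_packet \<xi> c R)))\<^sup>2 = (\<integral>t. (cmod (wave_packet \<xi> c R t))\<^sup>2 \<partial>lborel)"
    by (simp add: lsq_norm[OF wave_packet_L2] L2_norm_on_def integral_lebesgue_borel)
  also have "\<dots> = (\<integral>t. indicator (cball c R) t \<partial>lborel)"
    by (intro Bochner_Integration.integral_cong refl) (simp add: norm_wave_packet indicator_def)
  finally show ?thesis by simp
qed

text \<open>If the ball of radius \<rho> about x lies inside the large ball, the convolution sees a
  pure plane wave, an exact eigenfunction. If it misses the large ball, both sides vanish. Only the
  excluded shell mixes the two cases.\<close>

lemma conv_wave_packet:
  assumes \<phi>: "\<phi> \<in> Cc" and \<rho>: "\<And>x. \<rho> < norm x \<Longrightarrow> \<phi> x = 0"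
    and x: "x \<notin> cball c (R + \<rho>) - ball c (R - \<rho>)" and "\<rho> > 0"
  shows "conv \<phi> (wave_packet \<xi> c R) x = fourier \<phi> \<xi> * wave_packet \<xi> c R x"
proof -
  note [measurable] = Cc_borel[OF \<phi>]
  have shift: "fkernel (- \<xi>) y = fkernel \<xi> (x - y) * fkernel (- \<xi>) x" for y
    by (simp add: fkernel_def inner_diff_right algebra_simps flip: exp_add)
  show ?thesis
  proof (cases "dist c x < R - \<rho>")
    case True
    have "\<phi> (x - y) * wave_packet \<xi> c R y = \<phi> (x - y) * fkernel \<xi> (x - y) * fkernel (- \<xi>) x" for y
    proof (cases "dist c y \<le> R")
      case False
      then have "\<rho> < norm (x - y)" using True dist_triangle[of c y x] by (simp add: dist_norm)
      then show ?thesis using \<rho> by simp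
    qed (simp add: wave_packet_def shift[of y] mult.assoc)
    then have "conv \<phi> (wave_packet \<xi> c R) x = (\<integral>y. \<phi> (x - y) * fkernel \<xi> (x - y) * fkernel (- \<xi>) x \<partial>lborel)"
      by (simp only: conv_lborel[OF Cc_borel[OF \<phi>] wave_packet_borel])
    also have "\<dots> = (\<integral>y. \<phi> (x - y) * fkernel \<xi> (x - y) \<partial>lborel) * fkernel (- \<xi>) x"
      by (rule integral_mult_left_zero)
    also have "(\<integral>y. \<phi> (x - y) * fkernel \<xi> (x - y) \<partial>lborel) = fourier \<phi> \<xi>"
      using integral_lborel_minus[of "\<lambda>y. \<phi> y * fkernel \<xi> y" x] by (simp add: fourier_lborel)
    also have "fkernel (- \<xi>) x = wave_packet \<xi> c R x"
      using True \<open>\<rho> > 0\<close> by (simp add: wave_packet_def)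
    finally show ?thesis .
  next
    case False
    then have far: "R + \<rho> < dist c x" using x by auto
    have "\<phi> (x - y) * wave_packet \<xi> c R y = 0" for y
    proof (cases "dist c y \<le> R")
      case True
      then have "\<rho> < norm (x - y)" using far dist_triangle[of c x y] by (simp add: dist_norm norm_minus_commute)
      then show ?thesis using \<rho> by simp
    qed (simp add: wave_packet_def)
    then have "conv \<phi> (wave_packet \<xi> c R) x = 0" unfolding conv_def by (simp only: integral_zero)
    then show ?thesis using far \<open>\<rho> > 0\<close> by (simp add: wave_packet_def)
  qed
qed

text \<open>For a fixed width the shell is negligible against the ball: after division by R^n the
  difference tends to 1 - 1 = 0.\<close>

lemma shell_volume_small:
  fixes e \<rho> :: real
  assumes "e > 0"
  shows "\<forall>\<^sub>F R in at_top. (R + \<rho>) ^ n - (R - \<rho>) ^ n \<le> e * R ^ n"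
proof -
  have "((\<lambda>R. (1 + \<rho> / R) ^ n - (1 - \<rho> / R) ^ n) \<longlongrightarrow> (1 + 0) ^ n - (1 - 0) ^ n) at_top"
    by (intro tendsto_intros tendsto_divide_0[OF tendsto_const] filterlim_at_top_imp_at_infinity filterlim_ident)
  then have "\<forall>\<^sub>F R in at_top. (1 + \<rho> / R) ^ n - (1 - \<rho> / R) ^ n < e"
    using assms by (intro order_tendstoD) auto
  moreover have "\<forall>\<^sub>F R in at_top. (R :: real) > 0" by (rule eventually_gt_at_top)
  ultimately show ?thesis
  proof eventually_elim
    case (elim R)
    have "(R + \<rho>) ^ n - (R - \<rho>) ^ n = ((1 + \<rho> / R) ^ n - (1 - \<rho> / R) ^ n) * R ^ n"
      using elim(2) by (simp add: left_diff_distrib distrib_right flip: power_mult_distrib)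
    also have "\<dots> \<le> e * R ^ n" using elim by (intro mult_right_mono) auto
    finally show ?case .
  qed
qed

text \<open>Four errors of relative size e / 4: replacing a by \<phi>, the potential on the ball,
  the shell where the packet is not an eigenfunction, and the change of the eigenvalue from
  \<open>fourier \<phi> \<xi>\<close> to \<open>fourier a \<xi>\<close>.\<close>

lemma approximate_eigenvector_convolution:
  fixes a V :: "real ^ 'd \<Rightarrow> complex"
  assumes a: "integrable lborel a" and V: "V \<in> borel_measurable borel" "\<And>t. cmod (V t) \<le> K"
    and V0: "\<And>e. e > 0 \<Longrightarrow> \<exists>R. \<forall>t. R < norm t \<longrightarrow> cmod (V t) < e"
    and real: "Im (fourier a \<xi>) = 0" and "e > 0"
  obtains x where "x \<noteq> 0" "norm (conv_op a x + mult_op V x - Re (fourier a \<xi>) *\<^sub>R x) \<le> e * norm x"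
proof -
  obtain \<phi> where \<phi>: "\<phi> \<in> Cc" "(\<integral>x. cmod (a x - \<phi> x) \<partial>lborel) < e / 4"
    using L1_dense_Cc[OF a, of "e / 4"] \<open>e > 0\<close> by auto
  note \<phi>b = Cc_borel[OF \<phi>(1)]
  note [measurable] = \<phi>b
  have \<phi>i: "integrable lborel \<phi>" by (rule Cc_integrable[OF \<phi>(1)])
  obtain \<rho> where \<rho>: "\<rho> > 0" "\<And>x. \<rho> < norm x \<Longrightarrow> \<phi> x = 0" using Cc_support[OF \<phi>(1)] by blast
  define P where "P = (\<integral>x. cmod (\<phi> x) \<partial>lborel) + 1"
  have "P > 0" unfolding P_def by (intro add_nonneg_pos) auto
  obtain S where S: "\<And>t. S < norm t \<Longrightarrow> cmod (V t) < e / 4" using V0[of "e / 4"] \<open>e > 0\<close> by auto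
  define n where "n = DIM(real ^ 'd)"
  define \<beta> where "\<beta> = unit_ball_vol (real n)"
  have "\<beta> > 0" by (simp add: \<beta>_def)
  \<comment> \<open>The defect on the shell is at most 2 P pointwise, so this fraction of the volume
    turns it into e / 4 times the L2 norm of the packet.\<close>
  have "\<forall>\<^sub>F R in at_top. (R + \<rho>) ^ n - (R - \<rho>) ^ n \<le> (e / 4 / (2 * P))\<^sup>2 * R ^ n"
    using \<open>e > 0\<close> \<open>P > 0\<close> by (intro shell_volume_small) simp
  moreover have "\<forall>\<^sub>F R in at_top. R > \<rho>" by (rule eventually_gt_at_top)
  ultimately have "\<forall>\<^sub>F R in at_top. (R + \<rho>) ^ n - (R - \<rho>) ^ n \<le> (e / 4 / (2 * P))\<^sup>2 * R ^ n \<and> R > \<rho>"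
    by (rule eventually_conj)
  then obtain R where R: "(R + \<rho>) ^ n - (R - \<rho>) ^ n \<le> (e / 4 / (2 * P))\<^sup>2 * R ^ n" "R > \<rho>"
    using eventually_happens'[OF trivial_limit_at_top_linorder] by blast
  \<comment> \<open>At this distance every point of the ball of radius R about c has norm above
    S.\<close>
  obtain c :: "real ^ 'd" where c: "norm c = R + \<bar>S\<bar> + 1"
    using vector_choose_size[of "R + \<bar>S\<bar> + 1"] R(2) \<rho>(1) by auto
  define v where "v = wave_packet \<xi> c R"
  have v[measurable]: "v \<in> borel_measurable borel" and vi: "integrable lborel v" and vL: "v \<in> L2 lebesgue"
    by (simp_all add: v_def wave_packet_integrable wave_packet_L2)
  have norm_v: "(norm (lsq v))\<^sup>2 = \<beta> * R ^ n"
    using R(2) \<rho>(1) by (simp add: v_def lsq_norm_wave_packet content_cball \<beta>_def n_def)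
  have c1: "norm (conv_op a (lsq v) - conv_op \<phi> (lsq v)) \<le> e / 4 * norm (lsq v)"
    by (rule conv_op_approx[OF a \<phi>])
  have c2: "norm (mult_op V (lsq v)) \<le> e / 4 * norm (lsq v)"
    unfolding mult_op_lsq[OF V vL]
  proof (rule lsq_norm_mono[OF mult_op_L2[OF V vL] vL])
    show "cmod (V t * v t) \<le> e / 4 * cmod (v t)" for t
    proof (cases "t \<in> cball c R")
      case True
      then have "S < norm t" using c norm_triangle_sub[of c t] by (simp add: dist_norm)
      then show ?thesis
        using S[of t] mult_right_mono[of "cmod (V t)" "e / 4" "cmod (v t)"] by (simp add: norm_mult)
    qed (simp add: v_def wave_packet_def)
  qed (use \<open>e > 0\<close> in simp)
  let ?D = "\<lambda>x. conv \<phi> v x - fourier \<phi> \<xi> * v x"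
  have c3: "norm (lsq ?D) \<le> e / 4 * norm (lsq v)"
  proof (rule power2_le_imp_le)
    let ?S = "cball c (R + \<rho>) - ball c (R - \<rho>)"
    have fin: "emeasure lborel (cball c (R + \<rho>)) < \<infinity>"
      by (simp add: emeasure_compact_finite[simplified])
    have "(norm (lsq ?D))\<^sup>2 \<le> (2 * P)\<^sup>2 * measure lborel ?S"
    proof (rule lsq_norm_bounded_support(2))
      show "emeasure lborel ?S < \<infinity>"
        by (rule le_less_trans[OF emeasure_mono fin]) auto
      show "cmod (?D x) \<le> 2 * P" for x
      proof -
        have "cmod (v x) \<le> 1" for x by (simp add: v_def norm_wave_packet indicator_def)
        then have "cmod (conv v \<phi> x) \<le> 1 * (\<integral>y. cmod (\<phi> y) \<partial>lborel)"
          by (intro norm_conv_bounded_kernel \<phi>i) auto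
        then have 1: "cmod (conv \<phi> v x) \<le> P" by (simp add: conv_commute[OF \<phi>b v] P_def)
        have "cmod (fourier \<phi> \<xi> * v x) \<le> P * 1"
          unfolding norm_mult using norm_fourier_le[OF \<phi>i, of \<xi>] \<open>P > 0\<close> \<open>cmod (v x) \<le> 1\<close>
          by (intro mult_mono) (auto simp: P_def)
        then show ?thesis using 1 norm_triangle_ineq4[of "conv \<phi> v x" "fourier \<phi> \<xi> * v x"] by simp
      qed
      show "?D x = 0" if "x \<notin> ?S" for x
        unfolding v_def using conv_wave_packet[OF \<phi>(1) \<rho>(2) that \<rho>(1)] by simp
    qed auto
    also have "measure lborel ?S = \<beta> * ((R + \<rho>) ^ n - (R - \<rho>) ^ n)"
    proof -
      have "measure lborel ?S = measure lborel (cball c (R + \<rho>)) - measure lborel (ball c (R - \<rho>))"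
        using fin R(2) \<rho>(1) by (intro measure_Diff) (auto simp: less_top)
      then show ?thesis
        using R(2) \<rho>(1) by (simp add: content_cball content_ball \<beta>_def n_def right_diff_distrib)
    qed
    also have "(2 * P)\<^sup>2 * (\<beta> * ((R + \<rho>) ^ n - (R - \<rho>) ^ n)) \<le> (2 * P)\<^sup>2 * (\<beta> * ((e / 4 / (2 * P))\<^sup>2 * R ^ n))"
      using R(1) \<open>\<beta> > 0\<close> by (intro mult_left_mono) auto
    also have "\<dots> = ((2 * P) * (e / 4 / (2 * P)))\<^sup>2 * (\<beta> * R ^ n)"
      by (simp only: power_mult_distrib mult_ac)
    also have "(2 * P) * (e / 4 / (2 * P)) = e / 4"
      using \<open>P > 0\<close> by simp
    also have "(e / 4)\<^sup>2 * (\<beta> * R ^ n) = (e / 4 * norm (lsq v))\<^sup>2"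
      by (simp only: norm_v power_mult_distrib)
    finally show "(norm (lsq ?D))\<^sup>2 \<le> (e / 4 * norm (lsq v))\<^sup>2" .
  qed (use \<open>e > 0\<close> in simp)
  let ?E = "\<lambda>x. (fourier \<phi> \<xi> - fourier a \<xi>) * v x"
  have c4: "norm (lsq ?E) \<le> e / 4 * norm (lsq v)"
  proof (rule lsq_norm_mono[OF L2_scale[OF vL] vL])
    have "cmod (fourier \<phi> \<xi> - fourier a \<xi>) \<le> e / 4"
      using norm_fourier_le[of "\<lambda>x. a x - \<phi> x" \<xi>] a \<phi>i \<phi>(2)
      by (simp add: fourier_diff norm_minus_commute)
    then show "cmod (?E t) \<le> e / 4 * cmod (v t)" for t
      unfolding norm_mult by (rule mult_right_mono) simp
  qed (use \<open>e > 0\<close> in simp)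
  have cL: "conv \<phi> v \<in> L2 lebesgue" by (rule conv_lebesgue_L2(1)[OF \<phi>i vL])
  have DL: "?D \<in> L2 lebesgue" by (intro L2_diff L2_scale cL vL)
  have EL: "?E \<in> L2 lebesgue" by (rule L2_scale[OF vL])
  have DE: "conv_op \<phi> (lsq v) - Re (fourier a \<xi>) *\<^sub>R lsq v = lsq ?D + lsq ?E"
  proof -
    have fa: "complex_of_real (Re (fourier a \<xi>)) = fourier a \<xi>" using real by (simp add: complex_eq_iff)
    have "conv_op \<phi> (lsq v) - Re (fourier a \<xi>) *\<^sub>R lsq v = lsq (\<lambda>x. conv \<phi> v x - fourier a \<xi> * v x)"
      using vL cL by (simp add: conv_op_lsq \<phi>i lsq_scaleR lsq_diff L2_scale fa)
    also have "\<dots> = lsq ?D + lsq ?E"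
      using DL EL by (simp add: lsq_add left_diff_distrib)
    finally show ?thesis .
  qed
  show ?thesis
  proof (rule that)
    have "\<beta> * R ^ n > 0" using \<open>\<beta> > 0\<close> R(2) \<rho>(1) by simp
    then show "lsq v \<noteq> 0" using norm_v by (metis norm_zero zero_power2 less_irrefl)
    have "conv_op a (lsq v) + mult_op V (lsq v) - Re (fourier a \<xi>) *\<^sub>R lsq v
        = (conv_op a (lsq v) - conv_op \<phi> (lsq v)) + mult_op V (lsq v) + lsq ?D + lsq ?E"
      using DE by (simp add: algebra_simps)
    also have "norm \<dots> \<le> e / 4 * norm (lsq v) + e / 4 * norm (lsq v) + e / 4 * norm (lsq v) + e / 4 * norm (lsq v)"
      by (intro norm_triangle_le add_mono c1 c2 c3 c4)
    finally show "norm (conv_op a (lsq v) + mult_op V (lsq v) - Re (fourier a \<xi>) *\<^sub>R lsq v) \<le> e * norm (lsq v)"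
      by simp
  qed
qed

text \<open>Indicators of unit balls with centres spaced 3 apart along a line are nonzero and
  pairwise orthogonal.\<close>

lemma lsq_infinite_dim:
  fixes F :: "'a::euclidean_space lsq set"
  assumes "finite F"
  shows "\<not> UNIV \<subseteq> span F"
proof
  assume span: "UNIV \<subseteq> span F"
  obtain b :: 'a where b: "norm b = 1" using vector_choose_size[of 1] by auto
  define B where "B n = cball ((3 * real n) *\<^sub>R b) 1" for n :: nat
  have disj: "B m \<inter> B n = {}" if "m \<noteq> n" for m n
  proof (rule ccontr)
    assume "B m \<inter> B n \<noteq> {}"
    then obtain t where t: "dist ((3 * real m) *\<^sub>R b) t \<le> 1" "dist ((3 * real n) *\<^sub>R b) t \<le> 1"
      by (auto simp: B_def)
    have "(3 * real m) *\<^sub>R b - (3 * real n) *\<^sub>R b = (3 * (real m - real n)) *\<^sub>R b"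
      by (simp add: algebra_simps)
    then have eq: "dist ((3 * real m) *\<^sub>R b) ((3 * real n) *\<^sub>R b) = \<bar>3 * (real m - real n)\<bar>"
      by (simp only: dist_norm norm_scaleR b mult_1_right)
    have "3 \<le> \<bar>3 * (real m - real n)\<bar>"
    proof -
      have "1 \<le> \<bar>real m - real n\<bar>" using that by linarith
      then have "3 * 1 \<le> 3 * \<bar>real m - real n\<bar>" by (rule mult_left_mono) simp
      then show ?thesis by (simp only: abs_mult abs_numeral mult_1_right)
    qed
    also have "\<dots> \<le> 1 + 1"
      unfolding eq[symmetric] by (rule order_trans[OF dist_triangle2[of _ _ t] add_mono[OF t]])
    finally show False by simp
  qed
  define u :: "nat \<Rightarrow> 'a \<Rightarrow> complex" where "u n = indicator (B n)" for n
  have [measurable]: "B n \<in> sets borel" for n by (simp add: B_def)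
  have um[measurable]: "u n \<in> borel_measurable borel" for n unfolding u_def by measurable
  have uL: "u n \<in> L2 lebesgue" for n
    by (rule lsq_norm_bounded_support(1)[where S = "B n" and d = 1, OF um])
       (auto simp: u_def indicator_def B_def emeasure_compact_finite[simplified])
  have ne: "lsq (u n) \<noteq> 0" for n
  proof -
    have "(norm (lsq (u n)))\<^sup>2 = (\<integral>t. (cmod (u n t))\<^sup>2 \<partial>lborel)"
      using uL by (simp add: lsq_norm L2_norm_on_def integral_lebesgue_borel)
    also have "\<dots> = (\<integral>t. indicator (B n) t \<partial>lborel)"
      by (intro Bochner_Integration.integral_cong refl) (simp add: u_def indicator_def)
    also have "\<dots> > 0" by (simp add: B_def)
    finally show ?thesis by auto
  qed
  have orth: "inner (lsq (u m)) (lsq (u n)) = 0" if "m \<noteq> n" for m n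
  proof -
    have "u m t \<bullet> u n t = 0" for t using disj[OF that] by (auto simp: u_def indicator_def)
    then show ?thesis using uL by (simp add: lsq_inner)
  qed
  have "inj (\<lambda>n. lsq (u n))"
  proof (rule injI)
    fix m n assume "lsq (u m) = lsq (u n)"
    then show "m = n" using orth[of m n] ne[of n] by (cases "m = n") auto
  qed
  then have "infinite (range (\<lambda>n. lsq (u n)))" by (rule range_inj_infinite)
  moreover have "independent (range (\<lambda>n. lsq (u n)))"
  proof (rule pairwise_orthogonal_independent)
    show "pairwise orthogonal (range (\<lambda>n. lsq (u n)))"
      by (rule pairwise_imageI) (simp add: orthogonal_def orth)
  qed (use ne in \<open>auto simp: image_iff\<close>)
  then have "finite (range (\<lambda>n. lsq (u n)))"
    using independent_span_bound[OF assms(1), of "range (\<lambda>n. lsq (u n))"] span by auto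
  ultimately show False by blast
qed

section \<open>The spectrum of a convolution operator with potential\<close>

text \<open>Infimum and supremum need not be attained, so l is reached only up to e. If values near
  the two ends do not already do, the intermediate value theorem gives l exactly.\<close>

lemma approximate_value:
  fixes f :: "'a::real_normed_vector \<Rightarrow> real"
  assumes cont: "continuous_on UNIV f" and "e > 0"
    and bdd: "bdd_below (range f)" "bdd_above (range f)"
    and l: "(INF x. f x) \<le> l" "l \<le> (SUP x. f x)"
  obtains x where "\<bar>f x - l\<bar> < e"
proof -
  obtain x1 where x1: "f x1 < l + e"
    using cINF_less_iff[of UNIV f "l + e"] bdd l(1) \<open>e > 0\<close> by auto
  obtain x2 where x2: "l - e < f x2"
    using less_cSUP_iff[of UNIV f "l - e"] bdd l(2) \<open>e > 0\<close> by auto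
  show ?thesis
  proof (cases "l - e < f x1 \<or> f x2 < l + e")
    case True
    then show ?thesis using x1 x2 that[of x1] that[of x2] by (auto simp: abs_less_iff)
  next
    case False
    then have "f x1 \<le> l" "l \<le> f x2" using \<open>e > 0\<close> by auto
    moreover have "connected (range f)"
      by (rule connected_continuous_image[OF cont convex_connected[OF convex_UNIV]])
    ultimately have "l \<in> range f" using connectedD_interval[of "range f" "f x1" "f x2" l] by simp
    then obtain x where "f x = l" by auto
    then show ?thesis using that[of x] \<open>e > 0\<close> by simp
  qed
qed

lemma INF_le_zero_le_SUP:
  fixes f :: "'a::real_normed_vector \<Rightarrow> real"
  assumes "bdd_below (range f)" "bdd_above (range f)" and small: "\<And>e. e > 0 \<Longrightarrow> \<exists>x. \<bar>f x\<bar> < e"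
  shows "(INF x. f x) \<le> 0" "0 \<le> (SUP x. f x)"
proof -
  show "(INF x. f x) \<le> 0"
  proof (rule field_le_epsilon)
    fix e :: real assume "e > 0"
    then obtain x where "\<bar>f x\<bar> < e" using small by blast
    then show "(INF x. f x) \<le> 0 + e" using cINF_lower[OF assms(1), of x] by simp
  qed
  show "0 \<le> (SUP x. f x)"
  proof (rule field_le_epsilon)
    fix e :: real assume "e > 0"
    then obtain x where "\<bar>f x\<bar> < e" using small by blast
    then show "0 \<le> (SUP x. f x) + e" using cSUP_upper[OF _ assms(2), of x] by simp
  qed
qed

lemma bounded_below_form:
  fixes x y :: "'a::real_inner"
  assumes "c * (norm x)\<^sup>2 \<le> \<bar>inner y x\<bar>"
  shows "c * norm x \<le> norm y"
proof (cases "x = 0")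
  case False
  have "c * norm x * norm x \<le> norm y * norm x"
    using assms Cauchy_Schwarz_ineq2[of y x] by (simp add: power2_eq_square mult.assoc)
  then show ?thesis using False by simp
qed simp

context complex_symmetric_operator
begin

text \<open>For \<open>z \<noteq> 0\<close>, \<open>- z (T - z) = (A - z) (B - z) - A B\<close>, a compact perturbation of an operator that
  is bounded below.\<close>

lemma compact_resolving_sum:
  assumes A: "bounded_linear A" and T_eq: "\<And>x. T x = A x + B x" and z: "z \<noteq> 0"
    and belowA: "c > 0" "\<And>x. c * norm x \<le> norm (A x - z *\<^sub>R x)"
    and belowB: "d > 0" "\<And>x. d * norm x \<le> norm (B x - z *\<^sub>R x)" and B: "bounded_linear B"
    and comp: "\<And>u :: nat \<Rightarrow> 'h. bounded (range u) \<Longrightarrow> \<exists>r. strict_mono r \<and> convergent (\<lambda>n. A (B (u (r n))))"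
  shows "compact_resolving z"
  unfolding compact_resolving_def
proof (intro allI impI)
  interpret A: bounded_linear A by fact
  interpret B: bounded_linear B by fact
  fix u :: "nat \<Rightarrow> 'h"
  assume u: "bounded (range u)" and lim: "(\<lambda>n. T (u n) - z *\<^sub>R u n) \<longlonglongrightarrow> 0"
  obtain r where r: "strict_mono r" "convergent (\<lambda>n. A (B (u (r n))))" using comp[OF u] by blast
  have lim_r: "(\<lambda>n. T (u (r n)) - z *\<^sub>R u (r n)) \<longlonglongrightarrow> 0"
    using LIMSEQ_subseq_LIMSEQ[OF lim r(1)] by (simp add: o_def)
  have Cauchy_below: "Cauchy w"
    if C: "Cauchy (\<lambda>n. S (w n))" and S: "\<And>x y. S (x - y) = S x - S y" and k: "k > 0" "\<And>x. k * norm x \<le> norm (S x)"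
    for S :: "'h \<Rightarrow> 'h" and w :: "nat \<Rightarrow> 'h" and k
    unfolding Cauchy_iff
  proof (intro allI impI)
    fix e :: real assume "e > 0"
    then obtain N where N: "\<And>m n. m \<ge> N \<Longrightarrow> n \<ge> N \<Longrightarrow> norm (S (w m) - S (w n)) < k * e"
      using C k(1) unfolding Cauchy_iff by (meson mult_pos_pos)
    have "norm (w m - w n) < e" if "m \<ge> N" "n \<ge> N" for m n
    proof -
      have "k * norm (w m - w n) < k * e"
        using k(2)[of "w m - w n"] N[OF that] by (simp add: S)
      then show ?thesis using k(1) by simp
    qed
    then show "\<exists>N. \<forall>m\<ge>N. \<forall>n\<ge>N. norm (w m - w n) < e" by blast
  qed
  \<comment> \<open>The lower bounds are used in turn: (A - z) w converges, so w = (B - z) u is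
    Cauchy, and then u is Cauchy along the subsequence.\<close>
  define w where "w n = B (u (r n)) - z *\<^sub>R u (r n)" for n
  have "A (w n) - z *\<^sub>R w n = A (B (u (r n))) - z *\<^sub>R (T (u (r n)) - z *\<^sub>R u (r n))" for n
    by (simp add: w_def T_eq A.diff A.scaleR algebra_simps)
  moreover have "convergent (\<lambda>n. A (B (u (r n))) - z *\<^sub>R (T (u (r n)) - z *\<^sub>R u (r n)))"
  proof -
    obtain L where "(\<lambda>n. A (B (u (r n)))) \<longlonglongrightarrow> L" using r(2) by (auto simp: convergent_def)
    from tendsto_diff[OF this tendsto_scaleR[OF tendsto_const lim_r]] show ?thesis
      by (rule convergentI)
  qed
  ultimately have "Cauchy (\<lambda>n. A (w n) - z *\<^sub>R w n)" by (simp add: convergent_Cauchy)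
  then have "Cauchy w"
    by (rule Cauchy_below) (use belowA in \<open>auto simp: A.diff scaleR_diff_right\<close>)
  then have "Cauchy (\<lambda>n. B (u (r n)) - z *\<^sub>R u (r n))" by (simp add: w_def[abs_def])
  then have "Cauchy (\<lambda>n. u (r n))"
    by (rule Cauchy_below) (use belowB in \<open>auto simp: B.diff scaleR_diff_right\<close>)
  then show "\<exists>r. strict_mono r \<and> convergent (u \<circ> r)"
    using r(1) by (auto simp: o_def intro: Cauchy_convergent)
qed

end

text \<open>A real spanning set suffices, as real coefficients are in particular complex ones. The
  representatives chosen by \<open>rep_lsq\<close> serve as generators, and \<open>lsq\<close>
  recovers the coefficient attached to each.\<close>

lemma finite_dim_ae_from_lsq:
  fixes E :: "('a::euclidean_space \<Rightarrow> complex) set"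
  assumes E: "E = {u \<in> L2 lebesgue. lsq u \<in> X}" and B: "finite B" "B \<subseteq> X" "X \<subseteq> span B"
  shows "finite_dim_ae lebesgue E"
  unfolding finite_dim_ae_def
proof (intro exI[of _ "rep_lsq ` B"] conjI ballI)
  have inj: "inj_on rep_lsq B" by (rule inj_on_inverseI[of _ lsq]) simp
  show "finite (rep_lsq ` B)" using B(1) by simp
  show "rep_lsq ` B \<subseteq> E" using B(2) by (auto simp: E rep_lsq_L2)
  fix u assume "u \<in> E"
  then have u: "u \<in> L2 lebesgue" "lsq u \<in> span B" using B(3) by (auto simp: E)
  obtain c where c: "lsq u = (\<Sum>b\<in>B. c b *\<^sub>R b)" using u(2) B(1) by (auto simp: span_finite)
  have sum: "(\<Sum>b\<in>A. c b *\<^sub>R b) = lsq (\<lambda>x. \<Sum>b\<in>A. complex_of_real (c b) * rep_lsq b x)" if "finite A" for A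
    using that
  proof (induction A rule: finite_induct)
    case (insert b A)
    have "c b *\<^sub>R b = lsq (\<lambda>x. complex_of_real (c b) * rep_lsq b x)"
      using lsq_scaleR[OF rep_lsq_L2[of b]] by simp
    with insert show ?case by (simp add: lsq_add L2_sum L2_scale rep_lsq_L2)
  qed (simp add: lsq_zero)
  have "ae_eq lebesgue u (\<lambda>x. \<Sum>b\<in>B. complex_of_real (c b) * rep_lsq b x)"
    using c sum[OF B(1)] u(1) B(1) by (subst lsq_eq_iff[symmetric]) (auto intro!: L2_sum L2_scale rep_lsq_L2)
  moreover have "(\<lambda>x. \<Sum>b\<in>B. complex_of_real (c b) * rep_lsq b x) = (\<lambda>x. \<Sum>g\<in>rep_lsq ` B. complex_of_real (c (lsq g)) * g x)"
    by (rule ext) (simp add: sum.reindex[OF inj])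
  ultimately have "ae_eq lebesgue u (\<lambda>x. \<Sum>g\<in>rep_lsq ` B. complex_of_real (c (lsq g)) * g x)" by simp
  then show "\<exists>c. ae_eq lebesgue u (\<lambda>x. \<Sum>b\<in>rep_lsq ` B. c b * b x)" by (rule exI[of _ "\<lambda>g. complex_of_real (c (lsq g))"])
qed

text \<open>A complex spanning set B would give the finite real spanning set made of B and i
  B.\<close>

lemma L2_not_finite_dim_ae: "\<not> finite_dim_ae lebesgue (L2 lebesgue :: ('a::euclidean_space \<Rightarrow> complex) set)"
proof
  assume "finite_dim_ae lebesgue (L2 lebesgue :: ('a \<Rightarrow> complex) set)"
  then obtain B where B: "finite B" "B \<subseteq> (L2 lebesgue :: ('a \<Rightarrow> complex) set)"
    "\<And>u. u \<in> L2 lebesgue \<Longrightarrow> \<exists>c. ae_eq lebesgue u (\<lambda>x. \<Sum>b\<in>B. c b * b x)"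
    unfolding finite_dim_ae_def by blast
  define F where "F = lsq ` B \<union> (\<lambda>b. lsq (\<lambda>x. \<i> * b x)) ` B"
  have sum: "lsq (\<lambda>x. \<Sum>b\<in>A. c b * b x) \<in> span F" if "finite A" "A \<subseteq> B" for A c
    using that
  proof (induction A rule: finite_induct)
    case empty
    show ?case by (simp add: lsq_zero[symmetric] span_zero)
  next
    case (insert b A)
    have bL: "b \<in> L2 lebesgue" and AL: "\<And>g. g \<in> A \<Longrightarrow> g \<in> L2 lebesgue" using insert.prems B(2) by auto
    have "lsq (\<lambda>x. c b * b x) = Re (c b) *\<^sub>R lsq b + Im (c b) *\<^sub>R lsq (\<lambda>x. \<i> * b x)"
    proof -
      have "c b * b x = complex_of_real (Re (c b)) * b x + complex_of_real (Im (c b)) * (\<i> * b x)" for x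
        by (metis (no_types) complex_eq distrib_right mult.assoc mult.commute)
      then show ?thesis using bL by (simp add: lsq_scaleR lsq_add L2_scale)
    qed
    also have "\<dots> \<in> span F"
      using insert.prems by (intro span_add span_scale span_base) (auto simp: F_def)
    finally have 1: "lsq (\<lambda>x. c b * b x) \<in> span F" .
    have "lsq (\<lambda>x. \<Sum>g\<in>insert b A. c g * g x) = lsq (\<lambda>x. c b * b x) + lsq (\<lambda>x. \<Sum>g\<in>A. c g * g x)"
      using insert.hyps bL AL by (simp add: lsq_add L2_scale L2_sum)
    then show ?case using 1 insert by (simp add: span_add)
  qed
  have "x \<in> span F" for x :: "'a lsq"
  proof -
    obtain u where u: "u \<in> L2 lebesgue" "x = lsq u" by (rule lsq_cases)
    obtain c where c: "ae_eq lebesgue u (\<lambda>x. \<Sum>b\<in>B. c b * b x)" using B(3)[OF u(1)] by blast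
    have "(\<lambda>x. \<Sum>b\<in>B. c b * b x) \<in> L2 lebesgue" using B(1,2) by (auto intro!: L2_sum L2_scale)
    then have "x = lsq (\<lambda>x. \<Sum>b\<in>B. c b * b x)" using c u by (simp add: lsq_eq_iff)
    then show ?thesis using sum[OF B(1) order_refl] by simp
  qed
  then have "UNIV \<subseteq> span F" by blast
  then show False using lsq_infinite_dim[of F] B(1) by (simp add: F_def)
qed

text \<open>Testing the form at x + A x leaves only the cross terms, which by symmetry amount to
  twice the squared norm of A x.\<close>

lemma symmetric_form_zero:
  fixes A :: "'h::real_inner \<Rightarrow> 'h"
  assumes "\<And>x y. A (x + y) = A x + A y" and sym: "\<And>x y. inner (A x) y = inner x (A y)" and form: "\<And>x. inner (A x) x = 0"
  shows "A x = 0"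
proof -
  have "inner (A (x + A x)) (x + A x) = 2 * inner (A x) (A x)"
    using form[of x] form[of "A x"] sym[of "A x" x]
    by (simp add: assms(1) inner_add_left inner_add_right inner_commute)
  then show ?thesis using form[of "x + A x"] by simp
qed


lemma fourier_cong_AE:
  fixes u v :: "real ^ 'd \<Rightarrow> complex"
  assumes [measurable]: "u \<in> borel_measurable lebesgue" "v \<in> borel_measurable lebesgue"
    and uv: "AE x in lebesgue. u x = v x"
  shows "fourier u = fourier v"
proof
  fix x :: "real ^ 'd"
  have [measurable]: "fkernel x \<in> borel_measurable lebesgue"
    by (rule borel_imp_lebesgue_measurable[OF fkernel_borel])
  show "fourier u x = fourier v x"
    unfolding fourier_def fkernel_def[symmetric] using uv by (intro integral_cong_AE) auto
qed

text \<open>V enters through the properties it has as a Fourier transform, with K an explicit bound.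
  Integrability over \<open>lborel\<close> makes a Borel measurable, so the product integrals are
  available.\<close>

locale convolution_potential =
  fixes a V :: "real ^ 'd \<Rightarrow> complex" and K :: real
  assumes a: "integrable lborel a" and hermitian: "hermitian a" and a_real: "\<And>\<xi>. Im (fourier a \<xi>) = 0"
    and V: "continuous_on UNIV V" and V_le: "\<And>t. cmod (V t) \<le> K" and V_real: "\<And>t. Im (V t) = 0"
    and V_0: "\<And>e. e > 0 \<Longrightarrow> \<exists>R. \<forall>t. R < norm t \<longrightarrow> cmod (V t) < e"
begin

definition T :: "(real ^ 'd) lsq \<Rightarrow> (real ^ 'd) lsq" where
  "T x = conv_op a x + mult_op V x"

definition J :: "(real ^ 'd) lsq \<Rightarrow> (real ^ 'd) lsq" where
  "J = mult_op (\<lambda>_. \<i>)"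

lemma V_borel: "V \<in> borel_measurable borel"
  by (rule borel_measurable_continuous_onI[OF V])

lemmas V_bounded = V_borel V_le

lemma conv_op_symmetric: "inner (conv_op a x) y = inner x (conv_op a y)"
proof -
  have [measurable]: "a \<in> borel_measurable borel" using a by auto
  have "conv_op (adj a) y = conv_op a y"
  proof -
    have "AE x in lebesgue. adj a x = a x"
      using hermitian unfolding hermitian_def adj_def by (auto elim!: eventually_mono)
    then have "conv (adj a) (rep_lsq y) = conv a (rep_lsq y)"
      using L2_measurable[OF rep_lsq_L2[of y]]
      by (intro conv_cong_AE) (auto intro!: borel_imp_lebesgue_measurable)
    then show ?thesis by (simp add: conv_op_def)
  qed
  then show ?thesis by (simp add: conv_op_adjoint[OF a])
qed

lemma mult_op_symmetric: "inner (mult_op V x) y = inner x (mult_op V y)"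
proof (rule mult_op_adjoint[OF V_bounded V_borel])
  show "cnj (V t) = V t" for t using V_real by (simp add: complex_eq_iff)
qed

lemma bounded_linear_T: "bounded_linear T"
  unfolding T_def
  by (intro bounded_linear_add bounded_linear_conv_op[OF a] bounded_linear_mult_op[OF V_bounded])

lemma J_lsq: "u \<in> L2 lebesgue \<Longrightarrow> J (lsq u) = lsq (\<lambda>t. \<i> * u t)"
  unfolding J_def by (rule mult_op_lsq[where K = 1]) auto

sublocale complex_symmetric_operator T J
proof (rule complex_symmetric_operator.intro)
  show "bounded_linear T" by (rule bounded_linear_T)
  show "inner (T x) y = inner x (T y)" for x y
    by (simp add: T_def inner_add_left inner_add_right conv_op_symmetric mult_op_symmetric)
  show "bounded_linear J"
    unfolding J_def by (rule bounded_linear_mult_op[where K = 1]) auto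
  show "J (J x) = - x" for x
  proof -
    obtain u where u: "u \<in> L2 lebesgue" "x = lsq u" by (rule lsq_cases)
    have "J (J x) = (- 1) *\<^sub>R x" using u by (simp only: J_lsq L2_scale lsq_scaleR) (simp flip: mult.assoc)
    then show ?thesis by simp
  qed
  show "inner (J x) y = - inner x (J y)" for x y
  proof -
    have "inner (J x) y = inner x (mult_op (\<lambda>_. - \<i>) y)"
      unfolding J_def by (rule mult_op_adjoint[where K = 1]) auto
    also have "mult_op (\<lambda>_. - \<i>) y = - J y"
    proof -
      obtain v where v: "v \<in> L2 lebesgue" "y = lsq v" by (rule lsq_cases)
      have "(- 1) *\<^sub>R J y = lsq (\<lambda>t. complex_of_real (- 1) * (\<i> * v t))"
        unfolding v(2) J_lsq[OF v(1)] by (rule lsq_scaleR[OF L2_scale[OF v(1)]])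
      moreover have "mult_op (\<lambda>_. - \<i>) y = lsq (\<lambda>t. - \<i> * v t)"
        unfolding v(2) by (rule mult_op_lsq[where K = 1, OF _ _ v(1)]) auto
      ultimately show ?thesis by simp
    qed
    finally show ?thesis by simp
  qed
  show "T (J x) = J (T x)" for x
  proof -
    interpret J: bounded_linear J
      unfolding J_def by (rule bounded_linear_mult_op[where K = 1]) auto
    obtain u where u: "u \<in> L2 lebesgue" "x = lsq u" by (rule lsq_cases)
    have "mult_op V (J x) = J (mult_op V x)"
      using u by (simp add: J_lsq mult_op_lsq[OF V_bounded] L2_scale mult_op_L2[OF V_bounded] mult.left_commute)
    then show ?thesis
      using conv_op_mult_const[OF a, of \<i> x, folded J_def] by (simp add: T_def J.add)
  qed
qed

lemma scaleC_lsq: "u \<in> L2 lebesgue \<Longrightarrow> scaleC z (lsq u) = lsq (\<lambda>t. z * u t)"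
proof -
  assume u: "u \<in> L2 lebesgue"
  have "z * u t = complex_of_real (Re z) * u t + complex_of_real (Im z) * (\<i> * u t)" for t
    by (metis (no_types) complex_eq distrib_right mult.assoc mult.commute)
  then show ?thesis
    using u by (simp add: scaleC_def J_lsq lsq_scaleR lsq_add L2_scale)
qed

lemma conv_potential_op_L2:
  assumes u: "u \<in> L2 lebesgue"
  shows "conv_potential_op a V u \<in> L2 lebesgue" "lsq (conv_potential_op a V u) = T (lsq u)"
proof -
  have eq: "conv_potential_op a V u = (\<lambda>x. conv a u x + V x * u x)"
    by (simp add: conv_potential_op_def conv_def)
  note L = conv_lebesgue_L2(1)[OF a u] mult_op_L2[OF V_bounded u]
  show "conv_potential_op a V u \<in> L2 lebesgue" unfolding eq by (rule L2_add[OF L])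
  show "lsq (conv_potential_op a V u) = T (lsq u)"
    unfolding eq T_def using u L a by (simp add: conv_op_lsq mult_op_lsq[OF V_bounded] lsq_add)
qed

lemma shift_lsq:
  assumes u: "u \<in> L2 lebesgue"
  shows "(\<lambda>x. conv_potential_op a V u x - z * u x) \<in> L2 lebesgue"
    "lsq (\<lambda>x. conv_potential_op a V u x - z * u x) = T (lsq u) - scaleC z (lsq u)"
proof -
  note L = conv_potential_op_L2[OF u]
  show "(\<lambda>x. conv_potential_op a V u x - z * u x) \<in> L2 lebesgue"
    by (rule L2_diff[OF L(1) L2_scale[OF u]])
  show "lsq (\<lambda>x. conv_potential_op a V u x - z * u x) = T (lsq u) - scaleC z (lsq u)"
    using lsq_diff[OF L(1) L2_scale[OF u], of z] L(2) by (simp add: scaleC_lsq[OF u])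
qed

text \<open>Every class has a representative in \<open>L2 lebesgue\<close>, so each quantifier over
  representatives becomes one over classes.\<close>

lemma resolvent_set_eq: "resolvent_set lebesgue (conv_potential_op a V) = {z. regular z}"
proof -
  have "z \<in> resolvent_set lebesgue (conv_potential_op a V) \<longleftrightarrow> regular z" for z
  proof -
    have eq: "ae_eq lebesgue (\<lambda>x. conv_potential_op a V u x - z * u x) f \<longleftrightarrow> T (lsq u) - scaleC z (lsq u) = lsq f"
      if "u \<in> L2 lebesgue" "f \<in> L2 lebesgue" for u f
      using lsq_eq_iff[OF shift_lsq(1)[OF that(1), of z] that(2)] shift_lsq(2)[OF that(1), of z] by auto
    have all: "(\<forall>v\<in>L2 lebesgue. Q (lsq v)) \<longleftrightarrow> (\<forall>v. Q v)" for Q :: "(real ^ 'd) lsq \<Rightarrow> bool"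
      by (metis lsq_cases)
    have ex: "(\<exists>v\<in>L2 lebesgue. Q (lsq v)) \<longleftrightarrow> (\<exists>v. Q v)" for Q :: "(real ^ 'd) lsq \<Rightarrow> bool"
      by (metis lsq_cases)
    have inner: "(ae_eq lebesgue (\<lambda>x. conv_potential_op a V u x - z * u x) f \<and>
          L2_norm_on lebesgue u \<le> C * L2_norm_on lebesgue f \<and>
          (\<forall>v\<in>L2 lebesgue. ae_eq lebesgue (\<lambda>x. conv_potential_op a V v x - z * v x) f \<longrightarrow> ae_eq lebesgue v u))
        \<longleftrightarrow> (T (lsq u) - scaleC z (lsq u) = lsq f \<and> norm (lsq u) \<le> C * norm (lsq f) \<and>
          (\<forall>v. T v - scaleC z v = lsq f \<longrightarrow> v = lsq u))"
      if u: "u \<in> L2 lebesgue" and f: "f \<in> L2 lebesgue" for u f C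
    proof -
      have "(\<forall>v\<in>L2 lebesgue. ae_eq lebesgue (\<lambda>x. conv_potential_op a V v x - z * v x) f \<longrightarrow> ae_eq lebesgue v u)
          \<longleftrightarrow> (\<forall>v\<in>L2 lebesgue. T (lsq v) - scaleC z (lsq v) = lsq f \<longrightarrow> lsq v = lsq u)"
        using u f by (intro ball_cong refl) (simp add: eq lsq_eq_iff)
      also have "\<dots> \<longleftrightarrow> (\<forall>v. T v - scaleC z v = lsq f \<longrightarrow> v = lsq u)" by (rule all)
      finally show ?thesis using u f by (simp add: eq lsq_norm)
    qed
    have "z \<in> resolvent_set lebesgue (conv_potential_op a V) \<longleftrightarrow>
        (\<exists>C. \<forall>f\<in>L2 lebesgue. \<exists>u\<in>L2 lebesgue. T (lsq u) - scaleC z (lsq u) = lsq f \<and> norm (lsq u) \<le> C * norm (lsq f) \<and>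
          (\<forall>v. T v - scaleC z v = lsq f \<longrightarrow> v = lsq u))"
      unfolding resolvent_set_def mem_Collect_eq
      by (intro ex_cong1 ball_cong bex_cong refl inner)
    also have "\<dots> \<longleftrightarrow> regular z"
      unfolding regular_def ex[of "\<lambda>u. T u - scaleC z u = lsq f \<and> norm u \<le> C * norm (lsq f) \<and>
          (\<forall>v. T v - scaleC z v = lsq f \<longrightarrow> v = u)" for f C]
      by (intro ex_cong1 all[of "\<lambda>f. \<exists>u. T u - scaleC z u = f \<and> norm u \<le> C * norm f \<and>
          (\<forall>v. T v - scaleC z v = f \<longrightarrow> v = u)" for C])
    finally show ?thesis .
  qed
  then show ?thesis by auto
qed

lemma spectrum_eq: "spectrum lebesgue (conv_potential_op a V) = {z. \<not> regular z}"
  by (auto simp: spectrum_def resolvent_set_eq)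

lemma eigenspace_eq:
  "eigenspace lebesgue (conv_potential_op a V) z = {u \<in> L2 lebesgue. lsq u \<in> {x. T x = scaleC z x}}"
proof -
  have "ae_eq lebesgue (conv_potential_op a V u) (\<lambda>x. z * u x) \<longleftrightarrow> T (lsq u) = scaleC z (lsq u)"
    if u: "u \<in> L2 lebesgue" for u
    using lsq_eq_iff[OF conv_potential_op_L2(1)[OF u] L2_scale[OF u, of z]] conv_potential_op_L2(2)[OF u]
    by (simp add: scaleC_lsq[OF u])
  then show ?thesis by (auto simp: eigenspace_def)
qed

lemma is_eigenvalue_iff:
  "is_eigenvalue lebesgue (conv_potential_op a V) z \<longleftrightarrow> (\<exists>x. x \<noteq> 0 \<and> T x = scaleC z x)"
proof -
  have "ae_eq lebesgue u (\<lambda>x. 0) \<longleftrightarrow> lsq u = 0" if "u \<in> L2 lebesgue" for u :: "real ^ 'd \<Rightarrow> complex"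
    using lsq_eq_iff[OF that L2_zero] by (simp add: lsq_zero)
  then show ?thesis
    unfolding is_eigenvalue_def eigenspace_eq by (auto, metis lsq_cases)
qed

section \<open>Ranges of the two functions and the segment they span\<close>

abbreviation "a_min \<equiv> real_inf (fourier a)"
abbreviation "a_max \<equiv> real_sup (fourier a)"
abbreviation "V_min \<equiv> real_inf V"
abbreviation "V_max \<equiv> real_sup V"

lemma bdd_fourier: "bdd_below (range (\<lambda>\<xi>. Re (fourier a \<xi>)))" "bdd_above (range (\<lambda>\<xi>. Re (fourier a \<xi>)))"
proof -
  have "\<bar>Re (fourier a \<xi>)\<bar> \<le> (\<integral>t. cmod (a t) \<partial>lborel)" for \<xi>
    using abs_Re_le_cmod[of "fourier a \<xi>"] norm_fourier_le[OF a, of \<xi>] by linarith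
  then have *: "- (\<integral>t. cmod (a t) \<partial>lborel) \<le> Re (fourier a \<xi>) \<and> Re (fourier a \<xi>) \<le> (\<integral>t. cmod (a t) \<partial>lborel)" for \<xi>
    by (metis abs_le_iff minus_le_iff)
  show "bdd_below (range (\<lambda>\<xi>. Re (fourier a \<xi>)))" "bdd_above (range (\<lambda>\<xi>. Re (fourier a \<xi>)))"
    using * by (auto intro!: bdd_belowI2 bdd_aboveI2)
qed

lemma bdd_V: "bdd_below (range (\<lambda>t. Re (V t)))" "bdd_above (range (\<lambda>t. Re (V t)))"
proof -
  have "\<bar>Re (V t)\<bar> \<le> K" for t
    using abs_Re_le_cmod[of "V t"] V_le[of t] by linarith
  then have *: "- K \<le> Re (V t) \<and> Re (V t) \<le> K" for t
    by (metis abs_le_iff minus_le_iff)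
  show "bdd_below (range (\<lambda>t. Re (V t)))" "bdd_above (range (\<lambda>t. Re (V t)))"
    using * by (auto intro!: bdd_belowI2 bdd_aboveI2)
qed

lemma a_bounds: "a_min \<le> Re (fourier a \<xi>)" "Re (fourier a \<xi>) \<le> a_max"
  unfolding real_inf_def real_sup_def by (auto intro!: cINF_lower cSUP_upper bdd_fourier)

lemma V_bounds: "V_min \<le> Re (V t)" "Re (V t) \<le> V_max"
  unfolding real_inf_def real_sup_def by (auto intro!: cINF_lower cSUP_upper bdd_V)

lemma vanishing_small:
  fixes f :: "real ^ 'd \<Rightarrow> complex"
  assumes "\<And>e. e > 0 \<Longrightarrow> \<exists>R. \<forall>t. R < norm t \<longrightarrow> cmod (f t) < e" "e > 0"
  shows "\<exists>t. \<bar>Re (f t)\<bar> < e"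
proof -
  obtain R where R: "\<forall>t. R < norm t \<longrightarrow> cmod (f t) < e" using assms by blast
  obtain t :: "real ^ 'd" where "norm t = \<bar>R\<bar> + 1" using vector_choose_size[of "\<bar>R\<bar> + 1"] by auto
  then have "cmod (f t) < e" using R by simp
  then show ?thesis using abs_Re_le_cmod[of "f t"] by (intro exI[of _ t]) linarith
qed

lemma a_min_max: "a_min \<le> 0" "0 \<le> a_max"
proof -
  have "\<exists>t. \<bar>Re (fourier a t)\<bar> < e" if "e > 0" for e
    by (rule vanishing_small[OF _ that]) (metis Riemann_Lebesgue[OF a])
  then show "a_min \<le> 0" "0 \<le> a_max"
    unfolding real_inf_def real_sup_def by (auto intro!: INF_le_zero_le_SUP bdd_fourier)
qed

lemma V_min_max: "V_min \<le> 0" "0 \<le> V_max"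
  unfolding real_inf_def real_sup_def
  by (auto intro!: INF_le_zero_le_SUP bdd_V vanishing_small[OF V_0])

lemma conv_form: "a_min * (norm x)\<^sup>2 \<le> inner (conv_op a x) x" "inner (conv_op a x) x \<le> a_max * (norm x)\<^sup>2"
  by (rule conv_op_form_ge[OF a a_bounds(1)], rule conv_op_form_le[OF a a_bounds(2)])

lemma mult_form: "V_min * (norm x)\<^sup>2 \<le> inner (mult_op V x) x" "inner (mult_op V x) x \<le> V_max * (norm x)\<^sup>2"
  by (rule mult_op_form_ge[OF V_bounded V_bounds(1)], rule mult_op_form_le[OF V_bounded V_bounds(2)])

lemma not_regular_approximate:
  assumes approx: "\<And>e. e > 0 \<Longrightarrow> \<exists>x. x \<noteq> 0 \<and> norm (T x - l *\<^sub>R x) \<le> e * norm x"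
  shows "\<not> regular (complex_of_real l)"
proof
  assume "regular (complex_of_real l)"
  then obtain c where c: "c > 0" "\<And>u. c * norm u \<le> norm (T u - l *\<^sub>R u)"
    by (rule regular_bounded_below) (simp add: that)
  obtain x where "x \<noteq> 0" "norm (T x - l *\<^sub>R x) \<le> c / 2 * norm x" using approx[of "c / 2"] c(1) by auto
  then have "c * norm x \<le> c / 2 * norm x" using c(2)[of x] by linarith
  then show False using c(1) \<open>x \<noteq> 0\<close> by simp
qed

lemma approximate_shift:
  assumes "norm (T x - f *\<^sub>R x) \<le> e / 2 * norm x" "\<bar>f - l\<bar> < e / 2"
  shows "norm (T x - l *\<^sub>R x) \<le> e * norm x"
proof -
  have "T x - l *\<^sub>R x = (T x - f *\<^sub>R x) + (f - l) *\<^sub>R x" by (simp add: scaleR_diff_left)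
  also have "norm \<dots> \<le> e / 2 * norm x + e / 2 * norm x"
  proof (intro norm_triangle_le add_mono assms(1))
    show "norm ((f - l) *\<^sub>R x) \<le> e / 2 * norm x"
      unfolding norm_scaleR using assms(2) by (intro mult_right_mono) auto
  qed
  finally show ?thesis by simp
qed

lemma segment_in_spectrum:
  assumes l: "min a_min V_min \<le> l" "l \<le> max a_max V_max"
  shows "\<not> regular (complex_of_real l)"
proof (rule not_regular_approximate)
  fix e :: real assume "e > 0"
  then have e2: "e / 2 > 0" by simp
  \<comment> \<open>Both intervals contain 0, so their union has no gap: for l \<le> 0 the interval
    with the smaller left end contains l, otherwise the one with the larger right end.\<close>
  consider "a_min \<le> l" "l \<le> a_max" | "V_min \<le> l" "l \<le> V_max"
    using l a_min_max V_min_max by (cases "l \<le> 0") (auto simp: min_le_iff_disj le_max_iff_disj)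
  then show "\<exists>x. x \<noteq> 0 \<and> norm (T x - l *\<^sub>R x) \<le> e * norm x"
  proof cases
    case 1
    have "continuous_on UNIV (\<lambda>\<xi>. Re (fourier a \<xi>))" by (intro continuous_intros continuous_fourier a)
    then obtain \<xi> where \<xi>: "\<bar>Re (fourier a \<xi>) - l\<bar> < e / 2"
      using approximate_value[OF _ e2 bdd_fourier] 1 unfolding real_inf_def real_sup_def by blast
    obtain x where "x \<noteq> 0" "norm (T x - Re (fourier a \<xi>) *\<^sub>R x) \<le> e / 2 * norm x"
      using approximate_eigenvector_convolution[OF a V_bounded V_0 a_real e2] unfolding T_def by blast
    then show ?thesis using approximate_shift \<xi> by blast
  next
    case 2
    have "continuous_on UNIV (\<lambda>t. Re (V t))" by (intro continuous_intros V)
    then obtain t where t: "\<bar>Re (V t) - l\<bar> < e / 2"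
      using approximate_value[OF _ e2 bdd_V] 2 unfolding real_inf_def real_sup_def by blast
    obtain x where "x \<noteq> 0" "norm (T x - Re (V t) *\<^sub>R x) \<le> e / 2 * norm x"
      using approximate_eigenvector_multiplication[OF a V V_le V_real e2] unfolding T_def by blast
    then show ?thesis using approximate_shift t by blast
  qed
qed

text \<open>The constant is the distance from z to [m, M], an interval containing the numerical
  range of B; Cauchy-Schwarz turns the bound on the form into one on the norm.\<close>

lemma form_bounded_below:
  fixes B :: "(real ^ 'd) lsq \<Rightarrow> (real ^ 'd) lsq"
  assumes "\<And>x. m * (norm x)\<^sup>2 \<le> inner (B x) x" "\<And>x. inner (B x) x \<le> M * (norm x)\<^sup>2" "z < m \<or> M < z"
  shows "\<exists>c>0. \<forall>x. c * norm x \<le> norm (B x - z *\<^sub>R x)"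
proof -
  have "max (m - z) (z - M) * norm x \<le> norm (B x - z *\<^sub>R x)" for x
  proof (rule bounded_below_form)
    have "inner (B x - z *\<^sub>R x) x = inner (B x) x - z * (norm x)\<^sup>2"
      by (simp add: inner_diff_left power2_norm_eq_inner)
    then show "max (m - z) (z - M) * (norm x)\<^sup>2 \<le> \<bar>inner (B x - z *\<^sub>R x) x\<bar>"
      using assms(1,2)[of x] by (cases "m - z \<le> z - M") (auto simp: max_def left_diff_distrib)
  qed
  moreover have "max (m - z) (z - M) > 0" using assms(3) by auto
  ultimately show ?thesis by blast
qed

lemma compact_resolving_outside:
  assumes z: "z < min a_min V_min \<or> max a_max V_max < z"
  shows "compact_resolving z"
proof -
  obtain c where c: "c > 0" "\<And>x. c * norm x \<le> norm (conv_op a x - z *\<^sub>R x)"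
    using form_bounded_below[of a_min "conv_op a" a_max z] conv_form z by auto
  obtain d where d: "d > 0" "\<And>x. d * norm x \<le> norm (mult_op V x - z *\<^sub>R x)"
    using form_bounded_below[of V_min "mult_op V" V_max z] mult_form z by auto
  show ?thesis
  proof (rule compact_resolving_sum[OF bounded_linear_conv_op[OF a] T_def _ c d bounded_linear_mult_op[OF V_bounded]])
    \<comment> \<open>The point 0 belongs to the segment, and z does not.\<close>
    show "z \<noteq> 0" using z a_min_max V_min_max by auto
    fix u :: "nat \<Rightarrow> (real ^ 'd) lsq" assume "bounded (range u)"
    then show "\<exists>r. strict_mono r \<and> convergent (\<lambda>n. conv_op a (mult_op V (u (r n))))"
      using conv_mult_compact[OF a V_bounded V_0] by metis
  qed
qed

text \<open>Nonreal points are always regular. Real points close to z are still outside the segment,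
  where only eigenvalues fail to be regular, and eigenvalues do not accumulate at z.\<close>

lemma outside_regular_nearby:
  assumes z: "z < min a_min V_min \<or> max a_max V_max < z"
  shows "\<exists>d>0. \<forall>w. w \<noteq> complex_of_real z \<longrightarrow> dist w (complex_of_real z) < d \<longrightarrow> regular w"
proof -
  obtain d where d: "d > 0" "\<And>w x. w \<noteq> z \<Longrightarrow> \<bar>w - z\<bar> < d \<Longrightarrow> T x = w *\<^sub>R x \<Longrightarrow> x = 0"
    using eigenvalues_isolated[OF compact_resolving_outside[OF z]] by blast
  obtain d' where d': "d' > 0" "\<And>w. \<bar>w - z\<bar> < d' \<Longrightarrow> w < min a_min V_min \<or> max a_max V_max < w"
  proof (cases "z < min a_min V_min")
    case True then show ?thesis by (intro that[of "min a_min V_min - z"]) (auto simp: abs_less_iff)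
  next
    case False then show ?thesis using z by (intro that[of "z - max a_max V_max"]) (auto simp: abs_less_iff)
  qed
  have "regular w" if w: "w \<noteq> complex_of_real z" "dist w (complex_of_real z) < min d d'" for w
  proof (cases "Im w = 0")
    case True
    then have eq: "w = complex_of_real (Re w)" by (simp add: complex_eq_iff)
    then have "dist w (complex_of_real z) = \<bar>Re w - z\<bar>"
      by (metis dist_norm norm_of_real of_real_diff)
    then have "Re w \<noteq> z" "\<bar>Re w - z\<bar> < d" "\<bar>Re w - z\<bar> < d'" using w eq by auto
    then have "regular (complex_of_real (Re w))"
      using d(2) d'(2) by (intro regular_real compact_resolving_outside) auto
    then show ?thesis using eq by simp
  qed (rule regular_nonreal)
  then show ?thesis using d(1) d'(1) by (intro exI[of _ "min d d'"]) auto
qed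

lemma outside_eigenvalue:
  assumes z: "z < min a_min V_min \<or> max a_max V_max < z" and "\<not> regular (complex_of_real z)"
  obtains x where "x \<noteq> 0" "T x = z *\<^sub>R x"
  using regular_real[OF compact_resolving_outside[OF z]] assms(2) that by blast

lemma eigenvalue_bounds:
  assumes "x \<noteq> 0" "T x = z *\<^sub>R x"
  shows "a_min + V_min \<le> z" "z \<le> a_max + V_max"
proof -
  have "inner (T x) x = z * (norm x)\<^sup>2" using assms(2) by (simp add: power2_norm_eq_inner)
  then have eq: "z * (norm x)\<^sup>2 = inner (conv_op a x) x + inner (mult_op V x) x"
    by (simp add: T_def inner_add_left)
  have "(a_min + V_min) * (norm x)\<^sup>2 \<le> z * (norm x)\<^sup>2" "z * (norm x)\<^sup>2 \<le> (a_max + V_max) * (norm x)\<^sup>2"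
    unfolding eq distrib_right by (intro add_mono conv_form mult_form)+
  then show "a_min + V_min \<le> z" "z \<le> a_max + V_max"
    using assms(1) by (auto simp: mult_le_cancel_right)
qed

lemma outside_discrete:
  assumes z: "z < min a_min V_min \<or> max a_max V_max < z" and nr: "\<not> regular (complex_of_real z)"
  shows "complex_of_real z \<in> discrete_spectrum lebesgue (conv_potential_op a V)"
proof -
  obtain d where d: "d > 0" "\<And>w. w \<noteq> complex_of_real z \<Longrightarrow> dist w (complex_of_real z) < d \<Longrightarrow> regular w"
    using outside_regular_nearby[OF z] by blast
  have "complex_of_real z isolated_in spectrum lebesgue (conv_potential_op a V)"
    unfolding isolated_in_def spectrum_eq
  proof (intro conjI exI)
    show "ball (complex_of_real z) d \<inter> {w. \<not> regular w} = {complex_of_real z}"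
      using nr d(1) by (auto simp: dist_commute) (use d(2) in blast)
  qed (use nr in auto)
  moreover have "is_eigenvalue lebesgue (conv_potential_op a V) (complex_of_real z)"
    using outside_eigenvalue[OF z nr] by (metis is_eigenvalue_iff scaleC_of_real)
  moreover have "finite_dim_ae lebesgue (eigenspace lebesgue (conv_potential_op a V) (complex_of_real z))"
  proof -
    obtain B where "finite B" "B \<subseteq> {x. T x = z *\<^sub>R x}" "{x. T x = z *\<^sub>R x} \<subseteq> span B"
      using finite_dim_eigenspace[OF compact_resolving_outside[OF z]] by blast
    then show ?thesis
      by (intro finite_dim_ae_from_lsq[OF eigenspace_eq]) auto
  qed
  ultimately show ?thesis by (simp add: discrete_spectrum_def)
qed

text \<open>A nondegenerate segment lies in the spectrum and has no isolated point. If the segment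
  degenerates to {0}, both quadratic forms vanish, so T = 0 and the eigenspace is all of L2, which
  has infinite dimension.\<close>

lemma segment_not_discrete:
  assumes l: "min a_min V_min \<le> l" "l \<le> max a_max V_max"
  shows "complex_of_real l \<notin> discrete_spectrum lebesgue (conv_potential_op a V)"
proof
  assume disc: "complex_of_real l \<in> discrete_spectrum lebesgue (conv_potential_op a V)"
  show False
  proof (cases "min a_min V_min < max a_max V_max")
    case True
    obtain S where S: "open S" "S \<inter> spectrum lebesgue (conv_potential_op a V) = {complex_of_real l}"
      using disc by (auto simp: discrete_spectrum_def isolated_in_def)
    then have "complex_of_real l \<in> S" by auto
    then obtain e where e: "e > 0" "ball (complex_of_real l) e \<subseteq> S" using S(1) openE by blast
    \<comment> \<open>A step of length e / 2 towards an end of the segment different from l, cut off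
      at that end.\<close>
    have "\<exists>w. w \<noteq> l \<and> \<bar>w - l\<bar> < e \<and> min a_min V_min \<le> w \<and> w \<le> max a_max V_max"
    proof (cases "l < max a_max V_max")
      case True
      then show ?thesis
        using l e(1) by (intro exI[of _ "min (l + e / 2) (max a_max V_max)"]) (auto simp: min_def max_def)
    next
      case False
      then have "min a_min V_min < l" using \<open>min a_min V_min < max a_max V_max\<close> by linarith
      then show ?thesis
        using l e(1) by (intro exI[of _ "max (l - e / 2) (min a_min V_min)"]) (auto simp: min_def max_def)
    qed
    then obtain w where w: "w \<noteq> l" "\<bar>w - l\<bar> < e" "min a_min V_min \<le> w" "w \<le> max a_max V_max" by blast
    have "complex_of_real w \<in> spectrum lebesgue (conv_potential_op a V)"
      using segment_in_spectrum[OF w(3,4)] by (simp add: spectrum_eq)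
    moreover have "dist (complex_of_real l) (complex_of_real w) = \<bar>l - w\<bar>"
      by (simp add: dist_norm flip: of_real_diff)
    then have "complex_of_real w \<in> S" using e(2) w(2) by (auto simp: abs_minus_commute)
    ultimately have "complex_of_real w = complex_of_real l" using S(2) by blast
    then show False using w(1) by simp
  next
    case False
    \<comment> \<open>The ends of the segment coincide, and 0 lies between the lower and the upper
      bound of each function.\<close>
    then have zero: "a_min = 0" "a_max = 0" "V_min = 0" "V_max = 0" "l = 0"
      using a_min_max V_min_max l by (auto simp: min_def max_def split: if_splits)
    interpret A: bounded_linear "conv_op a" by (rule bounded_linear_conv_op[OF a])
    interpret M: bounded_linear "mult_op V" by (rule bounded_linear_mult_op[OF V_bounded])
    have "conv_op a x = 0" for x
    proof (rule symmetric_form_zero[of "conv_op a"])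
      show "inner (conv_op a x) x = 0" for x using conv_form[of x] by (simp add: zero)
    qed (auto simp: A.add conv_op_symmetric)
    moreover have "mult_op V x = 0" for x
    proof (rule symmetric_form_zero[of "mult_op V"])
      show "inner (mult_op V x) x = 0" for x using mult_form[of x] by (simp add: zero)
    qed (auto simp: M.add mult_op_symmetric)
    ultimately have "T x = 0" for x by (simp add: T_def)
    then have "eigenspace lebesgue (conv_potential_op a V) (complex_of_real l) = L2 lebesgue"
      using zero(5) scaleC_of_real[of 0] by (auto simp: eigenspace_eq)
    then show False
      using disc L2_not_finite_dim_ae[where 'a = "real ^ 'd"] by (simp add: discrete_spectrum_def)
  qed
qed

lemma discrete_spectrum_cases:
  assumes "z \<in> discrete_spectrum lebesgue (conv_potential_op a V)"
  obtains l where "z = complex_of_real l" "l < min a_min V_min \<or> max a_max V_max < l"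
    "a_min + V_min \<le> l" "l \<le> a_max + V_max"
proof -
  have nr: "\<not> regular z" using assms by (auto simp: discrete_spectrum_def isolated_in_def spectrum_eq)
  then have "Im z = 0" using regular_nonreal by blast
  then have z: "z = complex_of_real (Re z)" by (simp add: complex_eq_iff)
  then have out: "Re z < min a_min V_min \<or> max a_max V_max < Re z"
    using segment_not_discrete[of "Re z"] assms by (metis not_less)
  obtain x where "x \<noteq> 0" "T x = Re z *\<^sub>R x" using outside_eigenvalue[OF out] nr z by metis
  then show ?thesis using that[OF z out] eigenvalue_bounds by blast
qed

lemma essential_spectrum_eq:
  "essential_spectrum lebesgue (conv_potential_op a V) = complex_of_real ` {min a_min V_min..max a_max V_max}"
proof (intro set_eqI iffI)
  fix z assume "z \<in> essential_spectrum lebesgue (conv_potential_op a V)"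
  then have nr: "\<not> regular z" and nd: "z \<notin> discrete_spectrum lebesgue (conv_potential_op a V)"
    by (auto simp: essential_spectrum_def spectrum_eq)
  have "Im z = 0" using nr regular_nonreal by blast
  then have z: "z = complex_of_real (Re z)" by (simp add: complex_eq_iff)
  then have "\<not> (Re z < min a_min V_min \<or> max a_max V_max < Re z)"
    using outside_discrete[of "Re z"] nr nd by metis
  then show "z \<in> complex_of_real ` {min a_min V_min..max a_max V_max}"
    using z by (intro image_eqI[of _ _ "Re z"]) (auto simp: not_less)
next
  fix z assume "z \<in> complex_of_real ` {min a_min V_min..max a_max V_max}"
  then show "z \<in> essential_spectrum lebesgue (conv_potential_op a V)"
    using segment_in_spectrum segment_not_discrete by (auto simp: essential_spectrum_def spectrum_eq)
qed

lemma discrete_spectrum_subset: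
  "discrete_spectrum lebesgue (conv_potential_op a V) \<subseteq> complex_of_real `
    ({a_min + V_min..<min a_min V_min} \<union> {max a_max V_max<..a_max + V_max})"
proof
  fix z assume "z \<in> discrete_spectrum lebesgue (conv_potential_op a V)"
  then show "z \<in> complex_of_real ` ({a_min + V_min..<min a_min V_min} \<union> {max a_max V_max<..a_max + V_max})"
    by (rule discrete_spectrum_cases) auto
qed

text \<open>The discrete spectrum is real, so a limit point is real. It is not outside the segment,
  since punctured neighbourhoods there are regular, and not interior to it, since the discrete
  spectrum avoids the segment. Only the two ends remain.\<close>

lemma discrete_spectrum_limit_points:
  assumes lim: "z islimpt discrete_spectrum lebesgue (conv_potential_op a V)"
  shows "z = complex_of_real (min a_min V_min) \<or> z = complex_of_real (max a_max V_max)"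
proof -
  let ?D = "discrete_spectrum lebesgue (conv_potential_op a V)"
  have near: "\<exists>l. complex_of_real l \<in> ?D \<and> complex_of_real l \<noteq> z \<and> dist (complex_of_real l) z < e \<and>
      (l < min a_min V_min \<or> max a_max V_max < l)" if "e > 0" for e
  proof -
    obtain w where "w \<in> ?D" "w \<noteq> z" "dist w z < e" using lim \<open>e > 0\<close> unfolding islimpt_approachable by blast
    then show ?thesis using discrete_spectrum_cases[of w] by metis
  qed
  have "Im z = 0"
  proof (rule ccontr)
    assume "Im z \<noteq> 0"
    then obtain l where "dist (complex_of_real l) z < \<bar>Im z\<bar>" using near[of "\<bar>Im z\<bar>"] by auto
    moreover have "\<bar>Im z\<bar> \<le> dist (complex_of_real l) z"
      using abs_Im_le_cmod[of "complex_of_real l - z"] by (simp add: dist_norm)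
    ultimately show False by simp
  qed
  then have z: "z = complex_of_real (Re z)" by (simp add: complex_eq_iff)
  have dist_z: "dist (complex_of_real l) z = \<bar>l - Re z\<bar>" for l
    by (subst z) (simp add: dist_norm flip: of_real_diff)
  have "\<not> (Re z < min a_min V_min \<or> max a_max V_max < Re z)"
  proof
    assume "Re z < min a_min V_min \<or> max a_max V_max < Re z"
    from outside_regular_nearby[OF this] obtain d where
      d: "d > 0" "\<And>w. w \<noteq> z \<Longrightarrow> dist w z < d \<Longrightarrow> regular w" using z by metis
    obtain l where "complex_of_real l \<in> ?D" "complex_of_real l \<noteq> z" "dist (complex_of_real l) z < d"
      using near[OF d(1)] by blast
    then have "regular (complex_of_real l)" "complex_of_real l \<in> ?D" using d(2) by auto
    then show False by (auto simp: discrete_spectrum_def isolated_in_def spectrum_eq)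
  qed
  moreover have "\<not> (min a_min V_min < Re z \<and> Re z < max a_max V_max)"
  proof
    assume *: "min a_min V_min < Re z \<and> Re z < max a_max V_max"
    then obtain l where "dist (complex_of_real l) z < min (Re z - min a_min V_min) (max a_max V_max - Re z)"
      "l < min a_min V_min \<or> max a_max V_max < l"
      using near[of "min (Re z - min a_min V_min) (max a_max V_max - Re z)"] by auto
    then show False unfolding dist_z by linarith
  qed
  ultimately have "Re z = min a_min V_min \<or> Re z = max a_max V_max" by linarith
  then show ?thesis using z by metis
qed

end

section \<open>Passage to Borel representatives and conclusion\<close>

lemma hermitian_Im_fourier:
  assumes "hermitian u" "integrable lebesgue u"
  shows "Im (fourier u x) = 0"
  using fourier_hermitian_real[OF assms] by (simp add: complex_is_Real_iff)

lemma integrable_borel_representative: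
  fixes u :: "real ^ 'd \<Rightarrow> complex"
  assumes u: "integrable lebesgue u"
  obtains v where "integrable lborel v" "AE x in lebesgue. u x = v x" "fourier v = fourier u"
proof -
  obtain v where v: "v \<in> borel_measurable borel" "AE x in lebesgue. u x = v x"
    using lebesgue_borel_representative[OF borel_measurable_integrable[OF u]] .
  have m: "u \<in> borel_measurable lebesgue" "v \<in> borel_measurable lebesgue"
    using u v(1) by (auto simp: borel_imp_lebesgue_measurable)
  have "integrable lebesgue v" using u integrable_cong_AE[OF m v(2)] by simp
  then have "integrable lborel v" using v(1) by (simp add: integrable_completion)
  then show ?thesis using that v(2) fourier_cong_AE[OF m v(2)] by simp
qed

theorem theorem2p1:
  fixes a V_hat V :: "real ^ 'd \<Rightarrow> complex"
    and a_min a_max V_min V_max \<mu>0 \<mu>1 :: real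
  assumes "integrable lebesgue a" and "hermitian a"
    and "integrable lebesgue V_hat" and "hermitian V_hat"
    and "V = fourier V_hat"
    and "a_min = real_inf (fourier a)" and "a_max = real_sup (fourier a)"
    and "V_min = real_inf V" and "V_max = real_sup V"
    and "\<mu>0 = min a_min V_min" and "\<mu>1 = max a_max V_max"
  shows "essential_spectrum lebesgue (conv_potential_op a V) = complex_of_real ` {\<mu>0..\<mu>1} \<and>
    discrete_spectrum lebesgue (conv_potential_op a V)
      \<subseteq> complex_of_real ` ({a_min + V_min..<\<mu>0} \<union> {\<mu>1<..a_max + V_max}) \<and>
    (\<forall>z. z islimpt discrete_spectrum lebesgue (conv_potential_op a V) \<longrightarrow>
      z = complex_of_real \<mu>0 \<or> z = complex_of_real \<mu>1)"
proof -
  \<comment> \<open>The locale works with a Borel kernel. Replacing a by b almost everywhere changes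
    neither the Fourier transform nor, at any point, the convolutions with L2 functions.\<close>
  obtain b where b: "integrable lborel b" "AE x in lebesgue. a x = b x" "fourier b = fourier a"
    using integrable_borel_representative[OF assms(1)] .
  obtain w where w: "integrable lborel w" "fourier w = V"
    using integrable_borel_representative[OF assms(3)] assms(5) by metis
  interpret convolution_potential b V "\<integral>x. cmod (w x) \<partial>lborel"
  proof
    show "integrable lborel b" by (rule b(1))
    have "AE x in lebesgue. a (- x) = b (- x)"
      using AE_lborel_minus[of "\<lambda>x. a x = b x" 0] b(2) by (simp add: AE_completion_iff)
    with b(2) assms(2) show "hermitian b"
      unfolding hermitian_def by eventually_elim metis
    show "Im (fourier b \<xi>) = 0" for \<xi>
      unfolding b(3) by (rule hermitian_Im_fourier[OF assms(2,1)])
    show "continuous_on UNIV V" using continuous_fourier[OF w(1)] by (simp add: w(2))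
    show "cmod (V t) \<le> (\<integral>x. cmod (w x) \<partial>lborel)" for t
      using norm_fourier_le[OF w(1)] by (simp add: w(2))
    show "Im (V t) = 0" for t
      unfolding assms(5) by (rule hermitian_Im_fourier[OF assms(4,3)])
    show "\<exists>R. \<forall>t. R < norm t \<longrightarrow> cmod (V t) < e" if "e > 0" for e
      using Riemann_Lebesgue[OF w(1) that] unfolding w(2) by metis
  qed
  \<comment> \<open>Agreement on \<open>L2 lebesgue\<close> is enough, because resolvent set and
    eigenspaces evaluate the operator only there.\<close>
  have op: "conv_potential_op a V u = conv_potential_op b V u" if "u \<in> L2 lebesgue" for u
  proof -
    have "conv a u = conv b u"
      using b(1,2) assms(1) L2_measurable[OF that]
      by (intro conv_cong_AE) (auto intro!: borel_imp_lebesgue_measurable)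
    then show ?thesis unfolding conv_potential_op_def conv_def by metis
  qed
  have "resolvent_set lebesgue (conv_potential_op a V) = resolvent_set lebesgue (conv_potential_op b V)"
    by (simp add: resolvent_set_def op cong: bex_cong ball_cong)
  then have spec: "spectrum lebesgue (conv_potential_op a V) = spectrum lebesgue (conv_potential_op b V)"
    by (simp add: spectrum_def)
  have eig: "eigenspace lebesgue (conv_potential_op a V) z = eigenspace lebesgue (conv_potential_op b V) z" for z
    by (auto simp: eigenspace_def op)
  have disc: "discrete_spectrum lebesgue (conv_potential_op a V) = discrete_spectrum lebesgue (conv_potential_op b V)"
    by (simp add: discrete_spectrum_def is_eigenvalue_def spec eig)
  have ess: "essential_spectrum lebesgue (conv_potential_op a V) = essential_spectrum lebesgue (conv_potential_op b V)"
    by (simp add: essential_spectrum_def spec disc)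
  show ?thesis
    unfolding ess disc assms(6-11) b(3)[symmetric]
    by (intro conjI allI impI essential_spectrum_eq discrete_spectrum_subset discrete_spectrum_limit_points)
qed

end
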